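(* Let $\mathrm{H}$ be a homology functor with field coefficients and $\mathbb{X}=(X,f)$ an $\mathbb{R}$-space whose levelsets $f^{-1}(q)$, $q\in\mathbb{R}$, are $\mathrm{H}$-taut. Then for every degree $i$, as functions of rectangles $[a,b]\times[c,d]$ with real numbers $a<b<c<d$, $$\mu^{\backslash\backslash}_i=\mu^{\mathrm{Ord}}_i,\qquad \mu^{//}_i=\mu^{\mathrm{Rel}}_{i+1},\qquad \mu^{\backslash/}_i=\mu^{\mathrm{Ext}^+}_i,\qquad \mu^{/\backslash}_i=\mu^{\mathrm{Ext}^-}_{i+1}.$$
   Context: An $\mathbb{R}$-space is a pair $\mathbb{X}=(X,f)$ with $X$ a topological space and $f:X\to\mathbb{R}$ continuous. Put $\mathbb{X}_a^b=f^{-1}([a,b])$, $\mathbb{X}^a=f^{-1}(-\infty,a]$, $\mathbb{X}_a=f^{-1}[a,+\infty)$. Here $\mathrm{H}=(\mathrm{H}_i)_i$ is a homology theory (Eilenberg–Steenrod axioms) with coefficients in a field $\mathbf{k}$. A zigzag module $\mathbb{V}$ of length $n$ is a sequence of $\mathbf{k}$-vector spaces $V_1,\dots,V_n$ with, for each $i$, one linear map between $V_i$ and $V_{i+1}$ (either direction). The interval module on $[V_p,V_q]$ has $\mathbf{k}$ at positions $p,\dots,q$, zero elsewhere, and identity maps between consecutive copies of $\mathbf{k}$. Every zigzag module is a direct sum of interval modules, uniquely up to reordering; the multiplicity $\langle[V_p,V_q]\mid\mathbb{V}\rangle\in\{0,1,\dots,\infty\}$ is the number of copies (infinite cardinals not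 distinguished). Parametrized homology measures: for $R=[a,b]\times[c,d]$ consider the zigzag module (maps induced by inclusions) $$\mathrm{H}_i(\mathbb{X}_a^a)\to\mathrm{H}_i(\mathbb{X}_a^b)\leftarrow\mathrm{H}_i(\mathbb{X}_b^b)\to\mathrm{H}_i(\mathbb{X}_b^c)\leftarrow\mathrm{H}_i(\mathbb{X}_c^c)\to\mathrm{H}_i(\mathbb{X}_c^d)\leftarrow\mathrm{H}_i(\mathbb{X}_d^d).$$ The following are multiplicities in it: $\mu^{/\backslash}_i(R)=\langle[\mathrm{H}_i(\mathbb{X}_b^b),\mathrm{H}_i(\mathbb{X}_c^c)]\rangle$, $\mu^{\backslash\backslash}_i(R)=\langle[\mathrm{H}_i(\mathbb{X}_a^b),\mathrm{H}_i(\mathbb{X}_c^c)]\rangle$, $\mu^{//}_i(R)=\langle[\mathrm{H}_i(\mathbb{X}_b^b),\mathrm{H}_i(\mathbb{X}_c^d)]\rangle$, $\mu^{\backslash/}_i(R)=\langle[\mathrm{H}_i(\mathbb{X}_a^b),\mathrm{H}_i(\mathbb{X}_c^d)]\rangle$. Extended persistence measures: consider the persistence module obtained by applying $\mathrm{H}_i$ to $$\mathbb{X}^a\to\mathbb{X}^b\to\mathbb{X}^c\to\mathbb{X}^d\to(X,\mathbb{X}_d)\to(X,\mathbb{X}_c)\to(X,\mathbb{X}_b)\to(X,\mathbb{X}_a).$$ The following are multiplicities in this module of interval modules with the given first and last nonzero nodes: $\mu^{\mathrm{Ord}}_i(R)$: from $\mathrm{H}_i(\mathbb{X}^b)$ to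 $\mathrm{H}_i(\mathbb{X}^c)$; $\mu^{\mathrm{Rel}}_i(R)$: from $\mathrm{H}_i(X,\mathbb{X}_c)$ to $\mathrm{H}_i(X,\mathbb{X}_b)$; $\mu^{\mathrm{Ext}^+}_i(R)$: from $\mathrm{H}_i(\mathbb{X}^b)$ to $\mathrm{H}_i(X,\mathbb{X}_d)$; $\mu^{\mathrm{Ext}^-}_i(R)$: from $\mathrm{H}_i(\mathbb{X}^d)$ to $\mathrm{H}_i(X,\mathbb{X}_b)$. Tautness. A normal neighborhood of $\mathbb{X}_q^q$ in $X$ is a neighborhood that contains a closed neighborhood. For a neighborhood $U$ of $\mathbb{X}_q^q$ put $A=U\cap\mathbb{X}^q$, $B=U\cap\mathbb{X}_q$. The levelset $\mathbb{X}_q^q$ is $\mathrm{H}$-taut if for every normal neighborhood $U$ (equivalently, some normal neighborhood $U$) the inclusion-induced maps $\mathrm{H}_k(A,\mathbb{X}_q^q)\to\mathrm{H}_k(U,B)$ are isomorphisms for all degrees $k$. *)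

theory Defs
  imports
    "HOL-Analysis.Analysis"
    "HOL-Library.Extended_Nat"
    "HOL-Library.Function_Algebras"
begin

section \<open>Linear maps between subspaces\<close>

text \<open>
  A vector space is a subspace of an ambient space \<open>'v\<close> with a scalar multiplication over the
  field \<open>'k\<close>. Every set-indexed family of vector spaces embeds into one ambient space (its direct
  sum), and no two members of a family are assumed to be related inside it. Maps are only
  meaningful on the subspace that is their domain.
\<close>

definition linear_between ::
  "('k \<Rightarrow> 'v \<Rightarrow> 'v) \<Rightarrow> ('k \<Rightarrow> 'w \<Rightarrow> 'w) \<Rightarrow>
   ('v::ab_group_add) set \<Rightarrow> ('w::ab_group_add) set \<Rightarrow> ('v \<Rightarrow> 'w) \<Rightarrow> bool" where
  "linear_between s1 s2 V W g \<longleftrightarrow>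
     (\<forall>x\<in>V. g x \<in> W) \<and>
     (\<forall>x\<in>V. \<forall>y\<in>V. g (x + y) = g x + g y) \<and>
     (\<forall>c. \<forall>x\<in>V. g (s1 c x) = s2 c (g x))"

definition ecard :: "'b set \<Rightarrow> enat" where
  "ecard S = (if finite S then enat (card S) else \<infinity>)"


section \<open>Zigzag modules, interval modules and multiplicities\<close>

text \<open>
  The positions are \<open>1, \<dots>, zz_length V\<close>. For \<open>1 \<le> j < zz_length V\<close> the map \<open>zz_map V j\<close> goes from
  position \<open>j\<close> to \<open>j + 1\<close> if \<open>zz_forward V j\<close> holds and from \<open>j + 1\<close> to \<open>j\<close> otherwise.
  A persistence module is the case in which all maps are forward.
\<close>

record 'v zigzag =
  zz_length :: nat
  zz_space :: "nat \<Rightarrow> 'v set"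
  zz_forward :: "nat \<Rightarrow> bool"
  zz_map :: "nat \<Rightarrow> 'v \<Rightarrow> 'v"

definition zz_source :: "'v zigzag \<Rightarrow> nat \<Rightarrow> 'v set" where
  "zz_source V j = (if zz_forward V j then zz_space V j else zz_space V (j + 1))"

definition zz_target :: "'v zigzag \<Rightarrow> nat \<Rightarrow> 'v set" where
  "zz_target V j = (if zz_forward V j then zz_space V (j + 1) else zz_space V j)"

definition zigzag_module :: "('k::field \<Rightarrow> 'v \<Rightarrow> 'v) \<Rightarrow> ('v::ab_group_add) zigzag \<Rightarrow> bool" where
  "zigzag_module smul V \<longleftrightarrow>
     (\<forall>j\<in>{1..zz_length V}. module.subspace smul (zz_space V j)) \<and>
     (\<forall>j\<in>{1..<zz_length V}. linear_between smul smul (zz_source V j) (zz_target V j) (zz_map V j))"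

definition zigzag_iso ::
  "('k \<Rightarrow> 'v \<Rightarrow> 'v) \<Rightarrow> ('k \<Rightarrow> 'w \<Rightarrow> 'w) \<Rightarrow>
   ('v::ab_group_add) zigzag \<Rightarrow> ('w::ab_group_add) zigzag \<Rightarrow> bool" where
  "zigzag_iso s1 s2 V W \<longleftrightarrow>
     zz_length V = zz_length W \<and>
     (\<forall>j\<in>{1..<zz_length V}. zz_forward V j = zz_forward W j) \<and>
     (\<exists>\<phi>. (\<forall>j\<in>{1..zz_length V}.
             linear_between s1 s2 (zz_space V j) (zz_space W j) (\<phi> j) \<and>
             bij_betw (\<phi> j) (zz_space V j) (zz_space W j)) \<and>
          (\<forall>j\<in>{1..<zz_length V}. \<forall>x\<in>zz_source V j.
             if zz_forward V j then \<phi> (j + 1) (zz_map V j x) = zz_map W j (\<phi> j x)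
             else \<phi> j (zz_map V j x) = zz_map W j (\<phi> (j + 1) x)))"

definition interval_module :: "nat \<Rightarrow> (nat \<Rightarrow> bool) \<Rightarrow> nat \<Rightarrow> nat \<Rightarrow> ('k::field) zigzag" where
  "interval_module n fwd p q =
     \<lparr>zz_length = n,
      zz_space = (\<lambda>j. if p \<le> j \<and> j \<le> q then UNIV else {0}),
      zz_forward = fwd,
      zz_map = (\<lambda>j x. if p \<le> j \<and> j + 1 \<le> q then x else 0)\<rparr>"

text \<open>The (external) direct sum of the modules \<open>M s\<close>, \<open>s \<in> S\<close>, all of length \<open>n\<close> and with the
  directions \<open>fwd\<close>: its elements are the finitely supported families.\<close>

definition zigzag_sum ::
  "nat \<Rightarrow> (nat \<Rightarrow> bool) \<Rightarrow> 's set \<Rightarrow> ('s \<Rightarrow> ('w::zero) zigzag) \<Rightarrow> ('s \<Rightarrow> 'w) zigzag" where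
  "zigzag_sum n fwd S M =
     \<lparr>zz_length = n,
      zz_space = (\<lambda>j. {x. finite {s. x s \<noteq> 0} \<and> (\<forall>s\<in>S. x s \<in> zz_space (M s) j) \<and> (\<forall>s. s \<notin> S \<longrightarrow> x s = 0)}),
      zz_forward = fwd,
      zz_map = (\<lambda>j x s. if s \<in> S then zz_map (M s) j (x s) else 0)\<rparr>"

text \<open>
  A decomposition of \<open>V\<close> into interval modules is given by a set \<open>S\<close> of labels: each
  \<open>(p, q, x) \<in> S\<close> stands for one copy of the interval module on positions \<open>p, \<dots>, q\<close>, and \<open>x\<close> only
  serves to tell copies apart. Taking \<open>x\<close> from \<open>'v\<close> loses nothing, because the number of
  copies is at most the dimension of \<open>zz_space V p\<close>.
\<close>

definition interval_decomposition ::
  "('k::field \<Rightarrow> 'v \<Rightarrow> 'v) \<Rightarrow> ('v::ab_group_add) zigzag \<Rightarrow> (nat \<times> nat \<times> 'v) set \<Rightarrow> bool" where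
  "interval_decomposition smul V S \<longleftrightarrow>
     (\<forall>(p, q, x)\<in>S. 1 \<le> p \<and> p \<le> q \<and> q \<le> zz_length V) \<and>
     zigzag_iso smul (\<lambda>c x s. c * x s) V
       (zigzag_sum (zz_length V) (zz_forward V) S
          (\<lambda>(p, q, x). interval_module (zz_length V) (zz_forward V) p q :: 'k zigzag))"

definition multiplicity_of ::
  "('k::field \<Rightarrow> 'v \<Rightarrow> 'v) \<Rightarrow> ('v::ab_group_add) zigzag \<Rightarrow> nat \<Rightarrow> nat \<Rightarrow> enat" where
  "multiplicity_of smul V p q =
     (THE m. \<exists>S. interval_decomposition smul V S \<and> m = ecard {x. (p, q, x) \<in> S})"


section \<open>Homology theories\<close>

definition pair_map :: "'a topology \<Rightarrow> 'a set \<Rightarrow> 'a topology \<Rightarrow> 'a set \<Rightarrow> ('a \<Rightarrow> 'a) \<Rightarrow> bool" where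
  "pair_map X A Y B g \<longleftrightarrow>
     A \<subseteq> topspace X \<and> B \<subseteq> topspace Y \<and> continuous_map X Y g \<and> g ` A \<subseteq> B"

text \<open>
  The Eilenberg--Steenrod axioms with coefficients in the field \<open>'k\<close>, for pairs of spaces with
  points in \<open>'a\<close>; the absolute homology of \<open>X\<close> is that of \<open>(X, {})\<close>. A theory graded by the
  natural numbers is extended by zero to negative degrees. Maps of pairs that agree on the
  underlying space induce the same map by the homotopy axiom.
\<close>

locale homology_theory = vector_space smul
  for smul :: "'k::field \<Rightarrow> 'v::ab_group_add \<Rightarrow> 'v" +
  fixes H :: "int \<Rightarrow> 'a topology \<Rightarrow> 'a set \<Rightarrow> 'v set"
    and Hmap :: "int \<Rightarrow> 'a topology \<Rightarrow> 'a set \<Rightarrow> 'a topology \<Rightarrow> 'a set \<Rightarrow> ('a \<Rightarrow> 'a) \<Rightarrow> 'v \<Rightarrow> 'v"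
    and bd :: "int \<Rightarrow> 'a topology \<Rightarrow> 'a set \<Rightarrow> 'v \<Rightarrow> 'v"
  assumes H_subspace: "A \<subseteq> topspace X \<Longrightarrow> module.subspace smul (H k X A)"
    and Hmap_linear:
      "pair_map X A Y B g \<Longrightarrow> linear_between smul smul (H k X A) (H k Y B) (Hmap k X A Y B g)"
    and bd_linear:
      "A \<subseteq> topspace X \<Longrightarrow>
         linear_between smul smul (H k X A) (H (k - 1) (subtopology X A) {}) (bd k X A)"
    and Hmap_id: "A \<subseteq> topspace X \<Longrightarrow> x \<in> H k X A \<Longrightarrow> Hmap k X A X A id x = x"
    and Hmap_comp:
      "pair_map X A Y B g \<Longrightarrow> pair_map Y B Z C h \<Longrightarrow> x \<in> H k X A \<Longrightarrow>
         Hmap k X A Z C (h \<circ> g) x = Hmap k Y B Z C h (Hmap k X A Y B g x)"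
    and bd_natural:
      "pair_map X A Y B g \<Longrightarrow> x \<in> H k X A \<Longrightarrow>
         bd k Y B (Hmap k X A Y B g x) =
         Hmap (k - 1) (subtopology X A) {} (subtopology Y B) {} g (bd k X A x)"
    and homotopy_axiom:
      "pair_map X A Y B g \<Longrightarrow> pair_map X A Y B h \<Longrightarrow>
         homotopic_with (\<lambda>r. r ` A \<subseteq> B) X Y g h \<Longrightarrow> x \<in> H k X A \<Longrightarrow>
         Hmap k X A Y B g x = Hmap k X A Y B h x"
    and exact_at_space:
      "A \<subseteq> topspace X \<Longrightarrow>
         Hmap k (subtopology X A) {} X {} id ` H k (subtopology X A) {} =
         {x \<in> H k X {}. Hmap k X {} X A id x = 0}"
    and exact_at_pair:
      "A \<subseteq> topspace X \<Longrightarrow> Hmap k X {} X A id ` H k X {} = {x \<in> H k X A. bd k X A x = 0}"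
    and exact_at_subspace:
      "A \<subseteq> topspace X \<Longrightarrow>
         bd k X A ` H k X A =
         {x \<in> H (k - 1) (subtopology X A) {}. Hmap (k - 1) (subtopology X A) {} X {} id x = 0}"
    and excision_axiom:
      "A \<subseteq> topspace X \<Longrightarrow> openin X W \<Longrightarrow> X closure_of W \<subseteq> X interior_of A \<Longrightarrow>
         bij_betw (Hmap k (subtopology X (topspace X - W)) (A - W) X A id)
           (H k (subtopology X (topspace X - W)) (A - W)) (H k X A)"
    and dimension_axiom: "topspace X = {pt} \<Longrightarrow> k \<noteq> 0 \<Longrightarrow> H k X {} = {0}"
    and coefficients: "topspace X = {pt} \<Longrightarrow> vector_space.dim smul (H 0 X {}) = 1"


section \<open>Slices of an R-space and tautness of levelsets\<close>

definition slice :: "'a topology \<Rightarrow> ('a \<Rightarrow> real) \<Rightarrow> real set \<Rightarrow> 'a set" where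
  "slice X f I = {x \<in> topspace X. f x \<in> I}"

definition normal_neighbourhood :: "'a topology \<Rightarrow> 'a set \<Rightarrow> 'a set \<Rightarrow> bool" where
  "normal_neighbourhood X L U \<longleftrightarrow>
     U \<subseteq> topspace X \<and> (\<exists>C. closedin X C \<and> L \<subseteq> X interior_of C \<and> C \<subseteq> U)"

definition taut_levelset ::
  "(int \<Rightarrow> 'a topology \<Rightarrow> 'a set \<Rightarrow> 'v set) \<Rightarrow>
   (int \<Rightarrow> 'a topology \<Rightarrow> 'a set \<Rightarrow> 'a topology \<Rightarrow> 'a set \<Rightarrow> ('a \<Rightarrow> 'a) \<Rightarrow> 'v \<Rightarrow> 'v) \<Rightarrow>
   'a topology \<Rightarrow> ('a \<Rightarrow> real) \<Rightarrow> real \<Rightarrow> bool" where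
  "taut_levelset H Hmap X f q \<longleftrightarrow>
     (\<forall>U. normal_neighbourhood X (slice X f {q}) U \<longrightarrow>
       (let L = slice X f {q}; A = U \<inter> slice X f {..q}; B = U \<inter> slice X f {q..}
        in \<forall>k. bij_betw (Hmap k (subtopology X A) L (subtopology X U) B id)
                 (H k (subtopology X A) L) (H k (subtopology X U) B)))"


section \<open>The measures\<close>

text \<open>The zigzag module obtained by applying homology in degree \<open>i\<close> to a list of pairs of subsets of
  \<open>X\<close>, consecutive ones being related by an inclusion in the direction prescribed by \<open>fwd\<close>.\<close>

definition homology_zigzag ::
  "(int \<Rightarrow> 'a topology \<Rightarrow> 'a set \<Rightarrow> 'v set) \<Rightarrow>
   (int \<Rightarrow> 'a topology \<Rightarrow> 'a set \<Rightarrow> 'a topology \<Rightarrow> 'a set \<Rightarrow> ('a \<Rightarrow> 'a) \<Rightarrow> 'v \<Rightarrow> 'v) \<Rightarrow>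
   int \<Rightarrow> 'a topology \<Rightarrow> (nat \<Rightarrow> bool) \<Rightarrow> ('a set \<times> 'a set) list \<Rightarrow> 'v zigzag" where
  "homology_zigzag H Hmap i X fwd ps =
     (let S = (\<lambda>j. subtopology X (fst (ps ! (j - 1)))); A = (\<lambda>j. snd (ps ! (j - 1)))
      in \<lparr>zz_length = length ps,
          zz_space = (\<lambda>j. H i (S j) (A j)),
          zz_forward = fwd,
          zz_map = (\<lambda>j. if fwd j then Hmap i (S j) (A j) (S (j + 1)) (A (j + 1)) id
                        else Hmap i (S (j + 1)) (A (j + 1)) (S j) (A j) id)\<rparr>)"

definition levelset_zigzag ::
  "(int \<Rightarrow> 'a topology \<Rightarrow> 'a set \<Rightarrow> 'v set) \<Rightarrow>
   (int \<Rightarrow> 'a topology \<Rightarrow> 'a set \<Rightarrow> 'a topology \<Rightarrow> 'a set \<Rightarrow> ('a \<Rightarrow> 'a) \<Rightarrow> 'v \<Rightarrow> 'v) \<Rightarrow>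
   int \<Rightarrow> 'a topology \<Rightarrow> ('a \<Rightarrow> real) \<Rightarrow> real \<Rightarrow> real \<Rightarrow> real \<Rightarrow> real \<Rightarrow> 'v zigzag" where
  "levelset_zigzag H Hmap i X f a b c d =
     homology_zigzag H Hmap i X odd
       [(slice X f {a..a}, {}), (slice X f {a..b}, {}), (slice X f {b..b}, {}),
        (slice X f {b..c}, {}), (slice X f {c..c}, {}), (slice X f {c..d}, {}),
        (slice X f {d..d}, {})]"

definition extended_module ::
  "(int \<Rightarrow> 'a topology \<Rightarrow> 'a set \<Rightarrow> 'v set) \<Rightarrow>
   (int \<Rightarrow> 'a topology \<Rightarrow> 'a set \<Rightarrow> 'a topology \<Rightarrow> 'a set \<Rightarrow> ('a \<Rightarrow> 'a) \<Rightarrow> 'v \<Rightarrow> 'v) \<Rightarrow>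
   int \<Rightarrow> 'a topology \<Rightarrow> ('a \<Rightarrow> real) \<Rightarrow> real \<Rightarrow> real \<Rightarrow> real \<Rightarrow> real \<Rightarrow> 'v zigzag" where
  "extended_module H Hmap i X f a b c d =
     homology_zigzag H Hmap i X (\<lambda>_. True)
       [(slice X f {..a}, {}), (slice X f {..b}, {}), (slice X f {..c}, {}), (slice X f {..d}, {}),
        (topspace X, slice X f {d..}), (topspace X, slice X f {c..}),
        (topspace X, slice X f {b..}), (topspace X, slice X f {a..})]"

lemma (in homology_theory) zigzag_module_homology_zigzag:
  assumes "\<And>j. j < length ps \<Longrightarrow> snd (ps ! j) \<subseteq> fst (ps ! j) \<and> fst (ps ! j) \<subseteq> topspace X"
    and "\<And>j. Suc j < length ps \<Longrightarrow> fwd (Suc j) \<Longrightarrow>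
           fst (ps ! j) \<subseteq> fst (ps ! Suc j) \<and> snd (ps ! j) \<subseteq> snd (ps ! Suc j)"
    and "\<And>j. Suc j < length ps \<Longrightarrow> \<not> fwd (Suc j) \<Longrightarrow>
           fst (ps ! Suc j) \<subseteq> fst (ps ! j) \<and> snd (ps ! Suc j) \<subseteq> snd (ps ! j)"
  shows "zigzag_module smul (homology_zigzag H Hmap i X fwd ps)"
proof -
  have pm: "pair_map (subtopology X S) A (subtopology X T) B id"
    if "A \<subseteq> S" "B \<subseteq> T" "S \<subseteq> topspace X" "T \<subseteq> topspace X" "S \<subseteq> T" "A \<subseteq> B" for S T A B
    using that unfolding pair_map_def
    by (auto simp: continuous_map_in_subtopology continuous_map_from_subtopology)
  have sub: "module.subspace smul (zz_space (homology_zigzag H Hmap i X fwd ps) j)"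
    if "j \<in> {1..length ps}" for j
  proof -
    have "j - 1 < length ps" using that by auto
    from assms(1)[OF this]
    have "snd (ps ! (j - 1)) \<subseteq> topspace (subtopology X (fst (ps ! (j - 1))))" by auto
    from H_subspace[OF this] show ?thesis
      unfolding homology_zigzag_def Let_def by simp
  qed
  have lin: "linear_between smul smul (zz_source (homology_zigzag H Hmap i X fwd ps) j)
      (zz_target (homology_zigzag H Hmap i X fwd ps) j) (zz_map (homology_zigzag H Hmap i X fwd ps) j)"
    if j: "j \<in> {1..<length ps}" for j
  proof -
    obtain m where m: "j = Suc m" "Suc m < length ps" using j by (cases j) auto
    then have "m < length ps" by simp
    note facts = assms(1)[OF this] assms(1)[OF m(2)] assms(2)[OF m(2)] assms(3)[OF m(2)]
    show ?thesis
      unfolding homology_zigzag_def Let_def zz_source_def zz_target_def m(1)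
      using facts by (cases "fwd (Suc m)") (auto intro!: Hmap_linear pm)
  qed
  have "zz_length (homology_zigzag H Hmap i X fwd ps) = length ps"
    by (simp add: homology_zigzag_def Let_def)
  with sub lin show ?thesis unfolding zigzag_module_def by auto
qed

lemma (in homology_theory) zigzag_module_levelset_zigzag:
  assumes "a < b" "b < c" "c < d"
  shows "zigzag_module smul (levelset_zigzag H Hmap i X f a b c d)"
  unfolding levelset_zigzag_def
  by (rule zigzag_module_homology_zigzag)
    (use assms in \<open>auto simp: slice_def less_Suc_eq nth_Cons' split: if_splits\<close>)

lemma (in homology_theory) zigzag_module_extended_module:
  assumes "a < b" "b < c" "c < d"
  shows "zigzag_module smul (extended_module H Hmap i X f a b c d)"
  unfolding extended_module_def
  by (rule zigzag_module_homology_zigzag)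
    (use assms in \<open>auto simp: slice_def less_Suc_eq nth_Cons' split: if_splits\<close>)

text \<open>In the names \<open>D\<close> (``down'') stands for a backslash and \<open>U\<close> (``up'') for a forward slash.\<close>

context
  fixes smul :: "'k::field \<Rightarrow> 'v::ab_group_add \<Rightarrow> 'v"
    and H :: "int \<Rightarrow> 'a topology \<Rightarrow> 'a set \<Rightarrow> 'v set"
    and Hmap :: "int \<Rightarrow> 'a topology \<Rightarrow> 'a set \<Rightarrow> 'a topology \<Rightarrow> 'a set \<Rightarrow> ('a \<Rightarrow> 'a) \<Rightarrow> 'v \<Rightarrow> 'v"
    and X :: "'a topology" and f :: "'a \<Rightarrow> real" and i :: int and a b c d :: real
begin

definition mu_UD :: enat where
  "mu_UD = multiplicity_of smul (levelset_zigzag H Hmap i X f a b c d) 3 5"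

definition mu_DD :: enat where
  "mu_DD = multiplicity_of smul (levelset_zigzag H Hmap i X f a b c d) 2 5"

definition mu_UU :: enat where
  "mu_UU = multiplicity_of smul (levelset_zigzag H Hmap i X f a b c d) 3 6"

definition mu_DU :: enat where
  "mu_DU = multiplicity_of smul (levelset_zigzag H Hmap i X f a b c d) 2 6"

definition mu_Ord :: enat where
  "mu_Ord = multiplicity_of smul (extended_module H Hmap i X f a b c d) 2 3"

definition mu_Rel :: enat where
  "mu_Rel = multiplicity_of smul (extended_module H Hmap i X f a b c d) 6 7"

definition mu_Ext_plus :: enat where
  "mu_Ext_plus = multiplicity_of smul (extended_module H Hmap i X f a b c d) 2 5"

definition mu_Ext_minus :: enat where
  "mu_Ext_minus = multiplicity_of smul (extended_module H Hmap i X f a b c d) 4 7"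

end

end

theory Submission
  imports Defs
begin

text \<open>
  The multiplicity of \<open>[p, q]\<close> in a zigzag module is the dimension of a subquotient of the space
  at any position \<open>t\<close> between \<open>p\<close> and \<open>q\<close>: intersect the two chains of subspaces of elements that
  live back to \<open>p\<close>, respectively on to \<open>q\<close>, and divide by the contributions of their predecessors.
  Tautness says that cutting a slice at a level \<open>q\<close> is excisive, so that two pieces meeting in the
  levelset of \<open>q\<close> satisfy Mayer--Vietoris exactness. Each of the four equalities then follows from a
  linear relation between a levelset group and a group of the extended module that matches the
  two subquotients: restriction to a sublevelset for Ord and Ext+, the connecting map of the pair
  for Rel, and the Mayer--Vietoris connecting map for Ext-.
\<close>

section \<open>Dimensions of subquotients\<close>

text \<open>Homology groups may be infinite-dimensional, so ranks cannot be added and subtracted;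
  every comparison has to be an isomorphism of subquotients. For Rel and Ext- this isomorphism is
  not visibly induced by a map in either direction, since partners are found through exact sequences
  and are determined only up to the choice of a preimage. Linear relations absorb these choices:
  three elementwise conditions suffice for an isomorphism of quotients. The definite description in
  \<open>multiplicity_of\<close> moreover demands that a decomposition into intervals exists and
  that all decompositions give the same count. The count is forced because the subquotient of a
  direct sum of intervals is spanned by coordinate vectors. A decomposition is built by lifting
  bases of the subquotients along the arrows; the two chains, being totally ordered by ranks, make
  the lifted bases fit together at every position.\<close>

text \<open>The library interprets \<^locale>\<open>vector_space\<close> for real scalars without a mandatory qualifier, so that
  constants added to that locale would be shadowed.\<close>

locale scalar_space = vector_space scale
  for scale :: "'k::field \<Rightarrow> 'b::ab_group_add \<Rightarrow> 'b"
begin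

text \<open>Lifts to \<open>N\<close> of a basis of \<open>N / N'\<close>. Lifts stay in the ambient
  space, so no quotient space has to be constructed.\<close>

definition basis_mod :: "'b set \<Rightarrow> 'b set \<Rightarrow> 'b set \<Rightarrow> bool" where
  "basis_mod N N' B \<longleftrightarrow>
     B \<subseteq> N \<and> independent B \<and> span B \<inter> N' \<subseteq> {0} \<and> (\<forall>x\<in>N. \<exists>y\<in>span B. x - y \<in> N')"

lemma basis_modD:
  assumes "basis_mod N N' B"
  shows "B \<subseteq> N" "independent B" "span B \<inter> N' \<subseteq> {0}"
    and "x \<in> N \<Longrightarrow> \<exists>y. y \<in> span B \<and> x - y \<in> N'"
  using assms unfolding basis_mod_def by blast+

text \<open>The dimension of \<open>N / N'\<close> with infinite values identified;
  \<open>quot_dim_eq\<close> shows that the chosen set does not matter.\<close>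

definition quot_dim :: "'b set \<Rightarrow> 'b set \<Rightarrow> enat" where
  "quot_dim N N' = ecard (SOME B. basis_mod N N' B)"

lemma independent_Un_span_disjoint:
  assumes A: "independent A" and B: "independent B" and AB: "span A \<inter> span B \<subseteq> {0}"
  shows "independent (A \<union> B)"
  unfolding independent_explicit_finite_subsets
proof (intro allI impI ballI)
  fix S u v assume S: "S \<subseteq> A \<union> B" "finite S" and sum0: "(\<Sum>v\<in>S. scale (u v) v) = 0" and v: "v \<in> S"
  have dis: "(S \<inter> A) \<inter> (S - A) = {}" and un: "(S \<inter> A) \<union> (S - A) = S" by auto
  have *: "(\<Sum>v\<in>S\<inter>A. scale (u v) v) + (\<Sum>v\<in>S-A. scale (u v) v) = 0"
    using sum.union_disjoint[of "S \<inter> A" "S - A" "\<lambda>v. scale (u v) v"] S(2) sum0 dis un by auto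
  have a: "(\<Sum>v\<in>S\<inter>A. scale (u v) v) \<in> span A"
    by (intro span_sum span_scale span_base) auto
  have b: "(\<Sum>v\<in>S-A. scale (u v) v) \<in> span B"
    using S(1) by (intro span_sum span_scale span_base) auto
  have "(\<Sum>v\<in>S\<inter>A. scale (u v) v) = - (\<Sum>v\<in>S-A. scale (u v) v)"
    using * by (simp add: eq_neg_iff_add_eq_0)
  with a b have "(\<Sum>v\<in>S\<inter>A. scale (u v) v) \<in> span A \<inter> span B"
    by (metis IntI span_neg)
  with AB have a0: "(\<Sum>v\<in>S\<inter>A. scale (u v) v) = 0" by auto
  with * have b0: "(\<Sum>v\<in>S-A. scale (u v) v) = 0" by simp
  show "u v = 0"
  proof (cases "v \<in> A")
    case True
    then show ?thesis using independentD[OF A _ _ a0, of v] S v by auto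
  next
    case False
    then show ?thesis using independentD[OF B _ _ b0, of v] S v by auto
  qed
qed

lemma span_Diff_Int_span:
  assumes D: "independent D" and C: "C \<subseteq> D"
  shows "span (D - C) \<inter> span C \<subseteq> {0}"
proof
  fix x assume "x \<in> span (D - C) \<inter> span C"
  then have x: "x \<in> span (D - C)" "x \<in> span C" by auto
  have i: "independent (D - C)" "independent C" using D C independent_mono by blast+
  have "representation D x = representation (D - C) x" "representation D x = representation C x"
    using representation_extend[OF D x(1)] representation_extend[OF D x(2) C] by auto
  then have "representation C x = (\<lambda>b. 0)"
    using representation_ne_zero[of "D - C" x] representation_ne_zero[of C x] by fastforce
  then show "x \<in> {0}"
    using sum_nonzero_representation_eq[OF i(2) x(2)] by simp
qed

text \<open>Extend a basis \<open>C\<close> of \<open>N'\<close> to a basis \<open>D\<close> of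
  \<open>N\<close>; the added vectors \<open>D - C\<close> have the required properties.\<close>

lemma basis_mod_exists:
  assumes N: "subspace N" and N': "subspace N'" and le: "N' \<subseteq> N"
  shows "\<exists>B. basis_mod N N' B"
proof -
  obtain C where C: "C \<subseteq> N'" "independent C" "N' \<subseteq> span C"
    using maximal_independent_subset_extend[of "{}" N', OF _ independent_empty] by auto
  obtain D where D: "C \<subseteq> D" "D \<subseteq> N" "independent D" "N \<subseteq> span D"
    using maximal_independent_subset_extend[of C N] C le by (metis subset_trans)
  have sC: "span C = N'"
    using C N' span_minimal by blast
  have "\<exists>y\<in>span (D - C). x - y \<in> N'" if "x \<in> N" for x
  proof -
    have "x \<in> span ((D - C) \<union> C)" using that D by (auto simp: Un_absorb2)
    then show ?thesis unfolding span_Un sC by force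
  qed
  then show ?thesis
    using D span_Diff_Int_span[OF D(3,1)] independent_mono[of D "D - C"]
    unfolding basis_mod_def sC by blast
qed

text \<open>The projection along \<open>N'\<close> onto \<open>span B\<close> is injective on
  \<open>span B'\<close>, because a vector of \<open>span B'\<close> that it kills lies in
  \<open>N'\<close>. So \<open>B'\<close> is carried to an independent set inside the span of the
  finite set \<open>B\<close>.\<close>

lemma basis_mod_card_le:
  assumes N': "subspace N'" and B: "basis_mod N N' B" and B': "basis_mod N N' B'"
    and fin: "finite B"
  shows "finite B' \<and> card B' \<le> card B"
proof -
  interpret p: vector_space_pair scale scale by unfold_locales
  obtain C where C: "C \<subseteq> N'" "independent C" "N' \<subseteq> span C"
    using maximal_independent_subset_extend[of "{}" N', OF _ independent_empty] by auto
  have sC: "span C = N'" using C N' span_minimal by blast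
  have ind: "independent (B \<union> C)"
    using B C sC by (intro independent_Un_span_disjoint) (auto simp: basis_mod_def)
  have nz: "b \<noteq> 0" if "b \<in> B" for b
    using B that dependent_zero unfolding basis_mod_def by blast
  have notC: "b \<notin> C" if "b \<in> B" for b
    using B that nz[OF that] C span_base unfolding basis_mod_def by blast
  \<comment> \<open>\<open>B\<close> and a basis of \<open>N'\<close> are jointly independent, so
    the projection may be prescribed on them and extended linearly.\<close>
  obtain g where g: "Vector_Spaces.linear scale scale g"
    and gb: "\<And>x. x \<in> B \<union> C \<Longrightarrow> g x = (if x \<in> B then x else 0)"
    using p.linear_independent_extend[OF ind, of "\<lambda>x. if x \<in> B then x else 0"] by blast
  interpret g: Vector_Spaces.linear scale scale g by (rule g)
  have "g x = 0" if "x \<in> C" for x using gb[of x] notC that by auto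
  then have g0: "g x = 0" if "x \<in> N'" for x
    using g.eq_0_on_span[of C x] that C(3) by blast
  have gid: "g x = x" if "x \<in> span B" for x
    using p.linear_eq_on[OF g _ that, of "\<lambda>x. x"] gb linear_ident by auto
  have gim: "g x \<in> span B" and gdiff: "x - g x \<in> N'" if xN: "x \<in> N" for x
  proof -
    obtain y where y: "y \<in> span B" "x - y \<in> N'" using B xN unfolding basis_mod_def by blast
    have "g x = y" using g0[OF y(2)] gid[OF y(1)] by (simp add: g.diff)
    with y show "g x \<in> span B" "x - g x \<in> N'" by auto
  qed
  have "x = 0" if x: "x \<in> span B'" "g x = 0" for x
  proof -
    have "subspace {y. y - g y \<in> N'}"
      by (rule subspaceI)
        (use N' in \<open>auto simp: g.zero g.add g.scale subspace_0 scale_right_diff_distrib[symmetric]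
           subspace_scale add_diff_add dest: subspace_add\<close>)
    moreover have "B' \<subseteq> {y. y - g y \<in> N'}" using B' gdiff unfolding basis_mod_def by blast
    ultimately have "x - g x \<in> N'" using x(1) span_minimal by blast
    from this x show ?thesis using B' unfolding basis_mod_def by auto
  qed
  then have inj: "inj_on g (span B')"
    by (subst g.inj_on_iff_eq_0) auto
  have "independent (g ` B')"
    using g.independent_injective_image inj B' unfolding basis_mod_def by blast
  moreover have "g ` B' \<subseteq> span B" using gim B' unfolding basis_mod_def by blast
  ultimately have "finite (g ` B') \<and> card (g ` B') \<le> card B"
    using independent_span_bound[OF fin] by blast
  moreover have "inj_on g B'" using inj inj_on_subset span_superset by blast
  ultimately show ?thesis by (simp add: finite_image_iff card_image)
qed

lemma quot_dim_eq:
  assumes "subspace N'" and B: "basis_mod N N' B"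
  shows "quot_dim N N' = ecard B"
proof -
  have B': "basis_mod N N' (SOME B. basis_mod N N' B)" using B by (rule someI)
  show ?thesis
    using basis_mod_card_le[OF assms B'] basis_mod_card_le[OF assms(1) B' B]
    unfolding quot_dim_def ecard_def by (auto intro!: antisym)
qed

text \<open>\<open>G k\<close> plays the part of everything strictly below step \<open>k\<close> of
  a filtration. Adding the sets in increasing order of \<open>key\<close>, the span of the earlier
  ones stays in \<open>G k\<close> and so meets \<open>span (B k)\<close> only in zero.\<close>

lemma independent_UN_filtered:
  fixes key :: "'i \<Rightarrow> 'o::linorder"
  assumes fin: "finite K" and inj: "inj_on key K"
    and G: "\<And>k. k \<in> K \<Longrightarrow> subspace (G k)"
    and ind: "\<And>k. k \<in> K \<Longrightarrow> independent (B k)"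
    and dis: "\<And>k. k \<in> K \<Longrightarrow> span (B k) \<inter> G k \<subseteq> {0}"
    and low: "\<And>k k'. k \<in> K \<Longrightarrow> k' \<in> K \<Longrightarrow> key k' < key k \<Longrightarrow> B k' \<subseteq> G k"
  shows "independent (\<Union>k\<in>K. B k)" and "\<And>k k'. k \<in> K \<Longrightarrow> k' \<in> K \<Longrightarrow> k \<noteq> k' \<Longrightarrow> B k \<inter> B k' = {}"
proof -
  have "K' \<subseteq> K \<Longrightarrow> independent (\<Union>k\<in>K'. B k)" if "finite K'" for K'
    using that
  proof (induction K' rule: finite_ranking_induct[where f = key])
    case empty
    then show ?case by (simp add: independent_empty)
  next
    case (insert k K')
    show ?case
    proof (cases "k \<in> K'")
      case True
      then show ?thesis using insert by (simp add: insert_absorb)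
    next
      case False
      have "key k' < key k" if "k' \<in> K'" for k'
        using insert that inj False by (metis inj_onD insert_subset order_le_imp_less_or_eq subsetD)
      then have "(\<Union>k\<in>K'. B k) \<subseteq> G k" using low insert(4) by blast
      then have "span (\<Union>k\<in>K'. B k) \<subseteq> G k" using G insert(4) span_minimal by blast
      then have "span (B k) \<inter> span (\<Union>k\<in>K'. B k) \<subseteq> {0}" using dis[of k] insert(4) by blast
      then show ?thesis
        using independent_Un_span_disjoint[of "B k" "\<Union>k\<in>K'. B k"] ind[of k] insert by simp
    qed
  qed
  then show "independent (\<Union>k\<in>K. B k)" using fin by blast
  have *: "B k \<inter> B k' = {}" if k: "k \<in> K" "k' \<in> K" "key k' < key k" for k k'
  proof -
    have "b \<noteq> 0" if "b \<in> B k" for b using ind k that dependent_zero by blast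
    then show ?thesis using low[OF k] dis[of k] k span_superset[of "B k"] by blast
  qed
  show "B k \<inter> B k' = {}" if k: "k \<in> K" "k' \<in> K" "k \<noteq> k'" for k k'
    using *[of k k'] *[of k' k] k inj by (metis Int_commute inj_onD linorder_less_linear)
qed

end

section \<open>Linear relations that identify two quotients\<close>

definition linear_relation ::
  "('k \<Rightarrow> 'v \<Rightarrow> 'v) \<Rightarrow> ('k \<Rightarrow> 'w \<Rightarrow> 'w) \<Rightarrow> ('v::ab_group_add \<Rightarrow> 'w::ab_group_add \<Rightarrow> bool) \<Rightarrow> bool" where
  "linear_relation s1 s2 R \<longleftrightarrow>
     R 0 0 \<and> (\<forall>x y x' y'. R x y \<longrightarrow> R x' y' \<longrightarrow> R (x + x') (y + y')) \<and>
     (\<forall>c x y. R x y \<longrightarrow> R (s1 c x) (s2 c y))"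

text \<open>For a linear relation between subspaces these conditions induce an isomorphism from
  \<open>N / N'\<close> to \<open>M / M'\<close>, although the relation need not be single-valued in
  either direction.\<close>

definition relates_quots ::
  "('v \<Rightarrow> 'w \<Rightarrow> bool) \<Rightarrow> 'v set \<Rightarrow> 'v set \<Rightarrow> 'w set \<Rightarrow> 'w set \<Rightarrow> bool" where
  "relates_quots R N N' M M' \<longleftrightarrow>
     (\<forall>x\<in>N. \<exists>y\<in>M. R x y) \<and> (\<forall>y\<in>M. \<exists>x\<in>N. R x y) \<and>
     (\<forall>x\<in>N. \<forall>y\<in>M. R x y \<longrightarrow> (x \<in> N' \<longleftrightarrow> y \<in> M'))"

lemma relates_quotsD:
  assumes "relates_quots R N N' M M'"
  shows "x \<in> N \<Longrightarrow> \<exists>y. y \<in> M \<and> R x y" and "y \<in> M \<Longrightarrow> \<exists>x. x \<in> N \<and> R x y"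
    and "x \<in> N \<Longrightarrow> y \<in> M \<Longrightarrow> R x y \<Longrightarrow> x \<in> N' \<longleftrightarrow> y \<in> M'"
  using assms unfolding relates_quots_def by blast+

lemma relates_quots_converse:
  "relates_quots (\<lambda>y x. R x y) M M' N N' \<longleftrightarrow> relates_quots R N N' M M'"
  unfolding relates_quots_def by blast

lemma linear_relation_converse:
  "linear_relation s2 s1 (\<lambda>y x. R x y) \<longleftrightarrow> linear_relation s1 s2 R"
  unfolding linear_relation_def by blast

locale scalar_space_pair = vs1: scalar_space s1 + vs2: scalar_space s2
  for s1 :: "'k::field \<Rightarrow> 'v::ab_group_add \<Rightarrow> 'v" and s2 :: "'k \<Rightarrow> 'w::ab_group_add \<Rightarrow> 'w"
begin

sublocale vector_space_pair s1 s2 ..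

lemma linear_relation_diff:
  assumes "linear_relation s1 s2 R" "R x y" "R x' y'"
  shows "R (x - x') (y - y')"
proof -
  have "R (s1 (-1) x') (s2 (-1) y')" using assms unfolding linear_relation_def by blast
  then have "R (- x') (- y')" by simp
  then have "R (x + - x') (y + - y')" using assms unfolding linear_relation_def by blast
  then show ?thesis by simp
qed

text \<open>The choice \<open>f\<close> extends linearly to \<open>F\<close>, whose graph over
  \<open>span B\<close> stays inside the relation. If \<open>F x \<in> M'\<close> then
  \<open>x \<in> N'\<close>, hence \<open>x = 0\<close>, which gives injectivity and independence
  modulo \<open>M'\<close>. A prescribed \<open>f\<close> keeps track of which basis vector goes
  where.\<close>

lemma basis_mod_transfer:
  assumes R: "linear_relation s1 s2 R" and rel: "relates_quots R N N' M M'"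
    and sN: "vs1.subspace N" and sN': "vs1.subspace N'" "N' \<subseteq> N"
    and sM: "vs2.subspace M" and sM': "vs2.subspace M'" "M' \<subseteq> M"
    and B: "vs1.basis_mod N N' B" and f: "\<And>b. b \<in> B \<Longrightarrow> f b \<in> M \<and> R b (f b)"
  shows "inj_on f B \<and> vs2.basis_mod M M' (f ` B)"
proof -
  have iB: "vs1.independent B" and BN: "B \<subseteq> N" using B by (auto simp: vs1.basis_mod_def)
  obtain F where F: "Vector_Spaces.linear s1 s2 F" and Ff: "\<And>b. b \<in> B \<Longrightarrow> F b = f b"
    using linear_independent_extend[OF iB, of f] by blast
  interpret F: Vector_Spaces.linear s1 s2 F by (rule F)
  have spN: "vs1.span B \<subseteq> N" using BN sN vs1.span_minimal by blast
  have "vs1.subspace {x. F x \<in> M \<and> R x (F x)}"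
    by (rule vs1.subspaceI)
      (use R sM in \<open>auto simp: F.zero F.add F.scale vs2.subspace_0 vs2.subspace_add
         vs2.subspace_scale linear_relation_def\<close>)
  moreover have "B \<subseteq> {x. F x \<in> M \<and> R x (F x)}"
    using f Ff by auto
  ultimately have RF: "F x \<in> M \<and> R x (F x)" if "x \<in> vs1.span B" for x
    using that vs1.span_minimal by blast
  have in0: "x = 0" if "x \<in> vs1.span B" "F x \<in> M'" for x
  proof -
    have "x \<in> N'" using rel RF[OF that(1)] spN that unfolding relates_quots_def by blast
    then show ?thesis using B that unfolding vs1.basis_mod_def by blast
  qed
  have inj: "inj_on F (vs1.span B)"
    using in0 sM' by (subst F.inj_on_iff_eq_0) (auto simp: vs2.subspace_0)
  have im: "F ` B = f ` B" using Ff by auto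
  have injf: "inj_on f B"
    using inj_on_subset[OF inj vs1.span_superset] Ff by (metis inj_on_cong)
  have ind: "vs2.independent (f ` B)"
    using F.independent_injective_image[OF iB inj] im by simp
  have sp: "vs2.span (f ` B) = F ` vs1.span B"
    using F.span_image[of B] im by simp
  have gen: "\<exists>z\<in>vs2.span (f ` B). y - z \<in> M'" if y: "y \<in> M" for y
  proof -
    obtain x where x: "x \<in> N" "R x y" using rel y unfolding relates_quots_def by blast
    obtain s where s: "s \<in> vs1.span B" "x - s \<in> N'" using B x unfolding vs1.basis_mod_def by blast
    \<comment> \<open>Subtracting two related pairs turns \<open>x - s \<in> N'\<close> into
      \<open>y - F s \<in> M'\<close>.\<close>
    have "R (x - s) (y - F s)" using linear_relation_diff[OF R x(2)] RF[OF s(1)] by blast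
    moreover have "y - F s \<in> M" using y RF[OF s(1)] sM vs2.subspace_diff by blast
    ultimately have "y - F s \<in> M'" using rel s sN' unfolding relates_quots_def by blast
    then show ?thesis using sp s by blast
  qed
  have "vs2.span (f ` B) \<inter> M' \<subseteq> {0}"
  proof
    fix y assume "y \<in> vs2.span (f ` B) \<inter> M'"
    then obtain x where x: "x \<in> vs1.span B" "y = F x" "F x \<in> M'" unfolding sp by auto
    then show "y \<in> {0}" using in0[OF x(1,3)] F.zero by simp
  qed
  moreover have "f ` B \<subseteq> M" using f by auto
  ultimately show ?thesis
    using injf ind gen unfolding vs2.basis_mod_def by simp
qed

lemma quot_dim_transfer:
  assumes R: "linear_relation s1 s2 R" and rel: "relates_quots R N N' M M'"
    and sN: "vs1.subspace N" and sN': "vs1.subspace N'" "N' \<subseteq> N"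
    and sM: "vs2.subspace M" and sM': "vs2.subspace M'" "M' \<subseteq> M"
  shows "vs1.quot_dim N N' = vs2.quot_dim M M'"
proof -
  obtain B where B: "vs1.basis_mod N N' B" using vs1.basis_mod_exists sN sN' by blast
  define f where "f b = (SOME y. y \<in> M \<and> R b y)" for b
  have "f b \<in> M \<and> R b (f b)" if "b \<in> B" for b
  proof -
    have "b \<in> N" using B that unfolding vs1.basis_mod_def by auto
    from relates_quotsD(1)[OF rel this] have "\<exists>y. y \<in> M \<and> R b y" .
    then show ?thesis unfolding f_def by (rule someI_ex)
  qed
  from basis_mod_transfer[OF R rel sN sN' sM sM' B this]
  have "inj_on f B" and B': "vs2.basis_mod M M' (f ` B)" by auto
  then have "ecard (f ` B) = ecard B" by (simp add: ecard_def card_image finite_image_iff)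
  then show ?thesis using vs1.quot_dim_eq[OF sN'(1) B] vs2.quot_dim_eq[OF sM'(1) B'] by simp
qed

end


section \<open>The birth and death filtrations of a zigzag module\<close>

text \<open>With \<open>n = zz_length V\<close>, arrow \<open>j\<close> of the reversal joins the
  positions \<open>n + 1 - j\<close> and \<open>n - j\<close> of \<open>V\<close>, so it is arrow
  \<open>n - j\<close> read the other way. Reversal exchanges births and deaths, and facts about
  right chains are obtained from those about left chains.\<close>

definition zz_rev :: "'v zigzag \<Rightarrow> 'v zigzag" where
  "zz_rev V =
     \<lparr>zz_length = zz_length V,
      zz_space = (\<lambda>j. zz_space V (Suc (zz_length V) - j)),
      zz_forward = (\<lambda>j. \<not> zz_forward V (zz_length V - j)),
      zz_map = (\<lambda>j. zz_map V (zz_length V - j))\<rparr>"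

lemma zz_rev_simps [simp]:
  "zz_length (zz_rev V) = zz_length V"
  "zz_space (zz_rev V) j = zz_space V (Suc (zz_length V) - j)"
  "zz_forward (zz_rev V) j \<longleftrightarrow> \<not> zz_forward V (zz_length V - j)"
  "zz_map (zz_rev V) j = zz_map V (zz_length V - j)"
  by (simp_all add: zz_rev_def)

definition zz_step :: "'v zigzag \<Rightarrow> nat \<Rightarrow> 'v set \<Rightarrow> 'v set" where
  "zz_step V j S =
     (if zz_forward V j then zz_map V j ` S else {y\<in>zz_space V (Suc j). zz_map V j y \<in> S})"

text \<open>Constant up to and including position \<open>p\<close>: the recursion has to begin at
  \<open>0\<close>, the transport begins at \<open>p\<close>.\<close>

primrec zz_transport :: "'v zigzag \<Rightarrow> nat \<Rightarrow> 'v set \<Rightarrow> nat \<Rightarrow> 'v set" where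
  "zz_transport V p A 0 = A"
| "zz_transport V p A (Suc j) = (if j < p then A else zz_step V j (zz_transport V p A j))"

text \<open>Two kinds of birth: an arrow pointing right into \<open>p\<close> gives birth to classes
  modulo its image, an arrow pointing left out of \<open>p\<close> gives birth to the elements of
  its kernel.\<close>

definition birth_space :: "('v::zero) zigzag \<Rightarrow> nat \<Rightarrow> 'v set" where
  "birth_space V p =
     (if p = 1 \<or> zz_forward V (p - 1) then zz_space V p
      else {x\<in>zz_space V p. zz_map V (p - 1) x = 0})"

definition birth_space_pred :: "('v::zero) zigzag \<Rightarrow> nat \<Rightarrow> 'v set" where
  "birth_space_pred V p =
     (if p \<noteq> 1 \<and> zz_forward V (p - 1) then zz_map V (p - 1) ` zz_space V (p - 1) else {0})"

text \<open>\<open>lsub V p t\<close> consists of the values at \<open>t\<close> of the elements that live on the positions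
  \<open>p, \<dots>, t\<close>. For fixed \<open>t\<close> these subspaces form a chain ordered by \<open>birth_rank V p\<close>, and
  \<open>lsub_pred V p t\<close> is the predecessor of \<open>lsub V p t\<close> in it: an arrow \<open>t \<rightarrow> t + 1\<close> adds a new top
  element to the chain, an arrow \<open>t \<leftarrow> t + 1\<close> adds a new bottom element.\<close>

definition lsub :: "('v::zero) zigzag \<Rightarrow> nat \<Rightarrow> nat \<Rightarrow> 'v set" where
  "lsub V p t = zz_transport V p (birth_space V p) t"

definition lsub_pred :: "('v::zero) zigzag \<Rightarrow> nat \<Rightarrow> nat \<Rightarrow> 'v set" where
  "lsub_pred V p t = zz_transport V p (birth_space_pred V p) t"

text \<open>Among births of the first kind later ones rank higher, among kernel births later ones
  rank lower. Counting up and down from \<open>zz_length V\<close> puts all kernel births below all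
  others.\<close>

definition birth_rank :: "'v zigzag \<Rightarrow> nat \<Rightarrow> nat" where
  "birth_rank V p =
     (if p = 1 \<or> zz_forward V (p - 1) then zz_length V + p else zz_length V - p)"

definition rsub :: "('v::zero) zigzag \<Rightarrow> nat \<Rightarrow> nat \<Rightarrow> 'v set" where
  "rsub V q t = lsub (zz_rev V) (Suc (zz_length V) - q) (Suc (zz_length V) - t)"

definition rsub_pred :: "('v::zero) zigzag \<Rightarrow> nat \<Rightarrow> nat \<Rightarrow> 'v set" where
  "rsub_pred V q t = lsub_pred (zz_rev V) (Suc (zz_length V) - q) (Suc (zz_length V) - t)"

definition death_rank :: "'v zigzag \<Rightarrow> nat \<Rightarrow> nat" where
  "death_rank V q = birth_rank (zz_rev V) (Suc (zz_length V) - q)"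

definition set_sum :: "('v::plus) set \<Rightarrow> 'v set \<Rightarrow> 'v set" where
  "set_sum A B = {x + y | x y. x \<in> A \<and> y \<in> B}"

definition interval_num :: "('v::zero) zigzag \<Rightarrow> nat \<Rightarrow> nat \<Rightarrow> nat \<Rightarrow> 'v set" where
  "interval_num V p q t = lsub V p t \<inter> rsub V q t"

text \<open>The denominator of the Zassenhaus subquotient of two chains. The quotient is the doubly
  graded piece and is symmetric in births and deaths.\<close>

definition interval_den :: "('v::ab_group_add) zigzag \<Rightarrow> nat \<Rightarrow> nat \<Rightarrow> nat \<Rightarrow> 'v set" where
  "interval_den V p q t =
     set_sum (lsub_pred V p t \<inter> rsub V q t) (lsub V p t \<inter> rsub_pred V q t)"

lemma set_sum_commute: "set_sum A B = set_sum B (A :: 'v::ab_group_add set)"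
  unfolding set_sum_def by (force simp: add.commute)

lemma zz_transport_start: "1 \<le> p \<Longrightarrow> zz_transport V p A p = A"
  by (cases p) auto

lemma lsub_start: "1 \<le> p \<Longrightarrow> lsub V p p = birth_space V p"
  and lsub_pred_start: "1 \<le> p \<Longrightarrow> lsub_pred V p p = birth_space_pred V p"
  by (simp_all add: lsub_def lsub_pred_def zz_transport_start)

lemma lsub_Suc: "p \<le> t \<Longrightarrow> lsub V p (Suc t) = zz_step V t (lsub V p t)"
  and lsub_pred_Suc: "p \<le> t \<Longrightarrow> lsub_pred V p (Suc t) = zz_step V t (lsub_pred V p t)"
  by (simp_all add: lsub_def lsub_pred_def)

lemma zz_step_mono: "S \<subseteq> T \<Longrightarrow> zz_step V j S \<subseteq> zz_step V j T"
  unfolding zz_step_def by auto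

lemma rsub_start:
  assumes "1 \<le> q" "q \<le> zz_length V"
  shows "rsub V q q = (if q = zz_length V \<or> \<not> zz_forward V q then zz_space V q
                        else {x\<in>zz_space V q. zz_map V q x = 0})"
    and "rsub_pred V q q = (if q \<noteq> zz_length V \<and> \<not> zz_forward V q
                             then zz_map V q ` zz_space V (Suc q) else {0})"
proof -
  have [simp]: "Suc (zz_length V) - q = Suc 0 \<longleftrightarrow> q = zz_length V"
    "zz_length V - (zz_length V - q) = q" "zz_length V - (Suc (zz_length V) - Suc q) = q"
    "Suc (zz_length V) - (Suc (zz_length V) - q) = q" "Suc (zz_length V) - q - 1 = zz_length V - q"
    "Suc (zz_length V) - (zz_length V - q) = Suc q" "Suc (zz_length V) - q - Suc 0 = zz_length V - q"
    using assms by auto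
  have 1: "1 \<le> Suc (zz_length V) - q" using assms by auto
  show "rsub V q q = (if q = zz_length V \<or> \<not> zz_forward V q then zz_space V q
                        else {x\<in>zz_space V q. zz_map V q x = 0})"
    and "rsub_pred V q q = (if q \<noteq> zz_length V \<and> \<not> zz_forward V q
                             then zz_map V q ` zz_space V (Suc q) else {0})"
    unfolding rsub_def lsub_start[OF 1] rsub_pred_def lsub_pred_start[OF 1]
    by (simp_all add: birth_space_def birth_space_pred_def del: diff_diff_left)
qed

lemma rsub_step:
  assumes "1 \<le> t" "t < q" "q \<le> zz_length V"
  shows "rsub V q t = (if zz_forward V t then {x\<in>zz_space V t. zz_map V t x \<in> rsub V q (Suc t)}
                        else zz_map V t ` rsub V q (Suc t))"
    and "rsub_pred V q t =
           (if zz_forward V t then {x\<in>zz_space V t. zz_map V t x \<in> rsub_pred V q (Suc t)}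
            else zz_map V t ` rsub_pred V q (Suc t))"
proof -
  have le: "Suc (zz_length V) - q \<le> zz_length V - t" using assms by auto
  have S: "Suc (zz_length V) - t = Suc (zz_length V - t)" using assms by auto
  have [simp]: "zz_length V - (zz_length V - t) = t" using assms by auto
  show "rsub V q t = (if zz_forward V t then {x\<in>zz_space V t. zz_map V t x \<in> rsub V q (Suc t)}
                        else zz_map V t ` rsub V q (Suc t))"
    and "rsub_pred V q t =
           (if zz_forward V t then {x\<in>zz_space V t. zz_map V t x \<in> rsub_pred V q (Suc t)}
            else zz_map V t ` rsub_pred V q (Suc t))"
    unfolding rsub_def rsub_pred_def S lsub_Suc[OF le] lsub_pred_Suc[OF le] zz_step_def by simp_all
qed

lemma birth_rank_inj:
  assumes "birth_rank V p = birth_rank V p'" "1 \<le> p" "p \<le> zz_length V" "1 \<le> p'" "p' \<le> zz_length V"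
  shows "p = p'"
  using assms unfolding birth_rank_def by (auto split: if_splits)

lemma death_rank_inj:
  assumes "death_rank V p = death_rank V p'" "1 \<le> p" "p \<le> zz_length V" "1 \<le> p'" "p' \<le> zz_length V"
  shows "p = p'"
proof -
  have "Suc (zz_length V) - p = Suc (zz_length V) - p'"
    by (rule birth_rank_inj[OF assms(1)[unfolded death_rank_def]]) (use assms in auto)
  then show ?thesis using assms by auto
qed

lemma birth_rank_less_Suc:
  assumes "1 \<le> p" "p \<le> t" "Suc t \<le> zz_length V"
  shows "birth_rank V p < birth_rank V (Suc t) \<longleftrightarrow> zz_forward V t"
    and "birth_rank V (Suc t) < birth_rank V p \<longleftrightarrow> \<not> zz_forward V t"
  using assms unfolding birth_rank_def by (auto split: if_splits)

section \<open>Linear algebra along a single arrow\<close>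

context scalar_space
begin

lemma linear_between_zero:
  assumes "linear_between scale scale A B g" "subspace A"
  shows "g 0 = 0"
proof -
  have "0 \<in> A" using assms(2) subspace_0 by auto
  then have "g (scale 0 0) = scale 0 (g 0)" using assms(1) unfolding linear_between_def by blast
  then show ?thesis by simp
qed

lemma subspace_linear_image:
  assumes "linear_between scale scale A B g" "subspace S" "S \<subseteq> A"
  shows "subspace (g ` S)"
proof (rule subspaceI)
  show "0 \<in> g ` S"
    using assms subspace_0 unfolding linear_between_def
    by (metis image_eqI scale_zero_left subsetD)
  show "x + y \<in> g ` S" if xy: "x \<in> g ` S" "y \<in> g ` S" for x y
  proof -
    obtain u v where "u \<in> S" "v \<in> S" "x = g u" "y = g v" using xy by auto
    moreover from this have "u \<in> A" "v \<in> A" using assms by auto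
    ultimately have "u \<in> S" "v \<in> S" "g (u + v) = x + y"
      using assms unfolding linear_between_def by auto
    then show ?thesis using subspace_add[OF assms(2)] by (metis imageI)
  qed
  show "scale c x \<in> g ` S" if x: "x \<in> g ` S" for c x
  proof -
    obtain u where u: "u \<in> S" "x = g u" using x by blast
    then have "g (scale c u) = scale c x" using assms unfolding linear_between_def by auto
    then show ?thesis using subspace_scale[OF assms(2) u(1)] by (metis imageI)
  qed
qed

lemma subspace_linear_vimage:
  assumes "linear_between scale scale A B g" "subspace A" "subspace S"
  shows "subspace {x\<in>A. g x \<in> S}"
  using assms linear_between_zero[OF assms(1,2)] unfolding linear_between_def
  by (intro subspaceI) (auto simp: subspace_0 subspace_add subspace_scale)

lemma set_sum_subspace: "subspace A \<Longrightarrow> subspace B \<Longrightarrow> subspace (set_sum A B)"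
  unfolding set_sum_def by (rule subspace_sums)

text \<open>Along \<open>g\<close> one chain is pushed forward and the other pulled back. The kernel
  of \<open>g\<close> does not disturb the quotient: its part in \<open>L\<close> lies in the
  pulled-back \<open>R'\<close>, hence in the denominator.\<close>

lemma relates_quots_along_map:
  assumes lin: "linear_between scale scale A C g" and A: "subspace A"
    and L: "subspace L" "L \<subseteq> A" "subspace L'" "L' \<subseteq> L"
    and R: "subspace R" "subspace R'" "R' \<subseteq> R"
  shows "relates_quots (\<lambda>x y. x \<in> A \<and> y = g x)
     (L \<inter> {x\<in>A. g x \<in> R}) (set_sum (L' \<inter> {x\<in>A. g x \<in> R}) (L \<inter> {x\<in>A. g x \<in> R'}))
     (g ` L \<inter> R) (set_sum (g ` L' \<inter> R) (g ` L \<inter> R'))"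
  unfolding relates_quots_def
proof (intro conjI ballI impI)
  fix x assume "x \<in> L \<inter> {x\<in>A. g x \<in> R}"
  then show "\<exists>y\<in>g ` L \<inter> R. x \<in> A \<and> y = g x" by auto
next
  fix y assume "y \<in> g ` L \<inter> R"
  then show "\<exists>x\<in>L \<inter> {x\<in>A. g x \<in> R}. x \<in> A \<and> y = g x" using L by auto
next
  fix x y assume x: "x \<in> L \<inter> {x\<in>A. g x \<in> R}" and y: "y \<in> g ` L \<inter> R" and xy: "x \<in> A \<and> y = g x"
  have add: "g (u + v) = g u + g v" if "u \<in> A" "v \<in> A" for u v
    using lin that unfolding linear_between_def by auto
  show "x \<in> set_sum (L' \<inter> {x\<in>A. g x \<in> R}) (L \<inter> {x\<in>A. g x \<in> R'}) \<longleftrightarrow>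
      y \<in> set_sum (g ` L' \<inter> R) (g ` L \<inter> R')"
  proof
    assume "x \<in> set_sum (L' \<inter> {x\<in>A. g x \<in> R}) (L \<inter> {x\<in>A. g x \<in> R'})"
    then obtain u v where "x = u + v" "u \<in> L'" "u \<in> A" "g u \<in> R" "v \<in> L" "v \<in> A" "g v \<in> R'"
      unfolding set_sum_def by auto
    then show "y \<in> set_sum (g ` L' \<inter> R) (g ` L \<inter> R')"
      using xy add[of u v] unfolding set_sum_def by auto
  next
    assume "y \<in> set_sum (g ` L' \<inter> R) (g ` L \<inter> R')"
    then obtain u v where uv: "y = g u + g v" "u \<in> L'" "g u \<in> R" "v \<in> L" "g v \<in> R'"
      unfolding set_sum_def by auto
    have A': "u \<in> A" "v \<in> A" using uv L by auto
    \<comment> \<open>The second summand of \<open>x\<close> is taken to be \<open>x - u\<close>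
      instead of \<open>v\<close>; the two have the same image and differ by an element of the
      kernel of \<open>g\<close>.\<close>
    have "g (x - u) = g v"
    proof -
      have "g ((x - u) + u) = g (x - u) + g u"
        using A' x subspace_diff[OF A] by (intro add) auto
      then show ?thesis using xy uv by simp
    qed
    moreover have "x - u \<in> L" using x uv L subspace_diff by blast
    ultimately have "x - u \<in> L \<inter> {x\<in>A. g x \<in> R'}" using uv L by auto
    moreover have "u \<in> L' \<inter> {x\<in>A. g x \<in> R}" using uv A' by auto
    moreover have "x = u + (x - u)" by simp
    ultimately show "x \<in> set_sum (L' \<inter> {x\<in>A. g x \<in> R}) (L \<inter> {x\<in>A. g x \<in> R'})"
      unfolding set_sum_def by blast
  qed
qed

lemma linear_relation_along_map:
  assumes "linear_between scale scale A C g" and A: "subspace A"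
  shows "linear_relation scale scale (\<lambda>x y. x \<in> A \<and> y = g x)"
  using assms linear_between_zero[OF assms] unfolding linear_relation_def linear_between_def
  by (auto simp: subspace_0 subspace_add subspace_scale)

end

section \<open>The chains of one zigzag module\<close>

locale zigzag_space = scalar_space scale
  for scale :: "'k::field \<Rightarrow> 'v::ab_group_add \<Rightarrow> 'v" +
  fixes V :: "'v zigzag"
  assumes zz: "zigzag_module scale V"
begin

lemma space_subspace: "1 \<le> t \<Longrightarrow> t \<le> zz_length V \<Longrightarrow> subspace (zz_space V t)"
  using zz unfolding zigzag_module_def by auto

lemma map_linear:
  assumes "1 \<le> j" "j < zz_length V"
  shows "linear_between scale scale
    (if zz_forward V j then zz_space V j else zz_space V (Suc j))
    (if zz_forward V j then zz_space V (Suc j) else zz_space V j) (zz_map V j)"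
proof -
  have "linear_between scale scale (zz_source V j) (zz_target V j) (zz_map V j)"
    using zz assms unfolding zigzag_module_def by simp
  then show ?thesis unfolding zz_source_def zz_target_def by (cases "zz_forward V j") simp_all
qed

lemma zz_step_subspace:
  assumes "1 \<le> j" "j < zz_length V" "subspace S" "S \<subseteq> zz_space V j"
  shows "subspace (zz_step V j S)" and "zz_step V j S \<subseteq> zz_space V (Suc j)"
proof -
  note lin = map_linear[OF assms(1,2)]
  show "subspace (zz_step V j S)"
    using lin assms space_subspace[of "Suc j"] unfolding zz_step_def
    by (auto intro: subspace_linear_image subspace_linear_vimage split: if_splits)
  show "zz_step V j S \<subseteq> zz_space V (Suc j)"
    using lin assms unfolding zz_step_def linear_between_def by (auto split: if_splits)
qed

lemma birth_space_subspace:
  assumes "1 \<le> p" "p \<le> zz_length V"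
  shows "subspace (birth_space V p)" "birth_space V p \<subseteq> zz_space V p"
    "subspace (birth_space_pred V p)" "birth_space_pred V p \<subseteq> birth_space V p"
proof -
  have sp: "subspace (zz_space V p)" using assms space_subspace by auto
  have s0: "{x. x = 0} = {0::'v}" by auto
  have lin: "linear_between scale scale
    (if zz_forward V (p-1) then zz_space V (p-1) else zz_space V p)
    (if zz_forward V (p-1) then zz_space V p else zz_space V (p-1)) (zz_map V (p-1))" if "p \<noteq> 1"
    using map_linear[of "p-1"] assms that by auto
  have spp: "subspace (zz_space V (p-1))" if "p \<noteq> 1"
    using assms space_subspace[of "p-1"] that by auto
  show "subspace (birth_space V p)"
    using sp subspace_linear_vimage[OF lin _ subspace_single_0]
    unfolding birth_space_def by auto
  show "birth_space V p \<subseteq> zz_space V p" unfolding birth_space_def by auto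
  show "subspace (birth_space_pred V p)"
    using subspace_linear_image[OF lin spp] subspace_single_0
    unfolding birth_space_pred_def by auto
  show "birth_space_pred V p \<subseteq> birth_space V p"
    using lin subspace_0[OF sp] linear_between_zero[OF lin] sp
    unfolding birth_space_pred_def birth_space_def linear_between_def by auto
qed

lemma lsub_subspace:
  assumes "1 \<le> p" "p \<le> t" "t \<le> zz_length V"
  shows "subspace (lsub V p t) \<and> lsub V p t \<subseteq> zz_space V t \<and>
     subspace (lsub_pred V p t) \<and> lsub_pred V p t \<subseteq> lsub V p t"
  using assms(2,3)
proof (induction t rule: dec_induct)
  case base
  then show ?case using assms birth_space_subspace[of p] by (simp add: lsub_start lsub_pred_start)
next
  case (step t)
  have t: "1 \<le> t" "t < zz_length V" using step assms by auto
  have IH: "subspace (lsub V p t)" "lsub V p t \<subseteq> zz_space V t"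
      "subspace (lsub_pred V p t)" "lsub_pred V p t \<subseteq> lsub V p t"
    using step by auto
  have "lsub_pred V p t \<subseteq> zz_space V t" using IH by blast
  then show ?case
    using step(1) zz_step_subspace[OF t] zz_step_mono[OF IH(4)] IH
    by (simp add: lsub_Suc lsub_pred_Suc)
qed

text \<open>Steps preserve inclusions, so only births at the newest position need an argument. A
  right-pointing arrow puts every old member into its image, the predecessor of the new top; a
  left-pointing arrow puts its kernel, the new bottom, into every preimage.\<close>

lemma lsub_mono:
  assumes "1 \<le> p" "p \<le> t" "1 \<le> p'" "p' \<le> t" "t \<le> zz_length V" "birth_rank V p' < birth_rank V p"
  shows "lsub V p' t \<subseteq> lsub_pred V p t"
  using assms
proof (induction t arbitrary: p p')
  case 0
  then show ?case by auto
next
  case (Suc t)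
  consider "p \<le> t" "p' \<le> t" | "p = Suc t" "p' \<le> t" | "p \<le> t" "p' = Suc t"
    using Suc.prems by (metis le_Suc_eq less_irrefl)
  then show ?case
  proof cases
    case 1
    then show ?thesis
      using Suc by (simp add: lsub_Suc lsub_pred_Suc zz_step_mono)
  next
    case 2
    then have "zz_forward V t" using Suc.prems birth_rank_less_Suc(1)[of p' t] by auto
    moreover have "lsub V p' t \<subseteq> zz_space V t" using lsub_subspace[of p' t] 2 Suc.prems by auto
    ultimately show ?thesis
      using 2 Suc.prems by (auto simp: lsub_Suc lsub_pred_start birth_space_pred_def zz_step_def)
  next
    case 3
    then have "\<not> zz_forward V t" using Suc.prems birth_rank_less_Suc(2)[of p t] by auto
    moreover have "0 \<in> lsub_pred V p t" using lsub_subspace[of p t] 3 Suc.prems subspace_0 by auto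
    ultimately show ?thesis
      using 3 Suc.prems by (auto simp: lsub_pred_Suc lsub_start birth_space_def zz_step_def)
  qed
qed

text \<open>Take for \<open>p\<close> the last position up to \<open>t\<close> that is entered by a
  right-pointing arrow, or else \<open>1\<close>. The left-pointing arrows after it pull the whole
  space back to the whole space.\<close>

lemma lsub_top:
  assumes "1 \<le> t" "t \<le> zz_length V"
  shows "\<exists>p. 1 \<le> p \<and> p \<le> t \<and> lsub V p t = zz_space V t"
  using assms
proof (induction t rule: dec_induct)
  case base
  then show ?case by (auto simp: lsub_start birth_space_def)
next
  case (step t)
  show ?case
  proof (cases "zz_forward V t")
    case True
    then show ?thesis by (intro exI[of _ "Suc t"]) (auto simp: lsub_start birth_space_def)
  next
    case False
    obtain p where p: "1 \<le> p" "p \<le> t" "lsub V p t = zz_space V t" using step by auto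
    have "lsub V p (Suc t) = zz_space V (Suc t)"
      using p False map_linear[of t] step unfolding linear_between_def
      by (auto simp: lsub_Suc zz_step_def)
    then show ?thesis using p by (intro exI[of _ p]) auto
  qed
qed

text \<open>Exhibits the predecessor as a member of the chain of smaller rank, which makes induction
  on ranks possible. At birth it is the image of the top member one position earlier; later a zero
  predecessor becomes a kernel, the new bottom, at a left-pointing arrow.\<close>

lemma lsub_pred_cases:
  assumes "1 \<le> p" "p \<le> t" "t \<le> zz_length V"
  shows "lsub_pred V p t = {0} \<or>
     (\<exists>p'. 1 \<le> p' \<and> p' \<le> t \<and> birth_rank V p' < birth_rank V p \<and> lsub_pred V p t = lsub V p' t)"
  using assms(2,3)
proof (induction t rule: dec_induct)
  case base
  show ?case
  proof (cases "p \<noteq> 1 \<and> zz_forward V (p - 1)")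
    case True
    then obtain m where m: "p = Suc m" "1 \<le> m" using assms by (cases p) auto
    obtain p' where p': "1 \<le> p'" "p' \<le> m" "lsub V p' m = zz_space V m"
      using lsub_top[of m] m base by auto
    have "birth_rank V p' < birth_rank V p"
      using birth_rank_less_Suc(1)[of p' m] p' m True base by auto
    moreover have "lsub_pred V p p = lsub V p' p"
      using p' m True by (simp add: lsub_pred_start birth_space_pred_def lsub_Suc zz_step_def)
    ultimately show ?thesis using p' m by (intro disjI2 exI[of _ p']) auto
  next
    case False
    then show ?thesis using assms by (auto simp: lsub_pred_start birth_space_pred_def)
  qed
next
  case (step t)
  have t: "1 \<le> t" "t < zz_length V" using step assms by auto
  from step have "lsub_pred V p t = {0} \<or>
     (\<exists>p'. 1 \<le> p' \<and> p' \<le> t \<and> birth_rank V p' < birth_rank V p \<and> lsub_pred V p t = lsub V p' t)"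
    by auto
  then show ?case
  proof (elim disjE exE conjE)
    assume *: "lsub_pred V p t = {0}"
    show ?thesis
    proof (cases "zz_forward V t")
      case True
      then have "zz_map V t 0 = 0"
        using map_linear[OF t] linear_between_zero space_subspace t by auto
      then show ?thesis using * True step by (simp add: lsub_pred_Suc zz_step_def)
    next
      case False
      then have "lsub_pred V p (Suc t) = lsub V (Suc t) (Suc t)"
        using * step t by (simp add: lsub_pred_Suc zz_step_def lsub_start birth_space_def)
      then show ?thesis
        using birth_rank_less_Suc(2)[of p t V] assms(1) step(1) t False
        by (intro disjI2 exI[of _ "Suc t"]) auto
    qed
  next
    fix p' assume "1 \<le> p'" "p' \<le> t" "birth_rank V p' < birth_rank V p" "lsub_pred V p t = lsub V p' t"
    then show ?thesis using step
      by (intro disjI2 exI[of _ p']) (auto simp: lsub_Suc lsub_pred_Suc)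
  qed
qed

lemma zigzag_space_rev: "zigzag_space scale (zz_rev V)"
proof
  have "linear_between scale scale (zz_source (zz_rev V) j) (zz_target (zz_rev V) j) (zz_map (zz_rev V) j)"
    if j: "j \<in> {1..<zz_length V}" for j
  proof -
    have e: "Suc (zz_length V - j) = Suc (zz_length V) - j" "Suc (zz_length V) - Suc j = zz_length V - j"
      using j by auto
    show ?thesis
      using map_linear[of "zz_length V - j"] j unfolding zz_source_def zz_target_def e
      by (auto simp: e)
  qed
  then show "zigzag_module scale (zz_rev V)"
    using space_subspace unfolding zigzag_module_def by auto
qed

lemma rsub_subspace:
  assumes "1 \<le> t" "t \<le> q" "q \<le> zz_length V"
  shows "subspace (rsub V q t) \<and> rsub V q t \<subseteq> zz_space V t \<and>
     subspace (rsub_pred V q t) \<and> rsub_pred V q t \<subseteq> rsub V q t"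
  using zigzag_space.lsub_subspace[OF zigzag_space_rev, of "Suc (zz_length V) - q" "Suc (zz_length V) - t"]
    assms by (simp add: rsub_def rsub_pred_def)

lemma rsub_mono:
  assumes "1 \<le> t" "t \<le> q" "t \<le> q'" "q \<le> zz_length V" "q' \<le> zz_length V" "death_rank V q' < death_rank V q"
  shows "rsub V q' t \<subseteq> rsub_pred V q t"
  using zigzag_space.lsub_mono[OF zigzag_space_rev, of "Suc (zz_length V) - q" "Suc (zz_length V) - t"
      "Suc (zz_length V) - q'"]
    assms by (simp add: rsub_def rsub_pred_def death_rank_def)

lemma rsub_top:
  assumes "1 \<le> t" "t \<le> zz_length V"
  shows "\<exists>q. t \<le> q \<and> q \<le> zz_length V \<and> rsub V q t = zz_space V t"
proof -
  obtain p where "1 \<le> p" "p \<le> Suc (zz_length V) - t"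
      "lsub (zz_rev V) p (Suc (zz_length V) - t) = zz_space V t"
    using zigzag_space.lsub_top[OF zigzag_space_rev, of "Suc (zz_length V) - t"] assms
    by fastforce
  then show ?thesis
    using assms by (intro exI[of _ "Suc (zz_length V) - p"]) (auto simp: rsub_def)
qed

lemma rsub_pred_cases:
  assumes "1 \<le> t" "t \<le> q" "q \<le> zz_length V"
  shows "rsub_pred V q t = {0} \<or>
     (\<exists>q'. t \<le> q' \<and> q' \<le> zz_length V \<and> death_rank V q' < death_rank V q \<and> rsub_pred V q t = rsub V q' t)"
proof -
  let ?r = "\<lambda>q. Suc (zz_length V) - q"
  have "lsub_pred (zz_rev V) (?r q) (?r t) = {0} \<or>
     (\<exists>p'. 1 \<le> p' \<and> p' \<le> ?r t \<and> birth_rank (zz_rev V) p' < birth_rank (zz_rev V) (?r q) \<and>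
        lsub_pred (zz_rev V) (?r q) (?r t) = lsub (zz_rev V) p' (?r t))"
    using zigzag_space.lsub_pred_cases[OF zigzag_space_rev, of "?r q" "?r t"] assms by auto
  then show ?thesis
  proof (elim disjE exE conjE)
    fix p' assume "1 \<le> p'" "p' \<le> ?r t" "birth_rank (zz_rev V) p' < birth_rank (zz_rev V) (?r q)"
        "lsub_pred (zz_rev V) (?r q) (?r t) = lsub (zz_rev V) p' (?r t)"
    then show ?thesis using assms
      by (intro disjI2 exI[of _ "?r p'"]) (auto simp: rsub_def rsub_pred_def death_rank_def)
  qed (simp add: rsub_pred_def)
qed

lemma interval_subspace:
  assumes "1 \<le> p" "p \<le> t" "t \<le> q" "q \<le> zz_length V"
  shows "subspace (interval_num V p q t)" "subspace (interval_den V p q t)"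
    "interval_den V p q t \<subseteq> interval_num V p q t" "interval_num V p q t \<subseteq> zz_space V t"
proof -
  have L: "subspace (lsub V p t)" "lsub V p t \<subseteq> zz_space V t" "subspace (lsub_pred V p t)"
      "lsub_pred V p t \<subseteq> lsub V p t"
    using lsub_subspace[of p t] assms by auto
  have R: "subspace (rsub V q t)" "subspace (rsub_pred V q t)" "rsub_pred V q t \<subseteq> rsub V q t"
    using rsub_subspace[of t q] assms by auto
  show "subspace (interval_num V p q t)" "subspace (interval_den V p q t)"
    unfolding interval_num_def interval_den_def using L R
    by (auto intro!: subspace_inter set_sum_subspace)
  show "interval_num V p q t \<subseteq> zz_space V t" unfolding interval_num_def using L by auto
  show "interval_den V p q t \<subseteq> interval_num V p q t"
    unfolding interval_num_def interval_den_def set_sum_def using L R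
    by (auto intro!: subspace_add)
qed

definition step_rel :: "nat \<Rightarrow> 'v \<Rightarrow> 'v \<Rightarrow> bool" where
  "step_rel t x y \<longleftrightarrow>
     (if zz_forward V t then x \<in> zz_space V t \<and> y = zz_map V t x
      else y \<in> zz_space V (Suc t) \<and> x = zz_map V t y)"

lemma step_rel_linear:
  assumes "1 \<le> t" "t < zz_length V"
  shows "linear_relation scale scale (step_rel t)"
proof (cases "zz_forward V t")
  case True
  then show ?thesis
    using linear_relation_along_map[of "zz_space V t" _ "zz_map V t"] map_linear[OF assms] assms
      space_subspace[of t] unfolding step_rel_def by simp
next
  case False
  then have "linear_relation scale scale (\<lambda>y x. step_rel t x y)"
    using linear_relation_along_map[of "zz_space V (Suc t)" _ "zz_map V t"] map_linear[OF assms] assms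
      space_subspace[of "Suc t"] unfolding step_rel_def by simp
  then show ?thesis by (simp add: linear_relation_converse[of scale scale "step_rel t"])
qed

text \<open>Across a right-pointing arrow the left chain is pushed forward and the right chain
  pulled back. Across a left-pointing arrow the chains exchange roles, and the symmetry of the
  subquotient reduces this to the same lemma.\<close>

lemma step_rel_quots:
  assumes "1 \<le> p" "p \<le> t" "t < q" "q \<le> zz_length V"
  shows "relates_quots (step_rel t) (interval_num V p q t) (interval_den V p q t)
     (interval_num V p q (Suc t)) (interval_den V p q (Suc t))"
proof -
  note lin = map_linear[of t]
  have L: "subspace (lsub V p t)" "lsub V p t \<subseteq> zz_space V t" "subspace (lsub_pred V p t)"
      "lsub_pred V p t \<subseteq> lsub V p t"
    using lsub_subspace[of p t] assms by auto
  have R: "subspace (rsub V q (Suc t))" "rsub V q (Suc t) \<subseteq> zz_space V (Suc t)"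
      "subspace (rsub_pred V q (Suc t))" "rsub_pred V q (Suc t) \<subseteq> rsub V q (Suc t)"
    using rsub_subspace[of "Suc t" q] assms by auto
  have sp: "subspace (zz_space V t)" "subspace (zz_space V (Suc t))"
    using space_subspace assms by auto
  note st = lsub_Suc[of p t V] lsub_pred_Suc[of p t V] rsub_step[of t q V] zz_step_def
  show ?thesis
  proof (cases "zz_forward V t")
    case True
    then show ?thesis
      using relates_quots_along_map[OF _ sp(1) L R(1,3,4)] lin assms
      unfolding interval_num_def interval_den_def step_rel_def by (simp add: st)
  next
    case False
    then have "relates_quots (\<lambda>y x. step_rel t x y) (interval_num V p q (Suc t)) (interval_den V p q (Suc t))
       (interval_num V p q t) (interval_den V p q t)"
      using relates_quots_along_map[OF _ sp(2) R L(1,3,4)] lin assms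
      unfolding interval_num_def interval_den_def step_rel_def
      by (simp add: st Int_commute[of "lsub V p t"] Int_commute[of "lsub_pred V p t"]
        Int_commute[of _ "rsub V q (Suc t)"] Int_commute[of _ "rsub_pred V q (Suc t)"]
        set_sum_commute[of "rsub V q (Suc t) \<inter> _"] set_sum_commute[of "zz_map V t ` rsub V q (Suc t) \<inter> _"])
    then show ?thesis by (simp add: relates_quots_converse[of "step_rel t"])
  qed
qed

end


section \<open>Multiplicities as dimensions of subquotients\<close>

text \<open>Exposes the family bound existentially in \<open>zigzag_iso\<close>, because one and the
  same \<open>\<phi>\<close> has to be followed through chains and reversals.\<close>

definition zz_iso_via ::
  "(nat \<Rightarrow> 'v \<Rightarrow> 'w) \<Rightarrow> ('k \<Rightarrow> 'v \<Rightarrow> 'v) \<Rightarrow> ('k \<Rightarrow> 'w \<Rightarrow> 'w) \<Rightarrow>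
   ('v::ab_group_add) zigzag \<Rightarrow> ('w::ab_group_add) zigzag \<Rightarrow> bool" where
  "zz_iso_via \<phi> s1 s2 V W \<longleftrightarrow>
     zz_length V = zz_length W \<and>
     (\<forall>j. 1 \<le> j \<and> j < zz_length V \<longrightarrow> zz_forward V j = zz_forward W j) \<and>
     (\<forall>j. 1 \<le> j \<and> j \<le> zz_length V \<longrightarrow>
        linear_between s1 s2 (zz_space V j) (zz_space W j) (\<phi> j) \<and>
        bij_betw (\<phi> j) (zz_space V j) (zz_space W j)) \<and>
     (\<forall>j x. 1 \<le> j \<and> j < zz_length V \<longrightarrow>
        (if zz_forward V j then x \<in> zz_space V j \<longrightarrow> \<phi> (Suc j) (zz_map V j x) = zz_map W j (\<phi> j x)
         else x \<in> zz_space V (Suc j) \<longrightarrow> \<phi> j (zz_map V j x) = zz_map W j (\<phi> (Suc j) x)))"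

lemma zigzag_iso_iff_via: "zigzag_iso s1 s2 V W \<longleftrightarrow> (\<exists>\<phi>. zz_iso_via \<phi> s1 s2 V W)"
proof -
  have ball: "(\<forall>j\<in>{1..n}. Q j) \<longleftrightarrow> (\<forall>j. 1 \<le> j \<and> j \<le> n \<longrightarrow> Q j)"
    "(\<forall>j\<in>{1..<n}. Q j) \<longleftrightarrow> (\<forall>j. 1 \<le> j \<and> j < n \<longrightarrow> Q j)" for n :: nat and Q
    by auto
  have s: "(\<forall>x\<in>zz_source V j. if zz_forward V j then \<phi> (j + 1) (zz_map V j x) = zz_map W j (\<phi> j x)
             else \<phi> j (zz_map V j x) = zz_map W j (\<phi> (j + 1) x)) \<longleftrightarrow>
     (\<forall>x. if zz_forward V j then x \<in> zz_space V j \<longrightarrow> \<phi> (Suc j) (zz_map V j x) = zz_map W j (\<phi> j x)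
         else x \<in> zz_space V (Suc j) \<longrightarrow> \<phi> j (zz_map V j x) = zz_map W j (\<phi> (Suc j) x))" for \<phi> j
    unfolding zz_source_def by (cases "zz_forward V j") auto
  show ?thesis
    unfolding zigzag_iso_def zz_iso_via_def ball s by blast
qed

lemma zz_iso_viaD:
  assumes "zz_iso_via \<phi> s1 s2 V W"
  shows "zz_length W = zz_length V"
    and "1 \<le> j \<Longrightarrow> j < zz_length V \<Longrightarrow> zz_forward W j = zz_forward V j"
    and "1 \<le> j \<Longrightarrow> j \<le> zz_length V \<Longrightarrow> linear_between s1 s2 (zz_space V j) (zz_space W j) (\<phi> j)"
    and "1 \<le> j \<Longrightarrow> j \<le> zz_length V \<Longrightarrow> bij_betw (\<phi> j) (zz_space V j) (zz_space W j)"
    and "1 \<le> j \<Longrightarrow> j < zz_length V \<Longrightarrow> zz_forward V j \<Longrightarrow> x \<in> zz_space V j \<Longrightarrow>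
           \<phi> (Suc j) (zz_map V j x) = zz_map W j (\<phi> j x)"
    and "1 \<le> j \<Longrightarrow> j < zz_length V \<Longrightarrow> \<not> zz_forward V j \<Longrightarrow> x \<in> zz_space V (Suc j) \<Longrightarrow>
           \<phi> j (zz_map V j x) = zz_map W j (\<phi> (Suc j) x)"
  using assms unfolding zz_iso_via_def by simp_all

lemma zz_iso_via_rev:
  assumes "zz_iso_via \<phi> s1 s2 V W"
  shows "zz_iso_via (\<lambda>j. \<phi> (Suc (zz_length V) - j)) s1 s2 (zz_rev V) (zz_rev W)"
proof -
  have e: "Suc (zz_length V - j) = Suc (zz_length V) - j" "Suc (zz_length V) - Suc j = zz_length V - j"
    "1 \<le> zz_length V - j" "zz_length V - j < zz_length V"
    if "1 \<le> j" "j < zz_length V" for j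
    using that by auto
  note D = zz_iso_viaD[OF assms]
  show ?thesis
    unfolding zz_iso_via_def zz_rev_simps D(1)
  proof (intro conjI allI impI, goal_cases)
    case (2 j)
    then show ?case using D(2)[of "zz_length V - j"] by auto
  next
    case (3 j)
    then show ?case by (intro D(3)) auto
  next
    case (4 j)
    then show ?case by (intro D(4)) auto
  next
    case (5 j x)
    then show ?case
      using D(5)[of "zz_length V - j" x] D(6)[of "zz_length V - j" x] e[of j] by auto
  qed simp
qed

section \<open>Invariance of the subquotients under isomorphism\<close>

locale zigzag_space_pair =
  V: zigzag_space s1 V + W: zigzag_space s2 W
  for s1 :: "'k::field \<Rightarrow> 'v::ab_group_add \<Rightarrow> 'v" and s2 :: "'k \<Rightarrow> 'w::ab_group_add \<Rightarrow> 'w" and V W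
begin

sublocale scalar_space_pair s1 s2 ..

lemma linear_between_zero:
  assumes "linear_between s1 s2 A B g" "V.subspace A"
  shows "g 0 = 0"
proof -
  have "0 \<in> A" using assms(2) V.subspace_0 by auto
  then have "g (s1 0 0) = s2 0 (g 0)" using assms(1) unfolding linear_between_def by blast
  then show ?thesis by simp
qed

lemma zz_step_iso:
  assumes iso: "zz_iso_via \<phi> s1 s2 V W" and j: "1 \<le> j" "j < zz_length V"
    and S: "S \<subseteq> zz_space V j"
  shows "zz_step W j (\<phi> j ` S) = \<phi> (Suc j) ` zz_step V j S"
proof -
  have f: "zz_forward W j = zz_forward V j" using iso j unfolding zz_iso_via_def by auto
  have b: "bij_betw (\<phi> j) (zz_space V j) (zz_space W j)"
      "bij_betw (\<phi> (Suc j)) (zz_space V (Suc j)) (zz_space W (Suc j))"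
    using iso j unfolding zz_iso_via_def by auto
  show ?thesis
  proof (cases "zz_forward V j")
    case True
    then have "\<phi> (Suc j) (zz_map V j x) = zz_map W j (\<phi> j x)" if "x \<in> S" for x
      using iso j that S unfolding zz_iso_via_def by auto
    then show ?thesis using True f unfolding zz_step_def by (force simp: image_image)
  next
    case False
    have c: "\<phi> j (zz_map V j x) = zz_map W j (\<phi> (Suc j) x)" if "x \<in> zz_space V (Suc j)" for x
      using iso j that False unfolding zz_iso_via_def by auto
    have m: "zz_map V j x \<in> zz_space V j" if "x \<in> zz_space V (Suc j)" for x
      using V.map_linear[OF j] that False unfolding linear_between_def by auto
    have "zz_map W j (\<phi> (Suc j) x) \<in> \<phi> j ` S \<longleftrightarrow> zz_map V j x \<in> S" if x: "x \<in> zz_space V (Suc j)" for x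
      unfolding c[OF x, symmetric]
      using inj_on_image_mem_iff[OF bij_betw_imp_inj_on[OF b(1)] m[OF x] S] .
    then show ?thesis
      using False f unfolding zz_step_def bij_betw_imp_surj_on[OF b(2), symmetric] by auto
  qed
qed

lemma birth_space_iso:
  assumes iso: "zz_iso_via \<phi> s1 s2 V W" and p: "1 \<le> p" "p \<le> zz_length V"
  shows "birth_space W p = \<phi> p ` birth_space V p"
    "birth_space_pred W p = \<phi> p ` birth_space_pred V p"
proof -
  have len: "zz_length W = zz_length V" using iso unfolding zz_iso_via_def by simp
  have b: "bij_betw (\<phi> p) (zz_space V p) (zz_space W p)"
      "linear_between s1 s2 (zz_space V p) (zz_space W p) (\<phi> p)"
    using iso p unfolding zz_iso_via_def by auto
  have im: "zz_space W p = \<phi> p ` zz_space V p" using bij_betw_imp_surj_on[OF b(1)] by simp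
  have z: "\<phi> p 0 = 0" using linear_between_zero[OF b(2)] V.space_subspace p by auto
  show "birth_space W p = \<phi> p ` birth_space V p"
    "birth_space_pred W p = \<phi> p ` birth_space_pred V p"
  proof -
    show "birth_space W p = \<phi> p ` birth_space V p"
    proof (cases "p = 1")
      case True
      then show ?thesis using im by (simp add: birth_space_def)
    next
      case False
      then obtain m where m: "p = Suc m" "1 \<le> m" using p by (cases p) auto
      have f: "zz_forward W m = zz_forward V m" using iso p m unfolding zz_iso_via_def by auto
      have sp: "V.subspace (zz_space V m)" using V.space_subspace m p by auto
      have z': "\<phi> m 0 = 0"
        using linear_between_zero[OF _ sp] iso m p unfolding zz_iso_via_def by auto
      have "zz_step W m {0} = \<phi> p ` zz_step V m {0}"
        using zz_step_iso[OF iso, of m "{0}"] m p z' V.subspace_0[OF sp] by simp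
      then show ?thesis
        using m im f by (cases "zz_forward V m") (auto simp: birth_space_def zz_step_def)
    qed
    show "birth_space_pred W p = \<phi> p ` birth_space_pred V p"
    proof (cases "p = 1")
      case True
      then show ?thesis using z by (simp add: birth_space_pred_def)
    next
      case False
      then obtain m where m: "p = Suc m" "1 \<le> m" using p by (cases p) auto
      have f: "zz_forward W m = zz_forward V m" using iso p m unfolding zz_iso_via_def by auto
      have im': "zz_space W m = \<phi> m ` zz_space V m"
        using bij_betw_imp_surj_on[OF zz_iso_viaD(4)[OF iso, of m]] m p by simp
      have "zz_step W m (zz_space W m) = \<phi> p ` zz_step V m (zz_space V m)"
        using zz_step_iso[OF iso, of m "zz_space V m"] m p im' by simp
      then show ?thesis
        using m f z by (cases "zz_forward V m") (simp_all add: birth_space_pred_def zz_step_def)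
    qed
  qed
qed

lemma lsub_iso:
  assumes iso: "zz_iso_via \<phi> s1 s2 V W" and p: "1 \<le> p" "p \<le> t" "t \<le> zz_length V"
  shows "lsub W p t = \<phi> t ` lsub V p t \<and> lsub_pred W p t = \<phi> t ` lsub_pred V p t"
  using p(2,3)
proof (induction t rule: dec_induct)
  case base
  then show ?case using birth_space_iso[OF iso p(1)] p by (simp add: lsub_start lsub_pred_start)
next
  case (step t)
  have t: "1 \<le> t" "t < zz_length V" using step p by auto
  have "lsub V p t \<subseteq> zz_space V t" "lsub_pred V p t \<subseteq> zz_space V t"
    using V.lsub_subspace[of p t] p(1) step(1) t by auto
  then show ?case
    using step t zz_step_iso[OF iso t] by (simp add: lsub_Suc lsub_pred_Suc)
qed

lemma rsub_iso:
  assumes iso: "zz_iso_via \<phi> s1 s2 V W" and p: "1 \<le> t" "t \<le> q" "q \<le> zz_length V"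
  shows "rsub W q t = \<phi> t ` rsub V q t \<and> rsub_pred W q t = \<phi> t ` rsub_pred V q t"
proof -
  interpret rev: zigzag_space_pair s1 s2 "zz_rev V" "zz_rev W"
    using V.zigzag_space_rev W.zigzag_space_rev by (rule zigzag_space_pair.intro)
  have len: "zz_length W = zz_length V" using iso unfolding zz_iso_via_def by simp
  show ?thesis
    using rev.lsub_iso[OF zz_iso_via_rev[OF iso], of "Suc (zz_length V) - q" "Suc (zz_length V) - t"] p len
    by (simp add: rsub_def rsub_pred_def)
qed

lemma quot_dim_iso:
  assumes iso: "zz_iso_via \<phi> s1 s2 V W" and p: "1 \<le> p" "p \<le> t" "t \<le> q" "q \<le> zz_length V"
  shows "V.quot_dim (interval_num V p q t) (interval_den V p q t) =
         W.quot_dim (interval_num W p q t) (interval_den W p q t)"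
proof (rule quot_dim_transfer)
  have len: "zz_length W = zz_length V" using iso unfolding zz_iso_via_def by simp
  let ?R = "\<lambda>x y. x \<in> zz_space V t \<and> y = \<phi> t x"
  have lin: "linear_between s1 s2 (zz_space V t) (zz_space W t) (\<phi> t)"
    and bij: "bij_betw (\<phi> t) (zz_space V t) (zz_space W t)"
    using iso p unfolding zz_iso_via_def by auto
  have sp: "V.subspace (zz_space V t)" using V.space_subspace p by auto
  show "linear_relation s1 s2 ?R"
    using lin linear_between_zero[OF lin sp] sp unfolding linear_relation_def linear_between_def
    by (auto simp: V.subspace_0 V.subspace_add V.subspace_scale)
  note inj = bij_betw_imp_inj_on[OF bij]
  have sub: "lsub V p t \<subseteq> zz_space V t" "lsub_pred V p t \<subseteq> zz_space V t"
      "rsub V q t \<subseteq> zz_space V t" "rsub_pred V q t \<subseteq> zz_space V t"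
    using V.lsub_subspace[of p t] V.rsub_subspace[of t q] p by auto
  note Vs = V.interval_subspace[OF p]
  have num: "interval_num W p q t = \<phi> t ` interval_num V p q t"
    using lsub_iso[OF iso] rsub_iso[OF iso] p inj_on_image_Int[OF inj sub(1,3)]
    by (simp add: interval_num_def)
  have ssum: "set_sum (\<phi> t ` A) (\<phi> t ` B) = \<phi> t ` set_sum A B"
    if "A \<subseteq> zz_space V t" "B \<subseteq> zz_space V t" for A B
  proof -
    have a: "\<phi> t (x + y) = \<phi> t x + \<phi> t y" if "x \<in> zz_space V t" "y \<in> zz_space V t" for x y
      using lin that unfolding linear_between_def by auto
    have "\<exists>x y. z = \<phi> t (x + y) \<and> x \<in> A \<and> y \<in> B" if "z = \<phi> t x + \<phi> t y" "x \<in> A" "y \<in> B" for x y z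
      using a[of x y] that \<open>A \<subseteq> zz_space V t\<close> \<open>B \<subseteq> zz_space V t\<close> by (metis subsetD)
    moreover have "\<phi> t (x + y) = \<phi> t x + \<phi> t y" if "x \<in> A" "y \<in> B" for x y
      using a[of x y] that \<open>A \<subseteq> zz_space V t\<close> \<open>B \<subseteq> zz_space V t\<close> by (metis subsetD)
    ultimately show ?thesis unfolding set_sum_def by (auto simp: image_iff) blast+
  qed
  have den: "interval_den W p q t = \<phi> t ` interval_den V p q t"
    using lsub_iso[OF iso, of p t] rsub_iso[OF iso, of t q] p inj_on_image_Int[OF inj sub(2,3)]
      inj_on_image_Int[OF inj sub(1,4)]
      ssum[of "lsub_pred V p t \<inter> rsub V q t" "lsub V p t \<inter> rsub_pred V q t"] sub
    by (simp add: interval_den_def le_infI1)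
  have "\<phi> t x \<in> \<phi> t ` interval_den V p q t \<longleftrightarrow> x \<in> interval_den V p q t" if "x \<in> interval_num V p q t" for x
    using inj_on_image_mem_iff[OF inj] that Vs by blast
  then show "relates_quots ?R (interval_num V p q t) (interval_den V p q t)
      (interval_num W p q t) (interval_den W p q t)"
    using Vs(4) unfolding relates_quots_def num den by (intro conjI ballI) auto
  show "V.subspace (interval_num V p q t)" "V.subspace (interval_den V p q t)"
    "interval_den V p q t \<subseteq> interval_num V p q t"
    using Vs by auto
  show "W.subspace (interval_num W p q t)" "W.subspace (interval_den W p q t)"
    "interval_den W p q t \<subseteq> interval_num W p q t"
    using W.interval_subspace[of p t q] p len by auto
qed

end

section \<open>Direct sums of interval modules in coordinates\<close>

definition split_zigzag ::
  "('s \<Rightarrow> 'k::field) zigzag \<Rightarrow> 's set \<Rightarrow> ('s \<Rightarrow> nat) \<Rightarrow> ('s \<Rightarrow> nat) \<Rightarrow> bool" where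
  "split_zigzag W S b d \<longleftrightarrow>
     (\<forall>s\<in>S. 1 \<le> b s \<and> b s \<le> d s \<and> d s \<le> zz_length W) \<and>
     (\<forall>j. 1 \<le> j \<and> j \<le> zz_length W \<longrightarrow>
        zz_space W j = {x. finite {s. x s \<noteq> 0} \<and> (\<forall>s. x s \<noteq> 0 \<longrightarrow> s \<in> S \<and> b s \<le> j \<and> j \<le> d s)}) \<and>
     (\<forall>j x s. 1 \<le> j \<and> j < zz_length W \<longrightarrow>
        zz_map W j x s = (if s \<in> S \<and> b s \<le> j \<and> Suc j \<le> d s then x s else 0))"

lemma split_zigzagD:
  assumes "split_zigzag W S b d"
  shows "s \<in> S \<Longrightarrow> 1 \<le> b s" "s \<in> S \<Longrightarrow> b s \<le> d s" "s \<in> S \<Longrightarrow> d s \<le> zz_length W"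
    and "1 \<le> j \<Longrightarrow> j \<le> zz_length W \<Longrightarrow>
        zz_space W j = {x. finite {s. x s \<noteq> 0} \<and> (\<forall>s. x s \<noteq> 0 \<longrightarrow> s \<in> S \<and> b s \<le> j \<and> j \<le> d s)}"
    and "1 \<le> j \<Longrightarrow> j < zz_length W \<Longrightarrow>
        zz_map W j x s = (if s \<in> S \<and> b s \<le> j \<and> Suc j \<le> d s then x s else 0)"
  using assms unfolding split_zigzag_def by simp_all

text \<open>Births and deaths are arbitrary functions on the labels precisely so that the reversal
  has the same form, with the two functions exchanged and reflected.\<close>

lemma split_zigzag_rev:
  assumes "split_zigzag W S b d"
  shows "split_zigzag (zz_rev W) S (\<lambda>s. Suc (zz_length W) - d s) (\<lambda>s. Suc (zz_length W) - b s)"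
proof -
  have r: "1 \<le> b s" "b s \<le> d s" "d s \<le> zz_length W" if "s \<in> S" for s
    using split_zigzagD(1-3)[OF assms that] by auto
  show ?thesis
    unfolding split_zigzag_def zz_rev_simps
  proof (intro conjI allI impI ballI, goal_cases)
    case (4 j)
    have "s \<in> S \<and> b s \<le> Suc (zz_length W) - j \<and> Suc (zz_length W) - j \<le> d s \<longleftrightarrow>
      s \<in> S \<and> Suc (zz_length W) - d s \<le> j \<and> j \<le> Suc (zz_length W) - b s" for s
      using r[of s] 4 by auto
    moreover have "zz_space W (Suc (zz_length W) - j) =
      {x. finite {s. x s \<noteq> 0} \<and> (\<forall>s. x s \<noteq> 0 \<longrightarrow>
         s \<in> S \<and> b s \<le> Suc (zz_length W) - j \<and> Suc (zz_length W) - j \<le> d s)}"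
      using 4 by (intro split_zigzagD(4)[OF assms]) auto
    ultimately show ?case by simp
  next
    case (5 j x s)
    have "s \<in> S \<and> b s \<le> zz_length W - j \<and> Suc (zz_length W - j) \<le> d s \<longleftrightarrow>
      s \<in> S \<and> Suc (zz_length W) - d s \<le> j \<and> Suc j \<le> Suc (zz_length W) - b s"
      using r[of s] 5 by auto
    moreover have "zz_map W (zz_length W - j) x s =
      (if s \<in> S \<and> b s \<le> zz_length W - j \<and> Suc (zz_length W - j) \<le> d s then x s else 0)"
      using 5 by (intro split_zigzagD(5)[OF assms]) auto
    ultimately show ?case by simp
  qed (use r in \<open>force+\<close>)
qed

text \<open>Subspaces cut out by a condition on supports keep this form under a step. Intervals born
  at \<open>Suc j\<close> are missing from an image and unrestricted in a preimage.\<close>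

lemma split_zigzag_support:
  assumes W: "split_zigzag W S b d" and j: "1 \<le> j" "j < zz_length W"
  shows "zz_map W j ` {x\<in>zz_space W j. \<forall>s. x s \<noteq> 0 \<longrightarrow> P s} =
           {y\<in>zz_space W (Suc j). \<forall>s. y s \<noteq> 0 \<longrightarrow> b s \<le> j \<and> P s}" (is ?img)
    and "{y\<in>zz_space W (Suc j). zz_map W j y \<in> {x\<in>zz_space W j. \<forall>s. x s \<noteq> 0 \<longrightarrow> P s}} =
           {y\<in>zz_space W (Suc j). \<forall>s. y s \<noteq> 0 \<longrightarrow> b s \<le> j \<longrightarrow> P s}" (is ?pre)
proof -
  have sp: "zz_space W i = {x. finite {s. x s \<noteq> 0} \<and> (\<forall>s. x s \<noteq> 0 \<longrightarrow> s \<in> S \<and> b s \<le> i \<and> i \<le> d s)}"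
    if "i = j \<or> i = Suc j" for i
    using split_zigzagD(4)[OF W, of i] j that by auto
  have m: "zz_map W j x s = (if s \<in> S \<and> b s \<le> j \<and> Suc j \<le> d s then x s else 0)" for x s
    using split_zigzagD(5)[OF W j] .
  have fin: "finite {s. zz_map W j x s \<noteq> 0}" if "finite {s. x s \<noteq> 0}" for x
    by (rule finite_subset[OF _ that]) (auto simp: m)
  have "{y\<in>zz_space W (Suc j). \<forall>s. y s \<noteq> 0 \<longrightarrow> b s \<le> j \<and> P s} \<subseteq>
      zz_map W j ` {x\<in>zz_space W j. \<forall>s. x s \<noteq> 0 \<longrightarrow> P s}"
  proof
    fix y assume y: "y \<in> {y\<in>zz_space W (Suc j). \<forall>s. y s \<noteq> 0 \<longrightarrow> b s \<le> j \<and> P s}"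
    \<comment> \<open>All coordinates of \<open>y\<close> belong to intervals that contain both
      positions, so \<open>y\<close> is its own preimage.\<close>
    then have "zz_map W j y = y" by (auto simp: fun_eq_iff m sp)
    moreover have "y \<in> {x\<in>zz_space W j. \<forall>s. x s \<noteq> 0 \<longrightarrow> P s}" using y by (auto simp: sp dest: Suc_leD)
    ultimately show "y \<in> zz_map W j ` {x\<in>zz_space W j. \<forall>s. x s \<noteq> 0 \<longrightarrow> P s}"
      by (intro image_eqI[of y "zz_map W j" y]) simp_all
  qed
  moreover have "zz_map W j x \<in> {y\<in>zz_space W (Suc j). \<forall>s. y s \<noteq> 0 \<longrightarrow> b s \<le> j \<and> P s}"
    if "x \<in> {x\<in>zz_space W j. \<forall>s. x s \<noteq> 0 \<longrightarrow> P s}" for x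
    using that fin[of x] unfolding sp[OF disjI1[OF refl]] sp[OF disjI2[OF refl]] by (simp add: m)
  ultimately show ?img by blast
  have "zz_map W j y \<in> {x\<in>zz_space W j. \<forall>s. x s \<noteq> 0 \<longrightarrow> P s} \<longleftrightarrow> (\<forall>s. y s \<noteq> 0 \<longrightarrow> b s \<le> j \<longrightarrow> P s)"
    if "y \<in> zz_space W (Suc j)" for y
    using that fin[of y] unfolding sp[OF disjI1[OF refl]] sp[OF disjI2[OF refl]]
    by (simp add: m) (meson Suc_leD)
  then show ?pre by blast
qed

text \<open>In coordinates the chain merely sorts the intervals by birth rank; the induction follows
  the supports through each step.\<close>

lemma split_zigzag_lsub:
  assumes W: "split_zigzag W S b d" and p: "1 \<le> p" "p \<le> t" "t \<le> zz_length W"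
  shows "lsub W p t = {x\<in>zz_space W t. \<forall>s. x s \<noteq> 0 \<longrightarrow> birth_rank W (b s) \<le> birth_rank W p} \<and>
         lsub_pred W p t = {x\<in>zz_space W t. \<forall>s. x s \<noteq> 0 \<longrightarrow> birth_rank W (b s) < birth_rank W p}"
  using p(2,3)
proof (induction t rule: dec_induct)
  case base
  have sp: "zz_space W p = {x. finite {s. x s \<noteq> 0} \<and> (\<forall>s. x s \<noteq> 0 \<longrightarrow> s \<in> S \<and> b s \<le> p \<and> p \<le> d s)}"
    using split_zigzagD(4)[OF W] p base by simp
  note b1 = split_zigzagD(1)[OF W]
  show ?case
  proof (cases "p = 1")
    case True
    have "b s = 1" if "x \<in> zz_space W p" "x s \<noteq> 0" for x s
      using that b1[of s] True unfolding sp by auto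
    moreover have "(\<lambda>s. 0) \<in> zz_space W 1" using True sp by auto
    ultimately show ?thesis using True
      by (auto simp: lsub_start lsub_pred_start birth_space_def birth_space_pred_def fun_eq_iff)
  next
    case False
    then obtain m where m: "p = Suc m" "1 \<le> m" using p by (cases p) auto
    have rank: "birth_rank W (b s) < birth_rank W p \<longleftrightarrow> b s \<le> m \<and> zz_forward W m"
      "birth_rank W (b s) \<le> birth_rank W p \<longleftrightarrow> \<not> b s \<le> m \<or> zz_forward W m"
      if "x \<in> zz_space W p" "x s \<noteq> 0" for x s
    proof -
      have "s \<in> S" "b s \<le> Suc m" "1 \<le> b s" using that b1 sp m by auto
      then show "birth_rank W (b s) < birth_rank W p \<longleftrightarrow> b s \<le> m \<and> zz_forward W m"
        "birth_rank W (b s) \<le> birth_rank W p \<longleftrightarrow> \<not> b s \<le> m \<or> zz_forward W m"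
        using birth_rank_less_Suc[of "b s" m W] base m p by (auto simp: le_Suc_eq)
    qed
    have sup: "zz_map W m ` zz_space W m = {y\<in>zz_space W p. \<forall>s. y s \<noteq> 0 \<longrightarrow> b s \<le> m}"
      "{y\<in>zz_space W p. zz_map W m y = 0} = {y\<in>zz_space W p. \<forall>s. y s \<noteq> 0 \<longrightarrow> \<not> b s \<le> m}"
    proof -
      show "zz_map W m ` zz_space W m = {y\<in>zz_space W p. \<forall>s. y s \<noteq> 0 \<longrightarrow> b s \<le> m}"
        using split_zigzag_support(1)[OF W, of m "\<lambda>_. True"] m base p by simp
      have "{x\<in>zz_space W m. \<forall>s. x s \<noteq> 0 \<longrightarrow> False} = {0}"
        using split_zigzagD(4)[OF W, of m] m base p by (auto simp: fun_eq_iff)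
      then show "{y\<in>zz_space W p. zz_map W m y = 0} = {y\<in>zz_space W p. \<forall>s. y s \<noteq> 0 \<longrightarrow> \<not> b s \<le> m}"
        using split_zigzag_support(2)[OF W, of m "\<lambda>_. False"] m base p by simp
    qed
    have 0: "(\<lambda>s. 0) \<in> zz_space W p" unfolding sp by auto
    show ?thesis
    proof (cases "zz_forward W m")
      case True
      then show ?thesis
        using m rank sup by (auto simp: lsub_start lsub_pred_start birth_space_def birth_space_pred_def)
    next
      case False
      have "{x\<in>zz_space W p. \<forall>s. x s \<noteq> 0 \<longrightarrow> birth_rank W (b s) < birth_rank W p} = {0}"
        using rank(1) False 0 by (auto simp: fun_eq_iff zero_fun_def)
      moreover have "{x\<in>zz_space W p. \<forall>s. x s \<noteq> 0 \<longrightarrow> birth_rank W (b s) \<le> birth_rank W p} =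
          {y\<in>zz_space W p. \<forall>s. y s \<noteq> 0 \<longrightarrow> \<not> b s \<le> m}"
        using rank(2) False by auto
      ultimately show ?thesis
        using False m sup(2) by (simp add: lsub_start lsub_pred_start birth_space_def birth_space_pred_def)
    qed
  qed
next
  case (step t)
  have t: "1 \<le> t" "t < zz_length W" using step p by auto
  have st: "s \<in> S" "1 \<le> b s" "b s \<le> Suc t" if "y \<in> zz_space W (Suc t)" "y s \<noteq> 0" for y s
    using split_zigzagD(4)[OF W, of "Suc t"] split_zigzagD(1)[OF W, of s] that t by auto
  have rp: "birth_rank W p < birth_rank W (Suc t) \<longleftrightarrow> zz_forward W t"
     "birth_rank W (Suc t) < birth_rank W p \<longleftrightarrow> \<not> zz_forward W t"
    using birth_rank_less_Suc[of p t W] p(1) step(1) t by auto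
  \<comment> \<open>After a right-pointing arrow \<open>Suc t\<close> outranks \<open>p\<close>, so
    the rank condition already excludes intervals born there. After a left-pointing arrow it ranks
    below \<open>p\<close>, so the condition already admits them.\<close>
  have fwd: "{y\<in>zz_space W (Suc t). \<forall>s. y s \<noteq> 0 \<longrightarrow> b s \<le> t \<and> P (birth_rank W (b s))} =
      {y\<in>zz_space W (Suc t). \<forall>s. y s \<noteq> 0 \<longrightarrow> P (birth_rank W (b s))}"
    if "\<not> P (birth_rank W (Suc t))" for P
    using st that by (auto simp: le_Suc_eq) metis
  have bwd: "{y\<in>zz_space W (Suc t). \<forall>s. y s \<noteq> 0 \<longrightarrow> b s \<le> t \<longrightarrow> P (birth_rank W (b s))} =
      {y\<in>zz_space W (Suc t). \<forall>s. y s \<noteq> 0 \<longrightarrow> P (birth_rank W (b s))}"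
    if "P (birth_rank W (Suc t))" for P
    using st that by (auto simp: le_Suc_eq) metis
  have IH: "lsub W p t = {x\<in>zz_space W t. \<forall>s. x s \<noteq> 0 \<longrightarrow> birth_rank W (b s) \<le> birth_rank W p}"
         "lsub_pred W p t = {x\<in>zz_space W t. \<forall>s. x s \<noteq> 0 \<longrightarrow> birth_rank W (b s) < birth_rank W p}"
    using step by auto
  show ?case
    unfolding lsub_Suc[OF step(1)] lsub_pred_Suc[OF step(1)] zz_step_def IH
      split_zigzag_support[OF W t]
    using rp fwd[of "\<lambda>r. r \<le> birth_rank W p"] fwd[of "\<lambda>r. r < birth_rank W p"]
      bwd[of "\<lambda>r. r \<le> birth_rank W p"] bwd[of "\<lambda>r. r < birth_rank W p"]
    by (cases "zz_forward W t") simp_all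
qed

lemma split_zigzag_rsub:
  assumes W: "split_zigzag W S b d" and t: "1 \<le> t" "t \<le> q" "q \<le> zz_length W"
  shows "rsub W q t = {x\<in>zz_space W t. \<forall>s. x s \<noteq> 0 \<longrightarrow> death_rank W (d s) \<le> death_rank W q} \<and>
         rsub_pred W q t = {x\<in>zz_space W t. \<forall>s. x s \<noteq> 0 \<longrightarrow> death_rank W (d s) < death_rank W q}"
  using split_zigzag_lsub[OF split_zigzag_rev[OF W], of "Suc (zz_length W) - q" "Suc (zz_length W) - t"] t
  by (simp add: rsub_def rsub_pred_def death_rank_def)

interpretation families: scalar_space "\<lambda>(c::'k::field) x (s::'s). c * x s"
  by unfold_locales (auto simp: fun_eq_iff algebra_simps)

lemma sum_fun_apply: "(\<Sum>i\<in>I. F i) s = (\<Sum>i\<in>I. F i s :: 'a::comm_monoid_add)"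
  by (induction I rule: infinite_finite_induct) auto

lemma families_subspace_support: "families.subspace {x. \<forall>s. x s \<noteq> 0 \<longrightarrow> P s}"
  by (rule families.subspaceI) (auto, metis add.right_neutral)

lemma split_zigzag_module:
  assumes W: "split_zigzag W S b d"
  shows "zigzag_space (\<lambda>c x s. c * x s) W"
proof
  have sp: "zz_space W i = {x. finite {s. x s \<noteq> 0} \<and> (\<forall>s. x s \<noteq> 0 \<longrightarrow> s \<in> S \<and> b s \<le> i \<and> i \<le> d s)}"
    if "1 \<le> i" "i \<le> zz_length W" for i
    using split_zigzagD(4)[OF W that] .
  have m: "zz_map W j x s = (if s \<in> S \<and> b s \<le> j \<and> Suc j \<le> d s then x s else 0)"
    if "1 \<le> j" "j < zz_length W" for j x s
    using split_zigzagD(5)[OF W that] .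
  have "families.subspace (zz_space W i)" if "1 \<le> i" "i \<le> zz_length W" for i
  proof -
    have "families.subspace {x :: 'a \<Rightarrow> 'b. finite {s. x s \<noteq> 0}}"
    proof (rule families.subspaceI)
      show "x + y \<in> {x. finite {s. x s \<noteq> 0}}" if "x \<in> {x. finite {s. x s \<noteq> 0}}" "y \<in> {x. finite {s. x s \<noteq> 0}}"
        for x y :: "'a \<Rightarrow> 'b"
        using that by (auto intro!: finite_subset[of "{s. x s + y s \<noteq> 0}" "{s. x s \<noteq> 0} \<union> {s. y s \<noteq> 0}"])
    qed auto
    from families.subspace_inter[OF this families_subspace_support[of "\<lambda>s. s \<in> S \<and> b s \<le> i \<and> i \<le> d s"]]
    show ?thesis unfolding sp[OF that] by (simp add: Collect_conj_eq)
  qed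
  moreover have "linear_between (\<lambda>c x s. c * x s) (\<lambda>c x s. c * x s) (zz_source W j) (zz_target W j) (zz_map W j)"
    if j: "1 \<le> j" "j < zz_length W" for j
  proof -
    have fin: "finite {s. zz_map W j x s \<noteq> 0}" if "finite {s. x s \<noteq> 0}" for x
      by (rule finite_subset[OF _ that]) (auto simp: m[OF j])
    have sp': "1 \<le> i \<Longrightarrow> i \<le> zz_length W \<Longrightarrow> x \<in> zz_space W i \<longleftrightarrow>
      finite {s. x s \<noteq> 0} \<and> (\<forall>s. x s \<noteq> 0 \<longrightarrow> s \<in> S \<and> b s \<le> i \<and> i \<le> d s)" for x i
      using sp[of i] by simp
    have "zz_map W j x \<in> zz_target W j" if x: "x \<in> zz_source W j" for x
      using x j fin[of x] unfolding zz_source_def zz_target_def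
      by (cases "zz_forward W j") (auto simp: sp' m[OF j] split: if_splits)
    then show ?thesis
      unfolding linear_between_def by (auto simp: m[OF j] fun_eq_iff)
  qed
  ultimately show "zigzag_module (\<lambda>c x s. c * x s) W" unfolding zigzag_module_def by auto
qed

text \<open>The coordinate vectors of the copies of \<open>[p, q]\<close> are a basis modulo the
  denominator: every other interval occurring in the numerator has a strictly smaller birth rank or
  a strictly smaller death rank.\<close>

lemma split_zigzag_quot_dim:
  assumes W: "split_zigzag W S b d" and p: "1 \<le> p" "p \<le> t" "t \<le> q" "q \<le> zz_length W"
  shows "families.quot_dim (interval_num W p q t) (interval_den W p q t) = ecard {s\<in>S. b s = p \<and> d s = q}"
proof -
  interpret zigzag_space "\<lambda>c x s. c * x s" W by (rule split_zigzag_module[OF W])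
  let ?T = "{s\<in>S. b s = p \<and> d s = q}"
  define e :: "'a \<Rightarrow> 'a \<Rightarrow> 'b" where "e s s' = (if s' = s then 1 else 0)" for s s'
  have e1: "e s s = 1" for s by (simp add: e_def)
  have inj: "inj e" by (rule injI) (metis e_def zero_neq_one)
  have sp: "zz_space W t = {x. finite {s. x s \<noteq> 0} \<and> (\<forall>s. x s \<noteq> 0 \<longrightarrow> s \<in> S \<and> b s \<le> t \<and> t \<le> d s)}"
    using split_zigzagD(4)[OF W, of t] p by simp
  have bd: "1 \<le> b s" "b s \<le> zz_length W" "1 \<le> d s" "d s \<le> zz_length W" if "s \<in> S" for s
    using split_zigzagD(1-3)[OF W that] by auto
  have L: "lsub W p t = {x\<in>zz_space W t. \<forall>s. x s \<noteq> 0 \<longrightarrow> birth_rank W (b s) \<le> birth_rank W p}"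
      "lsub_pred W p t = {x\<in>zz_space W t. \<forall>s. x s \<noteq> 0 \<longrightarrow> birth_rank W (b s) < birth_rank W p}"
    using split_zigzag_lsub[OF W, of p t] p by auto
  have R: "rsub W q t = {x\<in>zz_space W t. \<forall>s. x s \<noteq> 0 \<longrightarrow> death_rank W (d s) \<le> death_rank W q}"
      "rsub_pred W q t = {x\<in>zz_space W t. \<forall>s. x s \<noteq> 0 \<longrightarrow> death_rank W (d s) < death_rank W q}"
    using split_zigzag_rsub[OF W, of t q] p by auto
  have rank: "birth_rank W (b s) < birth_rank W p" if "s \<in> S" "b s \<noteq> p" "birth_rank W (b s) \<le> birth_rank W p" for s
    using birth_rank_inj[of W "b s" p] bd[OF that(1)] p that by fastforce
  have rank': "death_rank W (d s) < death_rank W q" if "s \<in> S" "d s \<noteq> q" "death_rank W (d s) \<le> death_rank W q" for s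
    using death_rank_inj[of W "d s" q] bd[OF that(1)] p that by fastforce
  have den0: "x s = 0" if x: "x \<in> interval_den W p q t" and s: "s \<in> ?T" for x s
  proof -
    obtain u v where "x = u + v" "u \<in> lsub_pred W p t" "v \<in> rsub_pred W q t"
      using x unfolding interval_den_def set_sum_def by blast
    moreover from this have "u s = 0" "v s = 0" using s unfolding L R by fastforce+
    ultimately show ?thesis by simp
  qed
  have spane: "families.span (e ` ?T) \<subseteq> {x. \<forall>s. x s \<noteq> 0 \<longrightarrow> s \<in> ?T}"
    by (rule families.span_minimal[OF _ families_subspace_support]) (auto simp: e_def split: if_splits)
  have ind: "families.independent (e ` ?T)"
    unfolding families.independent_explicit_finite_subsets
  proof (intro allI impI ballI)
    fix B :: "('a \<Rightarrow> 'b) set" and u v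
    assume B: "B \<subseteq> e ` ?T" "finite B" and s0: "(\<Sum>v\<in>B. (\<lambda>s. u v * v s)) = 0" and v: "v \<in> B"
    obtain s where s: "v = e s" using B v by auto
    have "v' s = (if v' = v then 1 else 0)" if v': "v' \<in> B" for v'
    proof -
      obtain s' where "v' = e s'" using B v' by auto
      then show ?thesis using s inj by (auto simp: e_def dest: injD)
    qed
    note this [simp]
    have "(\<Sum>v'\<in>B. u v' * v' s) = (\<Sum>v'\<in>B. if v' = v then u v else 0)"
      by (intro sum.cong) simp_all
    also have "\<dots> = u v" using B v by simp
    finally show "u v = 0" using fun_cong[OF s0, of s] by (simp add: sum_fun_apply)
  qed
  have gen: "\<exists>y\<in>families.span (e ` ?T). x - y \<in> interval_den W p q t" if x: "x \<in> interval_num W p q t" for x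
  proof -
    define y where "y s = (if s \<in> ?T then x s else 0)" for s
    define u where "u s = (if b s \<noteq> p then x s else 0)" for s
    \<comment> \<open>Requiring \<open>b s = p\<close> here keeps \<open>u\<close> and
      \<open>v\<close> from sharing a coordinate, so that \<open>y + u + v\<close> is exactly
      \<open>x\<close>.\<close>
    define v where "v s = (if b s = p \<and> d s \<noteq> q then x s else 0)" for s
    have x': "finite {s. x s \<noteq> 0}" "x s \<noteq> 0 \<Longrightarrow> s \<in> S \<and> b s \<le> t \<and> t \<le> d s"
      "x s \<noteq> 0 \<Longrightarrow> birth_rank W (b s) \<le> birth_rank W p" "x s \<noteq> 0 \<Longrightarrow> death_rank W (d s) \<le> death_rank W q" for s
      using x unfolding interval_num_def L R sp by auto
    have fin: "finite {s. y s \<noteq> 0}" "finite {s. u s \<noteq> 0}" "finite {s. v s \<noteq> 0}"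
      by (rule finite_subset[OF _ x'(1)]; auto simp: y_def u_def v_def)+
    have "y = (\<Sum>s | y s \<noteq> 0. (\<lambda>s'. y s * e s s'))"
    proof
      fix s'
      have "(\<Sum>s | y s \<noteq> 0. y s * e s s') = (\<Sum>s | y s \<noteq> 0. if s = s' then y s' else 0)"
        by (intro sum.cong) (auto simp: e_def)
      also have "\<dots> = y s'" using fin(1) by simp
      finally show "y s' = (\<Sum>s | y s \<noteq> 0. (\<lambda>s'. y s * e s s')) s'" by (simp add: sum_fun_apply)
    qed
    also have "\<dots> \<in> families.span (e ` ?T)"
      by (intro families.span_sum families.span_scale families.span_base)
        (auto simp: y_def split: if_splits)
    finally have y: "y \<in> families.span (e ` ?T)" .
    have "x - y = u + v"
      using x'(2) by (auto simp: fun_eq_iff y_def u_def v_def)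
    moreover have "u \<in> lsub_pred W p t \<inter> rsub W q t"
      using fin(2) x' rank by (auto simp: L R sp u_def)
    moreover have "v \<in> lsub W p t \<inter> rsub_pred W q t"
      using fin(3) x' rank' by (auto simp: L R sp v_def)
    ultimately show ?thesis using y unfolding interval_den_def set_sum_def by blast
  qed
  have "e s \<in> interval_num W p q t" if s: "s \<in> ?T" for s
  proof -
    have "{s'. e s s' \<noteq> 0} = {s}" by (auto simp: e_def)
    then show ?thesis using s p unfolding interval_num_def L R sp by (auto simp: e_def split: if_splits)
  qed
  moreover have "families.span (e ` ?T) \<inter> interval_den W p q t \<subseteq> {0}"
    using spane den0 by (fastforce simp: fun_eq_iff)
  ultimately have "families.basis_mod (interval_num W p q t) (interval_den W p q t) (e ` ?T)"
    using ind gen unfolding families.basis_mod_def by (intro conjI ballI) auto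
  then have "families.quot_dim (interval_num W p q t) (interval_den W p q t) = ecard (e ` ?T)"
    using families.quot_dim_eq interval_subspace(2)[OF p] by blast
  also have "\<dots> = ecard ?T"
    using inj_on_subset[OF inj, of ?T] by (simp add: ecard_def card_image finite_image_iff)
  finally show ?thesis .
qed

lemma support_iff:
  "(\<forall>s\<in>S. x s \<in> (if P s then UNIV else {0})) \<and> (\<forall>s. s \<notin> S \<longrightarrow> x s = 0) \<longleftrightarrow>
     (\<forall>s. x s \<noteq> 0 \<longrightarrow> s \<in> S \<and> P s)"
  by (auto split: if_splits)

lemma split_zigzag_interval_sum:
  assumes "\<forall>(p, q, x)\<in>S. 1 \<le> p \<and> p \<le> q \<and> q \<le> n"
  shows "split_zigzag (zigzag_sum n fwd S (\<lambda>(p, q, x). interval_module n fwd p q :: 'k::field zigzag))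
           S fst (\<lambda>s. fst (snd s))"
proof -
  have rng: "1 \<le> fst s \<and> fst s \<le> fst (snd s) \<and> fst (snd s) \<le> n" if "s \<in> S" for s
    using assms that by (cases s) auto
  have sp: "zz_space ((case s of (p, q, x) \<Rightarrow> interval_module n fwd p q) :: 'k zigzag) j =
      (if fst s \<le> j \<and> j \<le> fst (snd s) then UNIV else {0})" for s j
    by (simp add: interval_module_def split_beta)
  have supp: "(\<forall>s\<in>S. x s \<in> zz_space ((case s of (p, q, x) \<Rightarrow> interval_module n fwd p q) :: 'k zigzag) j) \<and>
      (\<forall>s. s \<notin> S \<longrightarrow> x s = 0) \<longleftrightarrow> (\<forall>s. x s \<noteq> 0 \<longrightarrow> s \<in> S \<and> fst s \<le> j \<and> j \<le> fst (snd s))" for x j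
    by (simp only: sp support_iff)
  have mp: "zz_map ((case s of (p, q, x) \<Rightarrow> interval_module n fwd p q) :: 'k zigzag) j z =
      (if fst s \<le> j \<and> Suc j \<le> fst (snd s) then z else 0)" for s j z
    by (simp add: interval_module_def split_beta)
  show ?thesis
    unfolding split_zigzag_def zigzag_sum_def zigzag.select_convs supp mp
    by (intro conjI ballI allI impI) (use rng in \<open>auto simp del: split_paired_All\<close>)
qed

section \<open>Existence of interval decompositions and independence of the count\<close>

context zigzag_space
begin

text \<open>The right-hand side does not mention \<open>S\<close>, so all decompositions contain the
  same number of copies.\<close>

lemma interval_decomposition_multiplicity:
  assumes dec: "interval_decomposition scale V S" and p: "1 \<le> p" "p \<le> t" "t \<le> q" "q \<le> zz_length V"
  shows "ecard {x. (p, q, x) \<in> S} = quot_dim (interval_num V p q t) (interval_den V p q t)"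
proof -
  let ?W = "zigzag_sum (zz_length V) (zz_forward V) S
     (\<lambda>(p, q, x). interval_module (zz_length V) (zz_forward V) p q :: 'k zigzag)"
  have W: "split_zigzag ?W S fst (\<lambda>s. fst (snd s))"
    using dec unfolding interval_decomposition_def by (intro split_zigzag_interval_sum) auto
  obtain \<phi> where \<phi>: "zz_iso_via \<phi> scale (\<lambda>c x s. c * x s) V ?W"
    using dec unfolding interval_decomposition_def zigzag_iso_iff_via by blast
  interpret zigzag_space_pair scale "\<lambda>c x s. c * x s" V ?W
    using split_zigzag_module[OF W] zigzag_space_axioms by (intro zigzag_space_pair.intro)
  have len: "zz_length ?W = zz_length V" using \<phi> unfolding zz_iso_via_def by simp
  have "quot_dim (interval_num V p q t) (interval_den V p q t) =
      families.quot_dim (interval_num ?W p q t) (interval_den ?W p q t)"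
    using quot_dim_iso[OF \<phi> p] .
  also have "\<dots> = ecard {s\<in>S. fst s = p \<and> fst (snd s) = q}"
    using split_zigzag_quot_dim[OF W p(1-3)] p(4) len by simp
  also have "{s\<in>S. fst s = p \<and> fst (snd s) = q} = (\<lambda>x. (p, q, x)) ` {x. (p, q, x) \<in> S}"
    by force
  also have "ecard \<dots> = ecard {x. (p, q, x) \<in> S}"
    by (simp add: ecard_def card_image finite_image_iff inj_on_def)
  finally show ?thesis ..
qed

text \<open>Neighbouring subquotients of an interval are matched by the arrow between them, so that a basis
  chosen at the first position continues along the interval. The continuations from all intervals
  together form a basis at every position.\<close>

definition interval_gens :: "nat \<Rightarrow> nat \<Rightarrow> 'v set" where
  "interval_gens p q = (SOME B. basis_mod (interval_num V p q p) (interval_den V p q p) B)"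

primrec continuation :: "nat \<Rightarrow> nat \<times> nat \<times> 'v \<Rightarrow> 'v" where
  "continuation 0 s = snd (snd s)"
| "continuation (Suc t) s =
     (if t < fst s then snd (snd s)
      else SOME y. y \<in> interval_num V (fst s) (fst (snd s)) (Suc t) \<and> step_rel t (continuation t s) y)"

definition gen_labels :: "(nat \<times> nat \<times> 'v) set" where
  "gen_labels = {(p, q, x). 1 \<le> p \<and> p \<le> q \<and> q \<le> zz_length V \<and> x \<in> interval_gens p q}"

lemma continuation_start: "1 \<le> p \<Longrightarrow> continuation p (p, q, x) = x"
  by (cases p) auto

lemma continuation_Suc:
  assumes "1 \<le> p" "p \<le> t" "t < q" "q \<le> zz_length V" "continuation t (p, q, x) \<in> interval_num V p q t"
  shows "continuation (Suc t) (p, q, x) \<in> interval_num V p q (Suc t) \<and>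
    step_rel t (continuation t (p, q, x)) (continuation (Suc t) (p, q, x))"
proof -
  let ?P = "\<lambda>y. y \<in> interval_num V p q (Suc t) \<and> step_rel t (continuation t (p, q, x)) y"
  have "\<exists>y. ?P y"
    using relates_quotsD(1)[OF step_rel_quots[OF assms(1-4)] assms(5)] .
  then have "?P (SOME y. ?P y)" by (rule someI_ex)
  then show ?thesis using assms by simp
qed

text \<open>Each arrow transfers the current basis to the next position. Injectivity is carried
  along because copies are labelled by their starting vectors.\<close>

lemma continuation_basis:
  assumes "1 \<le> p" "p \<le> t" "t \<le> q" "q \<le> zz_length V"
  shows "inj_on (\<lambda>x. continuation t (p, q, x)) (interval_gens p q) \<and>
    basis_mod (interval_num V p q t) (interval_den V p q t) ((\<lambda>x. continuation t (p, q, x)) ` interval_gens p q)"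
  using assms(2,3)
proof (induction t rule: dec_induct)
  case base
  have "\<exists>B. basis_mod (interval_num V p q p) (interval_den V p q p) B"
    by (rule basis_mod_exists; rule interval_subspace) (use assms in auto)
  then have "basis_mod (interval_num V p q p) (interval_den V p q p) (interval_gens p q)"
    unfolding interval_gens_def by (rule someI_ex)
  then show ?case using assms(1) by (simp add: continuation_start)
next
  case (step t)
  interpret vv: scalar_space_pair scale scale ..
  let ?e = "\<lambda>x. continuation t (p, q, x)" and ?e' = "\<lambda>x. continuation (Suc t) (p, q, x)"
  let ?G = "interval_gens p q"
  have t: "1 \<le> t" "t < zz_length V" "p \<le> t" "t < q" using step assms by auto
  have inj: "inj_on ?e ?G" and B: "basis_mod (interval_num V p q t) (interval_den V p q t) (?e ` ?G)"
    using step by auto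
  \<comment> \<open>Continuations are indexed by starting vectors, whereas the transfer needs a
    function of the current vector; the inverse of \<open>?e\<close> mediates.\<close>
  define f where "f y = ?e' (the_inv_into ?G ?e y)" for y
  have f: "f (?e x) = ?e' x" if "x \<in> ?G" for x
    unfolding f_def using the_inv_into_f_f[OF inj that] by simp
  have "f y \<in> interval_num V p q (Suc t) \<and> step_rel t y (f y)" if y: "y \<in> ?e ` ?G" for y
  proof -
    obtain x where x: "x \<in> ?G" "y = ?e x" using y by auto
    have "?e x \<in> interval_num V p q t" using basis_modD(1)[OF B] x(1) by auto
    from continuation_Suc[OF assms(1) t(3,4) assms(4) this] show ?thesis
      using f[OF x(1)] x(2) by simp
  qed
  from vv.basis_mod_transfer[OF step_rel_linear[OF t(1,2)] step_rel_quots[OF assms(1) t(3,4) assms(4)]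
      _ _ _ _ _ _ B this]
  have 1: "inj_on f (?e ` ?G)"
    "basis_mod (interval_num V p q (Suc t)) (interval_den V p q (Suc t)) (f ` ?e ` ?G)"
    using interval_subspace[of p t q] interval_subspace[of p "Suc t" q] t assms by auto
  have im: "f ` ?e ` ?G = ?e' ` ?G" using f by (force simp: image_image)
  have "inj_on ?e' ?G"
    using comp_inj_on[OF inj 1(1)] f by (simp add: inj_on_def)
  then show ?case using 1(2) unfolding im by simp
qed

lemma continuation_in:
  assumes "(p, q, x) \<in> gen_labels" "p \<le> t" "t \<le> q"
  shows "continuation t (p, q, x) \<in> interval_num V p q t"
proof -
  have *: "1 \<le> p" "q \<le> zz_length V" "x \<in> interval_gens p q" using assms unfolding gen_labels_def by auto
  then show ?thesis
    using basis_modD(1)[OF conjunct2[OF continuation_basis[OF *(1) assms(2,3) *(2)]]] by auto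
qed

definition active_labels :: "nat \<Rightarrow> (nat \<times> nat \<times> 'v) set" where
  "active_labels t = {s\<in>gen_labels. fst s \<le> t \<and> t \<le> fst (snd s)}"

text \<open>The doubly graded pieces of the two chains at \<open>t\<close> exhaust the space:
  independence comes from filtering them lexicographically by birth and death rank, spanning from
  descending through smaller ranks.\<close>

lemma continuation_family_basis:
  assumes t: "1 \<le> t" "t \<le> zz_length V"
  shows "inj_on (continuation t) (active_labels t)"
    and "independent (continuation t ` active_labels t)"
    and "span (continuation t ` active_labels t) = zz_space V t"
proof -
  let ?n = "zz_length V"
  define K where "K = {k. 1 \<le> fst k \<and> fst k \<le> t \<and> t \<le> snd k \<and> snd k \<le> ?n}"
  define B where "B k = (\<lambda>x. continuation t (fst k, snd k, x)) ` interval_gens (fst k) (snd k)" for k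
  \<comment> \<open>Everything lexicographically below \<open>k\<close>: an earlier birth rank, or
    the same birth with an earlier death rank. In contrast to \<open>interval_den\<close>, the first
    summand is not confined to \<open>rsub V (snd k) t\<close>.\<close>
  define G where "G k = set_sum (lsub_pred V (fst k) t) (lsub V (fst k) t \<inter> rsub_pred V (snd k) t)" for k
  \<comment> \<open>encodes the lexicographic order of the two ranks\<close>
  define key where "key k = birth_rank V (fst k) * (2 * ?n + 1) + death_rank V (snd k)" for k
  have K_fin: "finite K"
    by (rule finite_subset[of _ "{..?n} \<times> {..?n}"]) (use t in \<open>auto simp: K_def\<close>)
  \<comment> \<open>Ranks are at most \<open>2 * ?n\<close>, so a death rank is a single digit in
    base \<open>2 * ?n + 1\<close>.\<close>
  have bound: "death_rank V q < 2 * ?n + 1" if "t \<le> q" "q \<le> ?n" for q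
    using that t unfolding death_rank_def birth_rank_def by auto
  have key_less: "birth_rank V (fst k) < birth_rank V (fst k') \<or>
      birth_rank V (fst k) = birth_rank V (fst k') \<and> death_rank V (snd k) < death_rank V (snd k')"
    if "key k < key k'" "k' \<in> K" for k k'
  proof (rule ccontr)
    assume "\<not> ?thesis"
    then consider "birth_rank V (fst k') < birth_rank V (fst k)"
      | "birth_rank V (fst k) = birth_rank V (fst k')" "death_rank V (snd k') \<le> death_rank V (snd k)"
      by linarith
    then show False
    proof cases
      case 1
      then have "Suc (birth_rank V (fst k')) * (2 * ?n + 1) \<le> birth_rank V (fst k) * (2 * ?n + 1)"
        by (intro mult_right_mono) auto
      moreover have "death_rank V (snd k') < 2 * ?n + 1" using bound that(2) unfolding K_def by auto
      ultimately show False using that(1) unfolding key_def by simp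
    next
      case 2
      then show False using that(1) unfolding key_def by simp
    qed
  qed
  have key_inj: "inj_on key K"
  proof (rule inj_onI)
    fix k k' assume k: "k \<in> K" "k' \<in> K" and e: "key k = key k'"
    have b: "death_rank V (snd k) < 2 * ?n + 1" "death_rank V (snd k') < 2 * ?n + 1"
      using bound k unfolding K_def by auto
    have "key k div (2 * ?n + 1) = birth_rank V (fst k)" "key k' div (2 * ?n + 1) = birth_rank V (fst k')"
      "key k mod (2 * ?n + 1) = death_rank V (snd k)" "key k' mod (2 * ?n + 1) = death_rank V (snd k')"
      unfolding key_def using b by (simp_all add: div_mult_self3 mod_mult_self3 del: mult_Suc_right)
    then have "birth_rank V (fst k) = birth_rank V (fst k')" "death_rank V (snd k) = death_rank V (snd k')"
      using e by simp_all
    then have "fst k = fst k'" "snd k = snd k'"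
      using birth_rank_inj[of V "fst k" "fst k'"] death_rank_inj[of V "snd k" "snd k'"] k t
      unfolding K_def by auto
    then show "k = k'" by (simp add: prod_eq_iff)
  qed
  have L: "subspace (lsub V (fst k) t)" "lsub V (fst k) t \<subseteq> zz_space V t"
      "subspace (lsub_pred V (fst k) t)" "lsub_pred V (fst k) t \<subseteq> lsub V (fst k) t"
    and R: "subspace (rsub V (snd k) t)" "rsub V (snd k) t \<subseteq> zz_space V t"
      "subspace (rsub_pred V (snd k) t)" "rsub_pred V (snd k) t \<subseteq> rsub V (snd k) t"
    if "k \<in> K" for k
    using lsub_subspace[of "fst k" t] rsub_subspace[of t "snd k"] that t unfolding K_def by auto
  have basis: "inj_on (\<lambda>x. continuation t (fst k, snd k, x)) (interval_gens (fst k) (snd k))"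
    "basis_mod (interval_num V (fst k) (snd k) t) (interval_den V (fst k) (snd k) t) (B k)"
    if "k \<in> K" for k
    using continuation_basis[of "fst k" t "snd k"] that unfolding K_def B_def by auto
  have BN: "B k \<subseteq> lsub V (fst k) t \<inter> rsub V (snd k) t" if "k \<in> K" for k
    using basis_modD(1)[OF basis(2)[OF that]] unfolding interval_num_def .
  have c1: "subspace (G k)" if "k \<in> K" for k
    unfolding G_def using L[OF that] R[OF that] by (intro set_sum_subspace subspace_inter) auto
  have c2: "independent (B k)" if "k \<in> K" for k
    using basis_modD(2)[OF basis(2)[OF that]] .
  have c3: "span (B k) \<inter> G k \<subseteq> {0}" if k: "k \<in> K" for k
  proof
    fix y assume y: "y \<in> span (B k) \<inter> G k"
    have "span (B k) \<subseteq> lsub V (fst k) t \<inter> rsub V (snd k) t"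
      using span_minimal[OF BN[OF k]] subspace_inter[OF L(1)[OF k] R(1)[OF k]] by blast
    then have yR: "y \<in> rsub V (snd k) t" using y by auto
    from y obtain u v where uv: "y = u + v" "u \<in> lsub_pred V (fst k) t"
        "v \<in> lsub V (fst k) t" "v \<in> rsub_pred V (snd k) t"
      unfolding G_def set_sum_def by blast
    \<comment> \<open>Modular law: as \<open>y\<close> and \<open>v\<close> lie in the member of the
      right chain, so does \<open>u\<close>, and membership in \<open>G k\<close> becomes membership
      in the denominator.\<close>
    have "u = y - v" using uv by simp
    then have "u \<in> rsub V (snd k) t"
      using yR uv R[OF k] subspace_diff by blast
    then have "y \<in> interval_den V (fst k) (snd k) t"
      unfolding interval_den_def set_sum_def using uv by auto
    then show "y \<in> {0}" using y basis_modD(3)[OF basis(2)[OF k]] by blast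
  qed
  have c4: "B k' \<subseteq> G k" if k: "k \<in> K" "k' \<in> K" "key k' < key k" for k k'
  proof -
    have 0: "0 \<in> lsub_pred V (fst k) t" "0 \<in> lsub V (fst k) t \<inter> rsub_pred V (snd k) t"
      using L[OF k(1)] R[OF k(1)] subspace_0 by auto
    have incl: "lsub_pred V (fst k) t \<subseteq> G k" "lsub V (fst k) t \<inter> rsub_pred V (snd k) t \<subseteq> G k"
      unfolding G_def set_sum_def using 0 by force+
    from key_less[OF k(3,1)] show ?thesis
    proof
      assume "birth_rank V (fst k') < birth_rank V (fst k)"
      then have "lsub V (fst k') t \<subseteq> lsub_pred V (fst k) t"
        using lsub_mono[of "fst k" t "fst k'"] k t unfolding K_def by auto
      then show ?thesis using BN[OF k(2)] incl by blast
    next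
      assume *: "birth_rank V (fst k') = birth_rank V (fst k) \<and> death_rank V (snd k') < death_rank V (snd k)"
      then have "fst k' = fst k"
        using birth_rank_inj[of V "fst k'" "fst k"] k t unfolding K_def by auto
      moreover have "rsub V (snd k') t \<subseteq> rsub_pred V (snd k) t"
        using rsub_mono[of t "snd k" "snd k'"] * k t unfolding K_def by auto
      ultimately have "B k' \<subseteq> lsub V (fst k) t \<inter> rsub_pred V (snd k) t"
        using BN[OF k(2)] by auto
      then show ?thesis using incl(2) by (rule subset_trans)
    qed
  qed
  have gen1: "independent (\<Union>k\<in>K. B k)"
    by (rule independent_UN_filtered(1)[OF K_fin key_inj, of G B]) (fact c1 c2 c3 c4)+
  have gen2: "B k \<inter> B k' = {}" if "k \<in> K" "k' \<in> K" "k \<noteq> k'" for k k'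
    by (rule independent_UN_filtered(2)[OF K_fin key_inj, of G B]) (fact c1 c2 c3 c4 that)+
  have act: "active_labels t = {(p, q, x). (p, q) \<in> K \<and> x \<in> interval_gens p q}"
    using t unfolding active_labels_def gen_labels_def K_def by auto
  have im: "continuation t ` active_labels t = (\<Union>k\<in>K. B k)"
    unfolding act B_def by force
  show "independent (continuation t ` active_labels t)" unfolding im by (rule gen1)
  show "inj_on (continuation t) (active_labels t)"
  proof (rule inj_onI)
    fix s s' assume s: "s \<in> active_labels t" "s' \<in> active_labels t" "continuation t s = continuation t s'"
    obtain p q x where px: "s = (p, q, x)" "(p, q) \<in> K" "x \<in> interval_gens p q" using s(1) act by auto
    obtain p' q' x' where px': "s' = (p', q', x')" "(p', q') \<in> K" "x' \<in> interval_gens p' q'"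
      using s(2) act by auto
    have "continuation t s \<in> B (p, q)" using px unfolding B_def by auto
    moreover have "continuation t s \<in> B (p', q')" unfolding s(3) using px' unfolding B_def by auto
    ultimately have eq: "(p, q) = (p', q')" using gen2[OF px(2) px'(2)] by auto
    then show "s = s'" using inj_onD[OF basis(1)[OF px(2)], of x x'] px px' s(3) by auto
  qed
  \<comment> \<open>Modulo the denominator a numerator is spanned by its own basis. The two summands
    of the denominator are zero or numerators with one rank lowered, so induction on the sum of the
    ranks applies.\<close>
  have spanN: "interval_num V p q t \<subseteq> span (\<Union>k\<in>K. B k)" if "(p, q) \<in> K" for p q
    using that
  proof (induction "birth_rank V p + death_rank V q" arbitrary: p q rule: less_induct)
    case less
    have pq: "1 \<le> p" "p \<le> t" "t \<le> q" "q \<le> ?n" using less.prems unfolding K_def by auto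
    have A: "lsub_pred V p t \<inter> rsub V q t \<subseteq> span (\<Union>k\<in>K. B k)"
    proof -
      from lsub_pred_cases[OF pq(1,2) t(2)] show ?thesis
      proof (elim disjE exE conjE)
        assume "lsub_pred V p t = {0}"
        then show ?thesis using span_zero by auto
      next
        fix p' assume p': "1 \<le> p'" "p' \<le> t" "birth_rank V p' < birth_rank V p" "lsub_pred V p t = lsub V p' t"
        then have "interval_num V p' q t \<subseteq> span (\<Union>k\<in>K. B k)"
          using less.hyps[of p' q] pq unfolding K_def by auto
        then show ?thesis using p' unfolding interval_num_def by auto
      qed
    qed
    have C: "lsub V p t \<inter> rsub_pred V q t \<subseteq> span (\<Union>k\<in>K. B k)"
    proof -
      from rsub_pred_cases[OF t(1) pq(3,4)] show ?thesis
      proof (elim disjE exE conjE)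
        assume "rsub_pred V q t = {0}"
        then show ?thesis using span_zero by auto
      next
        fix q' assume q': "t \<le> q'" "q' \<le> ?n" "death_rank V q' < death_rank V q" "rsub_pred V q t = rsub V q' t"
        then have "interval_num V p q' t \<subseteq> span (\<Union>k\<in>K. B k)"
          using less.hyps[of p q'] pq unfolding K_def by auto
        then show ?thesis using q' unfolding interval_num_def by auto
      qed
    qed
    have D: "interval_den V p q t \<subseteq> span (\<Union>k\<in>K. B k)"
      using A C span_add unfolding interval_den_def set_sum_def by blast
    show ?case
    proof
      fix x assume "x \<in> interval_num V p q t"
      then obtain y where y: "y \<in> span (B (p, q))" "x - y \<in> interval_den V p q t"
        using basis_modD(4)[OF basis(2)[OF less.prems], of x] by auto
      have "y \<in> span (\<Union>k\<in>K. B k)" using y(1) less.prems span_mono[of "B (p, q)" "\<Union>k\<in>K. B k"] by blast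
      moreover have "x - y \<in> span (\<Union>k\<in>K. B k)" using y(2) D by blast
      ultimately have "y + (x - y) \<in> span (\<Union>k\<in>K. B k)" by (rule span_add)
      then show "x \<in> span (\<Union>k\<in>K. B k)" by simp
    qed
  qed
  obtain p where p: "1 \<le> p" "p \<le> t" "lsub V p t = zz_space V t" using lsub_top[OF t] by auto
  obtain q where q: "t \<le> q" "q \<le> ?n" "rsub V q t = zz_space V t" using rsub_top[OF t] by auto
  have "zz_space V t \<subseteq> span (\<Union>k\<in>K. B k)"
    using spanN[of p q] p q unfolding K_def interval_num_def by auto
  moreover have "span (\<Union>k\<in>K. B k) \<subseteq> zz_space V t"
    using BN L by (intro span_minimal space_subspace[OF t]) blast
  ultimately show "span (continuation t ` active_labels t) = zz_space V t" unfolding im by blast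
qed

text \<open>The value zero arises at the last position \<open>q\<close> of the interval, where the
  continuation lies in the kernel of the right-pointing arrow by \<open>rsub_start\<close>.\<close>

lemma continuation_step:
  assumes s: "s \<in> active_labels t" and t: "1 \<le> t" "t < zz_length V"
  shows "zz_forward V t \<Longrightarrow>
      zz_map V t (continuation t s) = (if s \<in> active_labels (Suc t) then continuation (Suc t) s else 0)"
proof -
  assume f: "zz_forward V t"
  obtain p q x where px: "s = (p, q, x)" "(p, q, x) \<in> gen_labels" "1 \<le> p" "p \<le> t" "t \<le> q" "q \<le> zz_length V"
    using s unfolding active_labels_def gen_labels_def by auto
  have "continuation t s \<in> interval_num V p q t" using continuation_in px by blast
  then show ?thesis
    using px f t continuation_Suc[of p t q x] rsub_start(1)[of q V]
    by (cases "t = q") (auto simp: active_labels_def step_rel_def interval_num_def)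
qed

lemma continuation_step_back:
  assumes s: "s \<in> active_labels (Suc t)" and t: "1 \<le> t" "t < zz_length V"
  shows "\<not> zz_forward V t \<Longrightarrow>
      zz_map V t (continuation (Suc t) s) = (if s \<in> active_labels t then continuation t s else 0)"
proof -
  assume f: "\<not> zz_forward V t"
  obtain p q x where px: "s = (p, q, x)" "(p, q, x) \<in> gen_labels" "1 \<le> p" "p \<le> Suc t" "Suc t \<le> q" "q \<le> zz_length V"
    using s unfolding active_labels_def gen_labels_def by auto
  have "continuation (Suc t) s \<in> interval_num V p q (Suc t)" using continuation_in px by blast
  moreover have "continuation t s \<in> interval_num V p q t" if "p \<le> t" using continuation_in px that by auto
  ultimately show ?thesis
    using px f t continuation_Suc[of p t q x] lsub_start[of p V]
    by (cases "p = Suc t") (auto simp: active_labels_def step_rel_def interval_num_def birth_space_def)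
qed

text \<open>\<open>\<phi> t\<close> sends a vector to its coordinates in the basis of continuations
  at \<open>t\<close>, indexed by labels. The arrows send continuations to continuations or to zero,
  which is how the sum of intervals acts on coordinates.\<close>

lemma interval_decomposition_exists: "\<exists>S. interval_decomposition scale V S"
proof
  let ?S = gen_labels
  let ?W = "zigzag_sum (zz_length V) (zz_forward V) ?S
     (\<lambda>(p, q, x). interval_module (zz_length V) (zz_forward V) p q :: 'k zigzag)"
  have S: "\<forall>(p, q, x)\<in>?S. 1 \<le> p \<and> p \<le> q \<and> q \<le> zz_length V"
    unfolding gen_labels_def by auto
  note W = split_zigzag_interval_sum[OF S, of "zz_forward V", where ?'k = 'k]
  have len: "zz_length ?W = zz_length V" "zz_forward ?W = zz_forward V" by (simp_all add: zigzag_sum_def)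
  define E where "E t = continuation t ` active_labels t" for t
  define \<phi> where "\<phi> t v s = (if s \<in> active_labels t then representation (E t) v (continuation t s) else 0)"
    for t v s
  have ind: "independent (E t)" and spE: "span (E t) = zz_space V t"
    and inj: "inj_on (continuation t) (active_labels t)" if "1 \<le> t" "t \<le> zz_length V" for t
    using continuation_family_basis[OF that] unfolding E_def by auto
  have Wsp: "zz_space ?W t = {x. finite {s. x s \<noteq> 0} \<and> (\<forall>s. x s \<noteq> 0 \<longrightarrow> s \<in> active_labels t)}"
    if "1 \<le> t" "t \<le> zz_length V" for t
    using split_zigzagD(4)[OF W, of t] that len unfolding active_labels_def by auto
  have Wmap: "zz_map ?W t x s = (if s \<in> active_labels t \<and> s \<in> active_labels (Suc t) then x s else 0)"
    if "1 \<le> t" "t < zz_length V" for t x s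
    using split_zigzagD(5)[OF W, of t x s] that len unfolding active_labels_def by auto
  have \<phi>_basis: "\<phi> t (continuation t s) s' = (if s' = s then 1 else 0)"
    if t: "1 \<le> t" "t \<le> zz_length V" and s: "s \<in> active_labels t" for t s s'
    using representation_basis[OF ind[OF t], of "continuation t s"] inj_onD[OF inj[OF t]] s
    unfolding \<phi>_def E_def by auto
  have lin: "linear_between scale (\<lambda>c x s. c * x s) (zz_space V t) (zz_space ?W t) (\<phi> t)"
    if t: "1 \<le> t" "t \<le> zz_length V" for t
    unfolding linear_between_def
  proof (intro conjI ballI allI)
    fix v assume v: "v \<in> zz_space V t"
    have "{s. \<phi> t v s \<noteq> 0} \<subseteq> active_labels t \<inter> continuation t -` {b. representation (E t) v b \<noteq> 0}"
      unfolding \<phi>_def by auto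
    moreover have "finite (continuation t -` {b. representation (E t) v b \<noteq> 0} \<inter> active_labels t)"
      by (rule finite_vimage_IntI[OF finite_representation inj[OF t]])
    ultimately have "finite {s. \<phi> t v s \<noteq> 0}" by (metis Int_commute finite_subset)
    then show "\<phi> t v \<in> zz_space ?W t" unfolding Wsp[OF t] by (auto simp: \<phi>_def split: if_splits)
    show "\<phi> t (v + w) = \<phi> t v + \<phi> t w" if "w \<in> zz_space V t" for w
      using representation_add[OF ind[OF t], of w v] v that unfolding spE[OF t]
      by (simp add: \<phi>_def fun_eq_iff)
    show "\<phi> t (scale c v) = (\<lambda>s. c * \<phi> t v s)" for c
      using representation_scale[OF ind[OF t], of v c] v unfolding spE[OF t] by (auto simp: \<phi>_def fun_eq_iff)
  qed
  have bij: "bij_betw (\<phi> t) (zz_space V t) (zz_space ?W t)" if t: "1 \<le> t" "t \<le> zz_length V" for t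
    unfolding bij_betw_def
  proof
    show "inj_on (\<phi> t) (zz_space V t)"
    proof (rule inj_onI)
      fix v w assume v: "v \<in> zz_space V t" "w \<in> zz_space V t" and e: "\<phi> t v = \<phi> t w"
      have "representation (E t) v b = representation (E t) w b" for b
      proof (cases "b \<in> E t")
        case True
        then obtain s where "s \<in> active_labels t" "b = continuation t s" unfolding E_def by auto
        then show ?thesis using fun_cong[OF e, of s] by (simp add: \<phi>_def)
      next
        case False
        then show ?thesis using representation_ne_zero[of "E t"] by metis
      qed
      then have "representation (E t) v = representation (E t) w" by auto
      note sum_nonzero_representation_eq[OF ind[OF t] v(1)[folded spE[OF t]], unfolded this]
      then show "v = w"
        using sum_nonzero_representation_eq[OF ind[OF t] v(2)[folded spE[OF t]]] by (rule trans[OF sym])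
    qed
    show "\<phi> t ` zz_space V t = zz_space ?W t"
    proof
      show "\<phi> t ` zz_space V t \<subseteq> zz_space ?W t" using lin[OF t] unfolding linear_between_def by blast
      show "zz_space ?W t \<subseteq> \<phi> t ` zz_space V t"
      proof
        fix x assume "x \<in> zz_space ?W t"
        then have x: "finite {s. x s \<noteq> 0}" "\<And>s. x s \<noteq> 0 \<Longrightarrow> s \<in> active_labels t" unfolding Wsp[OF t] by auto
        define v where "v = (\<Sum>s | x s \<noteq> 0. scale (x s) (continuation t s))"
        have c: "continuation t s \<in> span (E t)" if "x s \<noteq> 0" for s
          using x(2)[OF that] span_base unfolding E_def by auto
        have v: "v \<in> zz_space V t"
          unfolding v_def spE[OF t, symmetric] using c by (intro span_sum span_scale) auto
        have "\<phi> t v s' = x s'" for s'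
        proof (cases "s' \<in> active_labels t")
          case True
          have "representation (E t) v =
              (\<lambda>b. \<Sum>s | x s \<noteq> 0. representation (E t) (scale (x s) (continuation t s)) b)"
            unfolding v_def using c by (intro representation_sum ind[OF t] span_scale) auto
          then have "\<phi> t v s' = (\<Sum>s | x s \<noteq> 0. representation (E t) (scale (x s) (continuation t s)) (continuation t s'))"
            using True by (simp add: \<phi>_def)
          also have "\<dots> = (\<Sum>s | x s \<noteq> 0. if s' = s then x s else 0)"
          proof (rule sum.cong)
            fix s assume s: "s \<in> {s. x s \<noteq> 0}"
            then have "representation (E t) (scale (x s) (continuation t s)) (continuation t s') =
                x s * representation (E t) (continuation t s) (continuation t s')"
              using representation_scale[OF ind[OF t], of "continuation t s" "x s"] c by simp
            also have "\<dots> = x s * \<phi> t (continuation t s) s'" using True by (simp add: \<phi>_def)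
            also have "\<dots> = (if s' = s then x s else 0)" using \<phi>_basis[OF t x(2), of s s'] s by simp
            finally show "representation (E t) (scale (x s) (continuation t s)) (continuation t s') =
                (if s' = s then x s else 0)" .
          qed simp
          also have "\<dots> = x s'" using x(1) by (simp add: sum.delta)
          finally show ?thesis .
        next
          case False
          then show ?thesis using x(2)[of s'] by (auto simp: \<phi>_def)
        qed
        then show "x \<in> \<phi> t ` zz_space V t" using v by (metis ext imageI)
      qed
    qed
  qed
  interpret pair: vector_space_pair scale "\<lambda>c x (s :: nat \<times> nat \<times> 'v). c * x s" ..
  have comm: "\<phi> t' (zz_map V j v) = zz_map ?W j (\<phi> t v)"
    if j: "1 \<le> j" "j < zz_length V" and tt: "t = j \<and> t' = Suc j \<and> zz_forward V j \<or>
        t = Suc j \<and> t' = j \<and> \<not> zz_forward V j"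
      and v: "v \<in> zz_space V t" for j t t' v
  proof -
    have t: "1 \<le> t" "t \<le> zz_length V" "1 \<le> t'" "t' \<le> zz_length V" using j tt by auto
    have ml: "linear_between scale scale (zz_space V t) (zz_space V t') (zz_map V j)"
      using map_linear[OF j] tt by auto
    have m0: "zz_map V j 0 = 0"
      using linear_between_zero[OF ml space_subspace] t by auto
    have p0: "\<phi> i 0 = 0" for i unfolding \<phi>_def by (auto simp: representation_zero fun_eq_iff)
    have w0: "zz_map ?W j 0 = 0" using Wmap[OF j] by (auto simp: fun_eq_iff)
    have wa: "zz_map ?W j (x + y) = zz_map ?W j x + zz_map ?W j y" for x y
      using Wmap[OF j] by (auto simp: fun_eq_iff)
    have ws: "zz_map ?W j (\<lambda>s. c * x s) = (\<lambda>s. c * zz_map ?W j x s)" for c x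
      using Wmap[OF j] by (auto simp: fun_eq_iff)
    \<comment> \<open>Both sides are linear in \<open>v\<close>, so it is enough that this subspace
      contains the basis \<open>E t\<close>.\<close>
    define T where "T = {v\<in>zz_space V t. \<phi> t' (zz_map V j v) = zz_map ?W j (\<phi> t v)}"
    have "subspace T"
      unfolding T_def using ml lin[OF t(1,2)] lin[OF t(3,4)] space_subspace[OF t(1,2)]
      by (intro subspaceI)
        (auto simp: subspace_0 subspace_add subspace_scale m0 p0 w0 linear_between_def wa ws)
    moreover have "E t \<subseteq> T"
    proof
      fix b assume b: "b \<in> E t"
      then obtain s where s: "s \<in> active_labels t" "b = continuation t s" unfolding E_def by auto
      have "zz_map V j b = (if s \<in> active_labels t' then continuation t' s else 0)"
        using continuation_step[of s j] continuation_step_back[of s j] s j tt by auto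
      then have "\<phi> t' (zz_map V j b) s' = zz_map ?W j (\<phi> t b) s'" for s'
        using Wmap[OF j, of "\<phi> t b" s'] \<phi>_basis[OF t(1,2) s(1), of s'] \<phi>_basis[OF t(3,4), of s s'] p0 s tt
        by (auto split: if_splits)
      then show "b \<in> T" using b span_base[OF b] spE[OF t(1,2)] unfolding T_def by auto
    qed
    ultimately have "span (E t) \<subseteq> T" by (intro span_minimal)
    then show ?thesis using v unfolding spE[OF t(1,2)] T_def by auto
  qed
  have "zz_iso_via \<phi> scale (\<lambda>c x s. c * x s) V ?W"
    unfolding zz_iso_via_def len using lin bij comm by auto
  then show "interval_decomposition scale V ?S"
    unfolding interval_decomposition_def zigzag_iso_iff_via using S by blast
qed

text \<open>Existence and independence of the decomposition together evaluate the definite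
  description. The position \<open>t\<close> remains free, so a comparison can be made wherever it
  is most convenient.\<close>

lemma multiplicity_of_eq_quot_dim:
  assumes "1 \<le> p" "p \<le> t" "t \<le> q" "q \<le> zz_length V"
  shows "multiplicity_of scale V p q = quot_dim (interval_num V p q t) (interval_den V p q t)"
  unfolding multiplicity_of_def
proof (rule the_equality)
  show "\<exists>S. interval_decomposition scale V S \<and>
      quot_dim (interval_num V p q t) (interval_den V p q t) = ecard {x. (p, q, x) \<in> S}"
    using interval_decomposition_exists interval_decomposition_multiplicity[OF _ assms] by metis
  show "m = quot_dim (interval_num V p q t) (interval_den V p q t)"
    if "\<exists>S. interval_decomposition scale V S \<and> m = ecard {x. (p, q, x) \<in> S}" for m
    using that interval_decomposition_multiplicity[OF _ assms] by metis
qed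

end


text \<open>The bridge to homology: the two modules may differ in length and shape, and only one
  position of each has to be related.\<close>

lemma multiplicity_of_transfer:
  assumes V: "zigzag_space s V" and W: "zigzag_space s W"
    and p: "1 \<le> p" "p \<le> t" "t \<le> q" "q \<le> zz_length V"
    and p': "1 \<le> p'" "p' \<le> t'" "t' \<le> q'" "q' \<le> zz_length W"
    and R: "linear_relation s s R"
    and rel: "relates_quots R (interval_num V p q t) (interval_den V p q t)
      (interval_num W p' q' t') (interval_den W p' q' t')"
  shows "multiplicity_of s V p q = multiplicity_of s W p' q'"
proof -
  interpret V: zigzag_space s V by (rule V)
  interpret W: zigzag_space s W by (rule W)
  interpret scalar_space_pair s s ..
  show ?thesis
    unfolding V.multiplicity_of_eq_quot_dim[OF p] W.multiplicity_of_eq_quot_dim[OF p']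
    using V.interval_subspace[OF p] W.interval_subspace[OF p'] by (intro quot_dim_transfer[OF R rel])
qed

text \<open>Stated with \<open>t - 1\<close> instead of \<open>Suc t\<close>, so that it unfolds at
  numeral positions; the premise stops the unfolding at \<open>p\<close>.\<close>

lemma lsub_rec: "p < t \<Longrightarrow> lsub V p t = zz_step V (t - 1) (lsub V p (t - 1))"
  and lsub_pred_rec: "p < t \<Longrightarrow> lsub_pred V p t = zz_step V (t - 1) (lsub_pred V p (t - 1))"
  using lsub_Suc[of p "t - 1" V] lsub_pred_Suc[of p "t - 1" V] by auto

section \<open>Homology of slices\<close>

locale taut_space = homology_theory smul H Hmap bd
  for smul :: "'k::field \<Rightarrow> 'v::ab_group_add \<Rightarrow> 'v"
    and H :: "int \<Rightarrow> 'a topology \<Rightarrow> 'a set \<Rightarrow> 'v set"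
    and Hmap :: "int \<Rightarrow> 'a topology \<Rightarrow> 'a set \<Rightarrow> 'a topology \<Rightarrow> 'a set \<Rightarrow> ('a \<Rightarrow> 'a) \<Rightarrow> 'v \<Rightarrow> 'v"
    and bd :: "int \<Rightarrow> 'a topology \<Rightarrow> 'a set \<Rightarrow> 'v \<Rightarrow> 'v" +
  fixes X :: "'a topology" and f :: "'a \<Rightarrow> real"
  assumes cont: "continuous_map X euclideanreal f"
    and taut: "\<And>q. taut_levelset H Hmap X f q"
begin

sublocale scalar_space smul ..

text \<open>Naming slices by sets of reals turns the side conditions on pairs of spaces into
  inclusions between sets of reals.\<close>

definition h :: "int \<Rightarrow> real set \<Rightarrow> real set \<Rightarrow> 'v set" where
  "h k I J = H k (subtopology X (slice X f I)) (slice X f J)"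

definition inc :: "int \<Rightarrow> real set \<Rightarrow> real set \<Rightarrow> real set \<Rightarrow> real set \<Rightarrow> 'v \<Rightarrow> 'v" where
  "inc k I J I' J' =
     Hmap k (subtopology X (slice X f I)) (slice X f J) (subtopology X (slice X f I')) (slice X f J') id"

text \<open>\<open>bdry k\<close> starts in degree \<open>k + 1\<close> and ends in degree \<open>k\<close>.\<close>

definition bdry :: "int \<Rightarrow> real set \<Rightarrow> real set \<Rightarrow> 'v \<Rightarrow> 'v" where
  "bdry k I J = bd (k + 1) (subtopology X (slice X f I)) (slice X f J)"

lemma slice_simps:
  "slice X f {} = {}" "slice X f UNIV = topspace X" "slice X f I \<subseteq> topspace X"
  "slice X f I \<inter> slice X f J = slice X f (I \<inter> J)"
  by (auto simp: slice_def)

lemma slice_mono: "I \<subseteq> J \<Longrightarrow> slice X f I \<subseteq> slice X f J"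
  by (auto simp: slice_def)

lemma topspace_slice: "topspace (subtopology X (slice X f I)) = slice X f I"
  by (auto simp: slice_def)

lemma subtopology_slice:
  "J \<subseteq> I \<Longrightarrow> subtopology (subtopology X (slice X f I)) (slice X f J) = subtopology X (slice X f J)"
  by (simp add: subtopology_subtopology slice_simps Int_absorb1)

lemma pair_map_slice:
  assumes "J \<subseteq> I" "J' \<subseteq> I'" "I \<subseteq> I'" "J \<subseteq> J'"
  shows "pair_map (subtopology X (slice X f I)) (slice X f J) (subtopology X (slice X f I')) (slice X f J') id"
  unfolding pair_map_def topspace_slice
  using slice_mono[OF assms(1)] slice_mono[OF assms(2)] slice_mono[OF assms(3)] slice_mono[OF assms(4)]
  by (auto simp: continuous_map_in_subtopology continuous_map_from_subtopology)

lemma h_subspace: "J \<subseteq> I \<Longrightarrow> subspace (h k I J)"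
  unfolding h_def by (rule H_subspace) (simp add: slice_simps slice_mono)

lemma h_closed:
  assumes "J \<subseteq> I"
  shows "0 \<in> h k I J" "x \<in> h k I J \<Longrightarrow> y \<in> h k I J \<Longrightarrow> x + y \<in> h k I J"
    "x \<in> h k I J \<Longrightarrow> y \<in> h k I J \<Longrightarrow> x - y \<in> h k I J" "x \<in> h k I J \<Longrightarrow> smul c x \<in> h k I J"
  using h_subspace[OF assms] by (auto intro: subspace_0 subspace_add subspace_diff subspace_scale)

lemma linear_between_rules:
  assumes g: "linear_between smul smul A B g" and A: "subspace A"
  shows "x \<in> A \<Longrightarrow> g x \<in> B" "x \<in> A \<Longrightarrow> y \<in> A \<Longrightarrow> g (x + y) = g x + g y"
    "x \<in> A \<Longrightarrow> g (smul c x) = smul c (g x)" "g 0 = 0"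
    "x \<in> A \<Longrightarrow> y \<in> A \<Longrightarrow> g (x - y) = g x - g y"
proof -
  show a: "g (x + y) = g x + g y" if "x \<in> A" "y \<in> A" for x y
    using g that unfolding linear_between_def by auto
  show "x \<in> A \<Longrightarrow> g x \<in> B" "x \<in> A \<Longrightarrow> g (smul c x) = smul c (g x)"
    using g unfolding linear_between_def by auto
  show "g 0 = 0" using a[of 0 0] subspace_0[OF A] by simp
  show "x \<in> A \<Longrightarrow> y \<in> A \<Longrightarrow> g (x - y) = g x - g y"
    using a[of "x - y" y] subspace_diff[OF A] by (simp add: algebra_simps)
qed

lemma inc_linear:
  assumes "J \<subseteq> I" "J' \<subseteq> I'" "I \<subseteq> I'" "J \<subseteq> J'"
  shows "linear_between smul smul (h k I J) (h k I' J') (inc k I J I' J')"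
  unfolding h_def inc_def by (rule Hmap_linear[OF pair_map_slice[OF assms]])

lemma inc_rules:
  assumes "J \<subseteq> I" "J' \<subseteq> I'" "I \<subseteq> I'" "J \<subseteq> J'"
  shows "x \<in> h k I J \<Longrightarrow> inc k I J I' J' x \<in> h k I' J'"
    "x \<in> h k I J \<Longrightarrow> y \<in> h k I J \<Longrightarrow> inc k I J I' J' (x + y) = inc k I J I' J' x + inc k I J I' J' y"
    "x \<in> h k I J \<Longrightarrow> inc k I J I' J' (smul c x) = smul c (inc k I J I' J' x)"
    "inc k I J I' J' 0 = 0"
    "x \<in> h k I J \<Longrightarrow> y \<in> h k I J \<Longrightarrow> inc k I J I' J' (x - y) = inc k I J I' J' x - inc k I J I' J' y"
  using linear_between_rules[OF inc_linear[OF assms] h_subspace[OF assms(1)]] by auto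

lemma inc_comp:
  assumes "J \<subseteq> I" "J' \<subseteq> I'" "J'' \<subseteq> I''" "I \<subseteq> I'" "J \<subseteq> J'" "I' \<subseteq> I''" "J' \<subseteq> J''" "x \<in> h k I J"
  shows "inc k I' J' I'' J'' (inc k I J I' J' x) = inc k I J I'' J'' x"
  using Hmap_comp[OF pair_map_slice pair_map_slice, of J I J' I' J'' I'' x k] assms
  unfolding inc_def h_def by simp

lemma bdry_linear:
  assumes "J \<subseteq> I"
  shows "linear_between smul smul (h (k + 1) I J) (h k J {}) (bdry k I J)"
  using bd_linear[of "slice X f J" "subtopology X (slice X f I)" "k + 1"] assms
  by (simp add: h_def bdry_def subtopology_slice slice_simps topspace_slice slice_mono)

lemma bdry_rules:
  assumes "J \<subseteq> I"
  shows "x \<in> h (k + 1) I J \<Longrightarrow> bdry k I J x \<in> h k J {}"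
    "x \<in> h (k + 1) I J \<Longrightarrow> y \<in> h (k + 1) I J \<Longrightarrow> bdry k I J (x + y) = bdry k I J x + bdry k I J y"
    "x \<in> h (k + 1) I J \<Longrightarrow> bdry k I J (smul c x) = smul c (bdry k I J x)"
    "bdry k I J 0 = 0"
    "x \<in> h (k + 1) I J \<Longrightarrow> y \<in> h (k + 1) I J \<Longrightarrow> bdry k I J (x - y) = bdry k I J x - bdry k I J y"
  using linear_between_rules[OF bdry_linear[OF assms] h_subspace[OF assms]] by auto

lemma bdry_inc:
  assumes "J \<subseteq> I" "J' \<subseteq> I'" "I \<subseteq> I'" "J \<subseteq> J'" "x \<in> h (k + 1) I J"
  shows "bdry k I' J' (inc (k + 1) I J I' J' x) = inc k J {} J' {} (bdry k I J x)"
  using bd_natural[OF pair_map_slice, of J I J' I' x "k + 1"] assms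
  by (simp add: h_def bdry_def inc_def subtopology_slice slice_simps)

lemma exact_slice_space:
  assumes "J \<subseteq> I"
  shows "x \<in> h k I {} \<Longrightarrow> inc k I {} I J x = 0 \<longleftrightarrow> (\<exists>y\<in>h k J {}. x = inc k J {} I {} y)"
    and "y \<in> h k J {} \<Longrightarrow> inc k J {} I J y = 0"
proof -
  have "inc k J {} I {} ` h k J {} = {x \<in> h k I {}. inc k I {} I J x = 0}"
    using exact_at_space[of "slice X f J" "subtopology X (slice X f I)" k] assms
    by (simp add: h_def inc_def subtopology_slice slice_simps topspace_slice slice_mono)
  then show *: "x \<in> h k I {} \<Longrightarrow> inc k I {} I J x = 0 \<longleftrightarrow> (\<exists>y\<in>h k J {}. x = inc k J {} I {} y)" for x
    by blast
  show "inc k J {} I J y = 0" if y: "y \<in> h k J {}"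
  proof -
    have "inc k J {} I {} y \<in> h k I {}" using assms y by (intro inc_rules) auto
    then have "inc k I {} I J (inc k J {} I {} y) = 0" using * y by blast
    then show ?thesis using inc_comp[of "{}" J "{}" I J I y k] assms y by simp
  qed
qed

lemma exact_slice_pair:
  assumes "J \<subseteq> I"
  shows "x \<in> h (k + 1) I J \<Longrightarrow> bdry k I J x = 0 \<longleftrightarrow> (\<exists>y\<in>h (k + 1) I {}. x = inc (k + 1) I {} I J y)"
proof -
  have "inc (k + 1) I {} I J ` h (k + 1) I {} = {x \<in> h (k + 1) I J. bdry k I J x = 0}"
    using exact_at_pair[of "slice X f J" "subtopology X (slice X f I)" "k + 1"] assms
    by (simp add: h_def inc_def bdry_def subtopology_slice slice_simps topspace_slice slice_mono)
  then show "x \<in> h (k + 1) I J \<Longrightarrow> bdry k I J x = 0 \<longleftrightarrow> (\<exists>y\<in>h (k + 1) I {}. x = inc (k + 1) I {} I J y)"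
    by blast
qed

lemma exact_slice_subspace:
  assumes "J \<subseteq> I"
  shows "x \<in> h k J {} \<Longrightarrow> inc k J {} I {} x = 0 \<longleftrightarrow> (\<exists>y\<in>h (k + 1) I J. x = bdry k I J y)"
proof -
  have "bdry k I J ` h (k + 1) I J = {x \<in> h k J {}. inc k J {} I {} x = 0}"
    using exact_at_subspace[of "slice X f J" "subtopology X (slice X f I)" "k + 1"] assms
    by (simp add: h_def inc_def bdry_def subtopology_slice slice_simps topspace_slice slice_mono)
  then show "x \<in> h k J {} \<Longrightarrow> inc k J {} I {} x = 0 \<longleftrightarrow> (\<exists>y\<in>h (k + 1) I J. x = bdry k I J y)"
    by blast
qed

lemma inc_bdry:
  assumes "J \<subseteq> I" "y \<in> h (k + 1) I J"
  shows "inc k J {} I {} (bdry k I J y) = 0"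
  using exact_slice_subspace[OF assms(1) bdry_rules(1)[OF assms]] assms(2) by blast

lemma bdry_inc_absolute:
  assumes "J \<subseteq> I" "y \<in> h (k + 1) I {}"
  shows "bdry k I J (inc (k + 1) I {} I J y) = 0"
proof -
  have "inc (k + 1) I {} I J y \<in> h (k + 1) I J" using assms by (intro inc_rules) auto
  then show ?thesis using exact_slice_pair[OF assms(1)] assms(2) by blast
qed

text \<open>The last condition makes the slice over \<open>J\<close> a normal neighbourhood of the levelset of \<open>q\<close>.\<close>

definition cut :: "real \<Rightarrow> real set \<Rightarrow> real set \<Rightarrow> real set \<Rightarrow> bool" where
  "cut q I K J \<longleftrightarrow> I = J \<inter> {..q} \<and> K = J \<inter> {q..} \<and> (\<exists>e>0. {q - e..q + e} \<subseteq> J)"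

section \<open>Excision and Mayer--Vietoris exactness at a taut level\<close>

lemma cut_intervals:
  "s < q \<Longrightarrow> q < t \<Longrightarrow> cut q {s..q} {q..t} {s..t}"
  "q < t \<Longrightarrow> cut q {..q} {q..t} {..t}"
  "s < q \<Longrightarrow> cut q {s..q} {q..} {s..}"
  "cut q {..q} {q..} UNIV"
proof -
  show "cut q {s..q} {q..t} {s..t}" if "s < q" "q < t"
    using that unfolding cut_def by (auto intro!: exI[of _ "min (q - s) (t - q)"])
  show "cut q {..q} {q..t} {..t}" if "q < t"
    using that unfolding cut_def by (auto intro!: exI[of _ "t - q"])
  show "cut q {s..q} {q..} {s..}" if "s < q"
    using that unfolding cut_def by (auto intro!: exI[of _ "q - s"])
  show "cut q {..q} {q..} UNIV"
    unfolding cut_def by (auto intro!: exI[of _ 1])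
qed

lemma cut_subset:
  assumes "cut q I K J"
  shows "I \<subseteq> J" "K \<subseteq> J" "{q} \<subseteq> I" "{q} \<subseteq> K" "{q} \<subseteq> J"
  using assms unfolding cut_def by auto

text \<open>Tautness enters here, for the neighbourhood over \<open>J\<close>. By continuity of
  \<open>f\<close> the closed band of radius \<open>e\<close> around \<open>q\<close> is a closed
  neighbourhood of the levelset inside it.\<close>

lemma cut_excision:
  assumes "cut q I K J"
  shows "bij_betw (inc k I {q} J K) (h k I {q}) (h k J K)"
proof -
  obtain e where e: "e > 0" "{q - e..q + e} \<subseteq> J" and I: "I = J \<inter> {..q}" and K: "K = J \<inter> {q..}"
    using assms unfolding cut_def by auto
  have "closedin X (slice X f {q - e..q + e})"
    unfolding slice_def using closedin_continuous_map_preimage[OF cont, of "{q - e..q + e}"] by simp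
  moreover have "openin X (slice X f {q - e<..<q + e})"
    unfolding slice_def using openin_continuous_map_preimage[OF cont, of "{q - e<..<q + e}"] by simp
  then have "slice X f {q - e<..<q + e} \<subseteq> X interior_of slice X f {q - e..q + e}"
    by (intro interior_of_maximal) (auto intro!: slice_mono)
  then have "slice X f {q} \<subseteq> X interior_of slice X f {q - e..q + e}"
    using e slice_mono[of "{q}" "{q - e<..<q + e}"] by auto
  ultimately have "normal_neighbourhood X (slice X f {q}) (slice X f J)"
    unfolding normal_neighbourhood_def using slice_mono[OF e(2)] slice_simps(3) by blast
  then show ?thesis
    using taut[of q, unfolded taut_levelset_def, rule_format, of "slice X f J"]
    unfolding h_def inc_def I K by (simp add: Let_def slice_simps(4))
qed

text \<open>By injectivity of excision \<open>x\<close> already vanishes relative to the levelset,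
  and exactness of the pair over \<open>I\<close> and \<open>{q}\<close> gives
  \<open>z\<close>.\<close>

lemma cut_restrict:
  assumes c: "cut q I K J" and x: "x \<in> h k I {}" "inc k I {} J K x = 0"
  shows "\<exists>z\<in>h k {q} {}. inc k {q} {} I {} z = x"
proof -
  note s = cut_subset[OF c]
  have y: "inc k I {} I {q} x \<in> h k I {q}" using x s by (intro inc_rules) auto
  have "inc k I {q} J K (inc k I {} I {q} x) = 0"
    using x s inc_comp[of "{}" I "{q}" I K J x k] by simp
  then have "inc k I {q} J K (inc k I {} I {q} x) = inc k I {q} J K 0"
    using s by (simp add: inc_rules)
  then have "inc k I {} I {q} x = 0"
    using bij_betw_imp_inj_on[OF cut_excision[OF c]] y h_closed(1)[OF s(3)] by (metis inj_onD)
  then show ?thesis using exact_slice_space(1)[OF s(3) x(1)] by auto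
qed

text \<open>First lift \<open>x\<close> alone to the level. The error \<open>w\<close> on the side
  of \<open>K\<close> dies in \<open>J\<close>, so it bounds a relative class, which excision moves
  to the pair over \<open>I\<close> and \<open>{q}\<close>. Its boundary on the level corrects the
  lift without affecting the image in \<open>I\<close>.\<close>

lemma cut_mayer_vietoris:
  assumes c: "cut q I K J" and x: "x \<in> h k I {}" and y: "y \<in> h k K {}"
    and eq: "inc k I {} J {} x = inc k K {} J {} y"
  shows "\<exists>z\<in>h k {q} {}. inc k {q} {} I {} z = x \<and> inc k {q} {} K {} z = y"
proof -
  note s = cut_subset[OF c]
  have "inc k I {} J K x = inc k J {} J K (inc k I {} J {} x)"
    using x s by (simp add: inc_comp)
  also have "\<dots> = inc k K {} J K y" unfolding eq using y s by (simp add: inc_comp)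
  also have "\<dots> = 0" using exact_slice_space(2)[OF s(2) y] .
  finally obtain z where z: "z \<in> h k {q} {}" "inc k {q} {} I {} z = x" using cut_restrict[OF c x] by blast
  define w where "w = inc k {q} {} K {} z - y"
  have zK: "inc k {q} {} K {} z \<in> h k K {}" using z(1) s by (intro inc_rules) auto
  then have wK: "w \<in> h k K {}" unfolding w_def using y by (intro h_closed) auto
  have "inc k K {} J {} w = inc k {q} {} J {} z - inc k K {} J {} y"
    unfolding w_def using zK y z(1) s by (simp add: inc_rules inc_comp)
  also have "\<dots> = 0" unfolding eq[symmetric] z(2)[symmetric] using z(1) s by (simp add: inc_comp)
  finally obtain v where v: "v \<in> h (k + 1) J K" "w = bdry k J K v"
    using exact_slice_subspace[OF s(2) wK] by blast
  obtain u where u: "u \<in> h (k + 1) I {q}" "v = inc (k + 1) I {q} J K u"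
    using bij_betw_imp_surj_on[OF cut_excision[OF c, of "k + 1"]] v(1) by blast
  have bu: "bdry k I {q} u \<in> h k {q} {}" using bdry_rules(1)[OF s(3) u(1)] .
  have w': "w = inc k {q} {} K {} (bdry k I {q} u)"
    unfolding v(2) u(2) using u(1) s by (intro bdry_inc) auto
  define z' where "z' = z - bdry k I {q} u"
  have "z' \<in> h k {q} {}" unfolding z'_def using z(1) bu by (intro h_closed) auto
  moreover have "inc k {q} {} I {} z' = x"
    unfolding z'_def using z bu s inc_bdry[OF s(3) u(1)] by (simp add: inc_rules)
  moreover have "inc k {q} {} K {} z' = y"
  proof -
    have "inc k {q} {} K {} z' = inc k {q} {} K {} z - w"
      unfolding z'_def w' using z(1) bu s by (simp add: inc_rules)
    then show ?thesis unfolding w_def by simp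
  qed
  ultimately show ?thesis by blast
qed

text \<open>Both cuts have the same lower part \<open>I\<close>, so both pairs are excised to the
  same pair over \<open>I\<close> and \<open>{q}\<close>.\<close>

lemma cut_excision_inj:
  assumes c: "cut q I K J" and c': "cut q I K' J'" and J: "J \<subseteq> J'"
    and x: "x \<in> h k J K" "inc k J K J' K' x = 0"
  shows "x = 0"
proof -
  note s = cut_subset[OF c] and s' = cut_subset[OF c']
  have K: "K \<subseteq> K'" using c c' J unfolding cut_def by auto
  obtain u where u: "u \<in> h k I {q}" "x = inc k I {q} J K u"
    using bij_betw_imp_surj_on[OF cut_excision[OF c, of k]] x(1) by blast
  have "inc k I {q} J' K' u = 0" using x(2) u s s' J K by (simp add: inc_comp)
  then have "inc k I {q} J' K' u = inc k I {q} J' K' 0" using s' by (simp add: inc_rules)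
  then have "u = 0"
    using bij_betw_imp_inj_on[OF cut_excision[OF c']] u(1) h_closed(1)[OF s(3)] by (metis inj_onD)
  then show ?thesis using u(2) s by (simp add: inc_rules)
qed

text \<open>By \<open>cut_excision_inj\<close> a class that vanishes relative to \<open>K'\<close>
  already vanishes relative to \<open>K\<close>. With \<open>J' = UNIV\<close> this moves
  sublevelset classes that vanish in a later group of the extended module into a bounded
  slice.\<close>

lemma cut_restrict_upper:
  assumes c: "cut q I K J" and c': "cut q I K' J'" and J: "J \<subseteq> J'"
    and x: "x \<in> h k J {}" "inc k J {} J' K' x = 0"
  shows "\<exists>y\<in>h k K {}. x = inc k K {} J {} y"
proof -
  note s = cut_subset[OF c] and s' = cut_subset[OF c']
  have K: "K \<subseteq> K'" using c c' J unfolding cut_def by auto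
  have "inc k J {} J K x \<in> h k J K" using x s by (intro inc_rules) auto
  moreover have "inc k J K J' K' (inc k J {} J K x) = 0" using x s s' J K by (simp add: inc_comp)
  ultimately have "inc k J {} J K x = 0" using cut_excision_inj[OF c c' J] by blast
  then show ?thesis using exact_slice_space(1)[OF s(2) x(1)] by blast
qed

lemma levelset_zigzag_slices:
  "levelset_zigzag H Hmap i X f a b c d = homology_zigzag H Hmap i X odd
     (map (\<lambda>(I, J). (slice X f I, slice X f J))
       [({a}, {}), ({a..b}, {}), ({b}, {}), ({b..c}, {}), ({c}, {}), ({c..d}, {}), ({d}, {})])"
  unfolding levelset_zigzag_def by (simp add: slice_simps(1))

lemma extended_module_slices:
  "extended_module H Hmap i X f a b c d = homology_zigzag H Hmap i X (\<lambda>_. True)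
     (map (\<lambda>(I, J). (slice X f I, slice X f J))
       [({..a}, {}), ({..b}, {}), ({..c}, {}), ({..d}, {}),
        (UNIV, {d..}), (UNIV, {c..}), (UNIV, {b..}), (UNIV, {a..})])"
  unfolding extended_module_def by (simp add: slice_simps(1,2))

section \<open>Comparison of the two modules\<close>

context
  fixes a b c d :: real
  assumes ab: "a < b" and bc: "b < c" and cd: "c < d"
  notes [simp] = inc_comp inc_rules bdry_rules h_closed ab bc cd less_imp_le[OF ab] less_imp_le[OF bc]
    less_imp_le[OF cd] less_imp_le[OF less_trans[OF ab bc]] less_imp_le[OF less_trans[OF bc cd]]
    less_imp_le[OF less_trans[OF ab less_trans[OF bc cd]]]
begin

abbreviation "Lev i \<equiv> levelset_zigzag H Hmap i X f a b c d"
abbreviation "Ext i \<equiv> extended_module H Hmap i X f a b c d"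

lemma zigzag_space_Lev: "zigzag_space smul (Lev i)"
  by unfold_locales (rule zigzag_module_levelset_zigzag[OF ab bc cd])

lemma zigzag_space_Ext: "zigzag_space smul (Ext i)"
  by unfold_locales (rule zigzag_module_extended_module[OF ab bc cd])

lemma Lev_length: "zz_length (Lev i) = 7" and Lev_forward: "zz_forward (Lev i) j \<longleftrightarrow> odd j"
  unfolding levelset_zigzag_slices homology_zigzag_def Let_def by simp_all

lemma Ext_length: "zz_length (Ext i) = 8" and Ext_forward: "zz_forward (Ext i) j"
  unfolding extended_module_slices homology_zigzag_def Let_def by simp_all

lemma Lev_space:
  "zz_space (Lev i) 1 = h i {a} {}" "zz_space (Lev i) 2 = h i {a..b} {}" "zz_space (Lev i) 3 = h i {b} {}"
  "zz_space (Lev i) 4 = h i {b..c} {}" "zz_space (Lev i) 5 = h i {c} {}" "zz_space (Lev i) 6 = h i {c..d} {}"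
  "zz_space (Lev i) 7 = h i {d} {}"
  unfolding levelset_zigzag_slices homology_zigzag_def Let_def h_def inc_def by simp_all

lemma Lev_map:
  "zz_map (Lev i) 1 = inc i {a} {} {a..b} {}" "zz_map (Lev i) 2 = inc i {b} {} {a..b} {}"
  "zz_map (Lev i) 3 = inc i {b} {} {b..c} {}" "zz_map (Lev i) 4 = inc i {c} {} {b..c} {}"
  "zz_map (Lev i) 5 = inc i {c} {} {c..d} {}" "zz_map (Lev i) 6 = inc i {d} {} {c..d} {}"
  unfolding levelset_zigzag_slices homology_zigzag_def Let_def h_def inc_def by simp_all

lemma Ext_space:
  "zz_space (Ext i) 1 = h i {..a} {}" "zz_space (Ext i) 2 = h i {..b} {}" "zz_space (Ext i) 3 = h i {..c} {}"
  "zz_space (Ext i) 4 = h i {..d} {}" "zz_space (Ext i) 5 = h i UNIV {d..}" "zz_space (Ext i) 6 = h i UNIV {c..}"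
  "zz_space (Ext i) 7 = h i UNIV {b..}" "zz_space (Ext i) 8 = h i UNIV {a..}"
  unfolding extended_module_slices homology_zigzag_def Let_def h_def inc_def by simp_all

lemma Ext_map:
  "zz_map (Ext i) 1 = inc i {..a} {} {..b} {}" "zz_map (Ext i) 2 = inc i {..b} {} {..c} {}"
  "zz_map (Ext i) 3 = inc i {..c} {} {..d} {}" "zz_map (Ext i) 4 = inc i {..d} {} UNIV {d..}"
  "zz_map (Ext i) 5 = inc i UNIV {d..} UNIV {c..}" "zz_map (Ext i) 6 = inc i UNIV {c..} UNIV {b..}"
  "zz_map (Ext i) 7 = inc i UNIV {b..} UNIV {a..}"
  unfolding extended_module_slices homology_zigzag_def Let_def h_def inc_def by simp_all

section \<open>The chains of both modules at the positions of comparison\<close>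

lemmas chain_simps = lsub_rec lsub_pred_rec lsub_start lsub_pred_start birth_space_def birth_space_pred_def
  zz_step_def rsub_start rsub_step
lemmas Lev_simps = Lev_length Lev_forward Lev_space Lev_space(1)[simplified] Lev_map Lev_map(1)[simplified]
lemmas Ext_simps = Ext_length Ext_forward Ext_space Ext_space(1)[simplified] Ext_map Ext_map(1)[simplified]

text \<open>If the comparison takes place at an endpoint of the interval that is cut off by a
  kernel, the chain on that side has predecessor zero and one summand disappears.\<close>

lemma interval_den_zero:
  assumes "zigzag_space smul V" "1 \<le> p" "p \<le> t" "t \<le> q" "q \<le> zz_length V"
  shows "rsub_pred V q t = {0} \<Longrightarrow> interval_den V p q t = lsub_pred V p t \<inter> rsub V q t"
    and "lsub_pred V p t = {0} \<Longrightarrow> interval_den V p q t = lsub V p t \<inter> rsub_pred V q t"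
proof -
  interpret V: zigzag_space smul V by fact
  have "0 \<in> lsub V p t" "0 \<in> rsub V q t"
    using V.lsub_subspace[of p t] V.rsub_subspace[of t q] assms(2-) subspace_0 by auto
  then show "rsub_pred V q t = {0} \<Longrightarrow> interval_den V p q t = lsub_pred V p t \<inter> rsub V q t"
    "lsub_pred V p t = {0} \<Longrightarrow> interval_den V p q t = lsub V p t \<inter> rsub_pred V q t"
    unfolding interval_den_def set_sum_def by auto
qed

text \<open>Trades bounded slices for sublevelsets. Classes in sublevelsets are cut down to
  levelsets by Mayer--Vietoris, once at \<open>b\<close> and, for the predecessor, a second time at
  \<open>a\<close>.\<close>

lemma left_chain:
  assumes x: "x \<in> h i {c} {}"
  shows "(\<exists>z\<in>h i {b} {}. inc i {c} {} {b..c} {} x = inc i {b} {} {b..c} {} z) \<longleftrightarrow>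
         (\<exists>u\<in>h i {..b} {}. inc i {c} {} {..c} {} x = inc i {..b} {} {..c} {} u)"
    and "(\<exists>z\<in>h i {b} {}. inc i {c} {} {b..c} {} x = inc i {b} {} {b..c} {} z \<and>
            (\<exists>w\<in>h i {a} {}. inc i {b} {} {a..b} {} z = inc i {a} {} {a..b} {} w)) \<longleftrightarrow>
         (\<exists>u\<in>h i {..a} {}. inc i {c} {} {..c} {} x = inc i {..a} {} {..c} {} u)"
proof -
  have fwd: "inc i {c} {} {..c} {} x = inc i {b} {} {..c} {} z"
    if "z \<in> h i {b} {}" "inc i {c} {} {b..c} {} x = inc i {b} {} {b..c} {} z" for z
  proof -
    have "inc i {b..c} {} {..c} {} (inc i {c} {} {b..c} {} x) = inc i {b..c} {} {..c} {} (inc i {b} {} {b..c} {} z)"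
      using that by simp
    then show ?thesis using x that(1) by simp
  qed
  \<comment> \<open>\<open>u\<close> over \<open>{..b}\<close> and the image of \<open>x\<close>
    over \<open>{b..c}\<close> agree in \<open>{..c}\<close>. That \<open>z\<close> also restricts
    to \<open>u\<close> is kept, since the second cut, at \<open>a\<close>, relies on it.\<close>
  have bwd: "\<exists>z\<in>h i {b} {}. inc i {b} {} {..b} {} z = u \<and> inc i {b} {} {b..c} {} z = inc i {c} {} {b..c} {} x"
    if "u \<in> h i {..b} {}" "inc i {c} {} {..c} {} x = inc i {..b} {} {..c} {} u" for u
    using cut_mayer_vietoris[OF cut_intervals(2)[OF bc], of u i "inc i {c} {} {b..c} {} x"] that x by auto
  show "(\<exists>z\<in>h i {b} {}. inc i {c} {} {b..c} {} x = inc i {b} {} {b..c} {} z) \<longleftrightarrow>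
         (\<exists>u\<in>h i {..b} {}. inc i {c} {} {..c} {} x = inc i {..b} {} {..c} {} u)"
  proof
    assume "\<exists>z\<in>h i {b} {}. inc i {c} {} {b..c} {} x = inc i {b} {} {b..c} {} z"
    then obtain z where z: "z \<in> h i {b} {}" "inc i {c} {} {b..c} {} x = inc i {b} {} {b..c} {} z" by blast
    then show "\<exists>u\<in>h i {..b} {}. inc i {c} {} {..c} {} x = inc i {..b} {} {..c} {} u"
      using fwd[OF z] by (intro bexI[of _ "inc i {b} {} {..b} {} z"]) auto
  next
    assume "\<exists>u\<in>h i {..b} {}. inc i {c} {} {..c} {} x = inc i {..b} {} {..c} {} u"
    then obtain u where u: "u \<in> h i {..b} {}" "inc i {c} {} {..c} {} x = inc i {..b} {} {..c} {} u" by blast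
    from bwd[OF this] show "\<exists>z\<in>h i {b} {}. inc i {c} {} {b..c} {} x = inc i {b} {} {b..c} {} z" by metis
  qed
  show "(\<exists>z\<in>h i {b} {}. inc i {c} {} {b..c} {} x = inc i {b} {} {b..c} {} z \<and>
            (\<exists>w\<in>h i {a} {}. inc i {b} {} {a..b} {} z = inc i {a} {} {a..b} {} w)) \<longleftrightarrow>
         (\<exists>u\<in>h i {..a} {}. inc i {c} {} {..c} {} x = inc i {..a} {} {..c} {} u)"
  proof
    assume "\<exists>z\<in>h i {b} {}. inc i {c} {} {b..c} {} x = inc i {b} {} {b..c} {} z \<and>
            (\<exists>w\<in>h i {a} {}. inc i {b} {} {a..b} {} z = inc i {a} {} {a..b} {} w)"
    then obtain z w where z: "z \<in> h i {b} {}" "inc i {c} {} {b..c} {} x = inc i {b} {} {b..c} {} z"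
      and w: "w \<in> h i {a} {}" "inc i {b} {} {a..b} {} z = inc i {a} {} {a..b} {} w" by blast
    have "inc i {a..b} {} {..c} {} (inc i {b} {} {a..b} {} z) = inc i {a..b} {} {..c} {} (inc i {a} {} {a..b} {} w)"
      using w by simp
    then have "inc i {b} {} {..c} {} z = inc i {a} {} {..c} {} w" using z(1) w(1) by simp
    then show "\<exists>u\<in>h i {..a} {}. inc i {c} {} {..c} {} x = inc i {..a} {} {..c} {} u"
      using fwd[OF z] w(1) by (intro bexI[of _ "inc i {a} {} {..a} {} w"]) auto
  next
    assume "\<exists>u\<in>h i {..a} {}. inc i {c} {} {..c} {} x = inc i {..a} {} {..c} {} u"
    then obtain u where u: "u \<in> h i {..a} {}" "inc i {c} {} {..c} {} x = inc i {..a} {} {..c} {} u" by blast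
    then obtain z where z: "z \<in> h i {b} {}" "inc i {b} {} {..b} {} z = inc i {..a} {} {..b} {} u"
        "inc i {b} {} {b..c} {} z = inc i {c} {} {b..c} {} x"
      using bwd[of "inc i {..a} {} {..b} {} u"] by auto
    then obtain w where "w \<in> h i {a} {}" "inc i {a} {} {a..b} {} w = inc i {b} {} {a..b} {} z"
      using cut_mayer_vietoris[OF cut_intervals(2)[OF ab], of u i "inc i {b} {} {a..b} {} z"] u by auto
    then show "\<exists>z\<in>h i {b} {}. inc i {c} {} {b..c} {} x = inc i {b} {} {b..c} {} z \<and>
            (\<exists>w\<in>h i {a} {}. inc i {b} {} {a..b} {} z = inc i {a} {} {a..b} {} w)"
      using z by metis
  qed
qed

text \<open>The mirror image of \<open>left_chain\<close>: superlevelsets are cut at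
  \<open>c\<close> and then at \<open>d\<close>.\<close>

lemma right_chain:
  assumes x: "x \<in> h i {b} {}"
  shows "(\<exists>z\<in>h i {c} {}. inc i {b} {} {b..c} {} x = inc i {c} {} {b..c} {} z) \<longleftrightarrow>
         (\<exists>u\<in>h i {c..} {}. inc i {b} {} {b..} {} x = inc i {c..} {} {b..} {} u)"
    and "(\<exists>z\<in>h i {c} {}. inc i {b} {} {b..c} {} x = inc i {c} {} {b..c} {} z \<and>
            (\<exists>w\<in>h i {d} {}. inc i {c} {} {c..d} {} z = inc i {d} {} {c..d} {} w)) \<longleftrightarrow>
         (\<exists>u\<in>h i {d..} {}. inc i {b} {} {b..} {} x = inc i {d..} {} {b..} {} u)"
proof -
  have fwd: "inc i {b} {} {b..} {} x = inc i {c} {} {b..} {} z"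
    if "z \<in> h i {c} {}" "inc i {b} {} {b..c} {} x = inc i {c} {} {b..c} {} z" for z
  proof -
    have "inc i {b..c} {} {b..} {} (inc i {b} {} {b..c} {} x) = inc i {b..c} {} {b..} {} (inc i {c} {} {b..c} {} z)"
      using that by simp
    then show ?thesis using x that(1) by simp
  qed
  have bwd: "\<exists>z\<in>h i {c} {}. inc i {c} {} {b..c} {} z = inc i {b} {} {b..c} {} x \<and> inc i {c} {} {c..} {} z = u"
    if "u \<in> h i {c..} {}" "inc i {b} {} {b..} {} x = inc i {c..} {} {b..} {} u" for u
    using cut_mayer_vietoris[OF cut_intervals(3)[OF bc], of "inc i {b} {} {b..c} {} x" i u] that x by auto
  show "(\<exists>z\<in>h i {c} {}. inc i {b} {} {b..c} {} x = inc i {c} {} {b..c} {} z) \<longleftrightarrow>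
         (\<exists>u\<in>h i {c..} {}. inc i {b} {} {b..} {} x = inc i {c..} {} {b..} {} u)"
  proof
    assume "\<exists>z\<in>h i {c} {}. inc i {b} {} {b..c} {} x = inc i {c} {} {b..c} {} z"
    then obtain z where z: "z \<in> h i {c} {}" "inc i {b} {} {b..c} {} x = inc i {c} {} {b..c} {} z" by blast
    then show "\<exists>u\<in>h i {c..} {}. inc i {b} {} {b..} {} x = inc i {c..} {} {b..} {} u"
      using fwd[OF z] by (intro bexI[of _ "inc i {c} {} {c..} {} z"]) auto
  next
    assume "\<exists>u\<in>h i {c..} {}. inc i {b} {} {b..} {} x = inc i {c..} {} {b..} {} u"
    then obtain u where u: "u \<in> h i {c..} {}" "inc i {b} {} {b..} {} x = inc i {c..} {} {b..} {} u" by blast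
    from bwd[OF this] show "\<exists>z\<in>h i {c} {}. inc i {b} {} {b..c} {} x = inc i {c} {} {b..c} {} z" by metis
  qed
  show "(\<exists>z\<in>h i {c} {}. inc i {b} {} {b..c} {} x = inc i {c} {} {b..c} {} z \<and>
            (\<exists>w\<in>h i {d} {}. inc i {c} {} {c..d} {} z = inc i {d} {} {c..d} {} w)) \<longleftrightarrow>
         (\<exists>u\<in>h i {d..} {}. inc i {b} {} {b..} {} x = inc i {d..} {} {b..} {} u)"
  proof
    assume "\<exists>z\<in>h i {c} {}. inc i {b} {} {b..c} {} x = inc i {c} {} {b..c} {} z \<and>
            (\<exists>w\<in>h i {d} {}. inc i {c} {} {c..d} {} z = inc i {d} {} {c..d} {} w)"
    then obtain z w where z: "z \<in> h i {c} {}" "inc i {b} {} {b..c} {} x = inc i {c} {} {b..c} {} z"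
      and w: "w \<in> h i {d} {}" "inc i {c} {} {c..d} {} z = inc i {d} {} {c..d} {} w" by blast
    have "inc i {c..d} {} {b..} {} (inc i {c} {} {c..d} {} z) = inc i {c..d} {} {b..} {} (inc i {d} {} {c..d} {} w)"
      using w by simp
    then have "inc i {c} {} {b..} {} z = inc i {d} {} {b..} {} w" using z(1) w(1) by simp
    then show "\<exists>u\<in>h i {d..} {}. inc i {b} {} {b..} {} x = inc i {d..} {} {b..} {} u"
      using fwd[OF z] w(1) by (intro bexI[of _ "inc i {d} {} {d..} {} w"]) auto
  next
    assume "\<exists>u\<in>h i {d..} {}. inc i {b} {} {b..} {} x = inc i {d..} {} {b..} {} u"
    then obtain u where u: "u \<in> h i {d..} {}" "inc i {b} {} {b..} {} x = inc i {d..} {} {b..} {} u" by blast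
    then obtain z where z: "z \<in> h i {c} {}" "inc i {c} {} {b..c} {} z = inc i {b} {} {b..c} {} x"
        "inc i {c} {} {c..} {} z = inc i {d..} {} {c..} {} u"
      using bwd[of "inc i {d..} {} {c..} {} u"] by auto
    then obtain w where "w \<in> h i {d} {}" "inc i {d} {} {c..d} {} w = inc i {c} {} {c..d} {} z"
      using cut_mayer_vietoris[OF cut_intervals(3)[OF cd], of "inc i {c} {} {c..d} {} z" i u] u by auto
    then show "\<exists>z\<in>h i {c} {}. inc i {b} {} {b..c} {} x = inc i {c} {} {b..c} {} z \<and>
            (\<exists>w\<in>h i {d} {}. inc i {c} {} {c..d} {} z = inc i {d} {} {c..d} {} w)"
      using z by metis
  qed
qed

lemma Lev_mixed_chains:
  "lsub (Lev i) 2 5 =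
     {x\<in>h i {c} {}. \<exists>z\<in>h i {b} {}. inc i {c} {} {b..c} {} x = inc i {b} {} {b..c} {} z}"
  "lsub_pred (Lev i) 2 5 =
     {x\<in>h i {c} {}. \<exists>z\<in>h i {b} {}. inc i {c} {} {b..c} {} x = inc i {b} {} {b..c} {} z \<and>
        (\<exists>w\<in>h i {a} {}. inc i {b} {} {a..b} {} z = inc i {a} {} {a..b} {} w)}"
  "rsub (Lev i) 6 3 =
     {x\<in>h i {b} {}. \<exists>z\<in>h i {c} {}. inc i {b} {} {b..c} {} x = inc i {c} {} {b..c} {} z}"
  "rsub_pred (Lev i) 6 3 =
     {x\<in>h i {b} {}. \<exists>z\<in>h i {c} {}. inc i {b} {} {b..c} {} x = inc i {c} {} {b..c} {} z \<and>
        (\<exists>w\<in>h i {d} {}. inc i {c} {} {c..d} {} z = inc i {d} {} {c..d} {} w)}"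
  by (simp_all add: chain_simps Lev_simps image_iff Bex_def cong: conj_cong)
    (auto simp: image_iff)

lemma Lev_chains:
  "lsub (Lev i) 2 5 =
     {x\<in>h i {c} {}. \<exists>u\<in>h i {..b} {}. inc i {c} {} {..c} {} x = inc i {..b} {} {..c} {} u}"
  "lsub_pred (Lev i) 2 5 =
     {x\<in>h i {c} {}. \<exists>u\<in>h i {..a} {}. inc i {c} {} {..c} {} x = inc i {..a} {} {..c} {} u}"
  "rsub (Lev i) 6 3 =
     {x\<in>h i {b} {}. \<exists>u\<in>h i {c..} {}. inc i {b} {} {b..} {} x = inc i {c..} {} {b..} {} u}"
  "rsub_pred (Lev i) 6 3 =
     {x\<in>h i {b} {}. \<exists>u\<in>h i {d..} {}. inc i {b} {} {b..} {} x = inc i {d..} {} {b..} {} u}"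
  unfolding Lev_mixed_chains by (simp_all only: left_chain right_chain cong: conj_cong)

lemma Lev_short_chains:
  "lsub (Lev i) 3 3 = {x\<in>h i {b} {}. inc i {b} {} {a..b} {} x = 0}"
  "lsub_pred (Lev i) 3 3 = {0}"
  "rsub (Lev i) 5 5 = {x\<in>h i {c} {}. inc i {c} {} {c..d} {} x = 0}"
  "rsub_pred (Lev i) 5 5 = {0}"
  "rsub (Lev i) 6 5 = h i {c} {}"
  "rsub_pred (Lev i) 6 5 =
     {x\<in>h i {c} {}. \<exists>w\<in>h i {d} {}. inc i {c} {} {c..d} {} x = inc i {d} {} {c..d} {} w}"
  "rsub (Lev i) 5 3 =
     {x\<in>h i {b} {}. \<exists>z\<in>h i {c} {}. inc i {b} {} {b..c} {} x = inc i {c} {} {b..c} {} z \<and>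
        inc i {c} {} {c..d} {} z = 0}"
  "rsub_pred (Lev i) 5 3 = {x\<in>h i {b} {}. inc i {b} {} {b..c} {} x = 0}"
  by (simp_all add: chain_simps Lev_simps image_iff Bex_def cong: conj_cong)
    (auto simp: image_iff)

lemma Ext_chains:
  "lsub (Ext i) 2 3 = {y\<in>h i {..c} {}. \<exists>u\<in>h i {..b} {}. y = inc i {..b} {} {..c} {} u}"
  "lsub_pred (Ext i) 2 3 = {y\<in>h i {..c} {}. \<exists>u\<in>h i {..a} {}. y = inc i {..a} {} {..c} {} u}"
  "rsub (Ext i) 3 3 = {y\<in>h i {..c} {}. inc i {..c} {} {..d} {} y = 0}"
  "rsub_pred (Ext i) 3 3 = {0}"
  "lsub (Ext i) 6 7 = {w\<in>h i UNIV {b..}. \<exists>s\<in>h i UNIV {c..}. w = inc i UNIV {c..} UNIV {b..} s}"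
  "lsub_pred (Ext i) 6 7 = {w\<in>h i UNIV {b..}. \<exists>s\<in>h i UNIV {d..}. w = inc i UNIV {d..} UNIV {b..} s}"
  "rsub (Ext i) 7 7 = {w\<in>h i UNIV {b..}. inc i UNIV {b..} UNIV {a..} w = 0}"
  "rsub_pred (Ext i) 7 7 = {0}"
  "rsub (Ext i) 5 3 = {y\<in>h i {..c} {}. inc i {..c} {} UNIV {c..} y = 0}"
  "rsub_pred (Ext i) 5 3 = {y\<in>h i {..c} {}. inc i {..c} {} UNIV {d..} y = 0}"
  "lsub (Ext i) 4 4 = h i {..d} {}"
  "lsub_pred (Ext i) 4 4 = {y\<in>h i {..d} {}. \<exists>u\<in>h i {..c} {}. y = inc i {..c} {} {..d} {} u}"
  "rsub (Ext i) 7 4 = {y\<in>h i {..d} {}. inc i {..d} {} UNIV {a..} y = 0}"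
  "rsub_pred (Ext i) 7 4 = {y\<in>h i {..d} {}. inc i {..d} {} UNIV {b..} y = 0}"
  by (simp_all add: chain_simps Ext_simps image_iff Bex_def cong: conj_cong)
    (auto simp: image_iff)

section \<open>The four equalities of measures\<close>

lemmas interval_ranges = zigzag_space_Lev zigzag_space_Ext Lev_length Ext_length
lemmas interval_unfold = interval_num_def Lev_chains Lev_short_chains Ext_chains

lemma linear_relationI:
  assumes "R 0 0" "\<And>x y x' y'. R x y \<Longrightarrow> R x' y' \<Longrightarrow> R (x + x') (y + y')"
    "\<And>c x y. R x y \<Longrightarrow> R (smul c x) (smul c y)"
  shows "linear_relation smul smul R"
  using assms unfolding linear_relation_def by blast

text \<open>The level \<open>c\<close> is included into its sublevelset. \<open>left_chain\<close>
  matches the birth chains, and Mayer--Vietoris at \<open>c\<close> with zero over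
  \<open>{c..d}\<close> matches the kernels that describe death.\<close>

lemma DD_eq_Ord: "multiplicity_of smul (Lev i) 2 5 = multiplicity_of smul (Ext i) 2 3"
proof (rule multiplicity_of_transfer[OF zigzag_space_Lev zigzag_space_Ext, where t = 5 and t' = 3])
  let ?R = "\<lambda>x y. x \<in> h i {c} {} \<and> y = inc i {c} {} {..c} {} x"
  show "linear_relation smul smul ?R" by (rule linear_relationI) auto
  have dens: "interval_den (Lev i) 2 5 5 = lsub_pred (Lev i) 2 5 \<inter> rsub (Lev i) 5 5"
    "interval_den (Ext i) 2 3 3 = lsub_pred (Ext i) 2 3 \<inter> rsub (Ext i) 3 3"
    by (rule interval_den_zero; simp add: interval_ranges Lev_short_chains Ext_chains)+
  show "relates_quots ?R (interval_num (Lev i) 2 5 5) (interval_den (Lev i) 2 5 5)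
      (interval_num (Ext i) 2 3 3) (interval_den (Ext i) 2 3 3)"
    unfolding relates_quots_def dens interval_unfold
  proof (intro conjI ballI impI, goal_cases)
    case (1 x)
    then have x: "x \<in> h i {c} {}" "inc i {c} {} {c..d} {} x = 0" by auto
    have "inc i {c..d} {} {..d} {} (inc i {c} {} {c..d} {} x) = 0" unfolding x(2) by simp
    then have "inc i {c} {} {..d} {} x = 0" using x(1) by simp
    then show ?case using 1 by auto
  next
    case (2 y)
    then have y: "y \<in> h i {..c} {}" "inc i {..c} {} {..d} {} y = 0" by auto
    then obtain x where "x \<in> h i {c} {}" "inc i {c} {} {..c} {} x = y" "inc i {c} {} {c..d} {} x = 0"
      using cut_mayer_vietoris[OF cut_intervals(2)[OF cd], of y i 0] by auto
    then show ?case using 2 by auto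
  next
    case (3 x y)
    then show ?case by auto
  qed
qed (simp_all add: interval_ranges)

text \<open>A class on the level \<open>b\<close> and a relative class are related if the former
  becomes the boundary of the latter in the superlevelset of \<open>b\<close>. Given
  \<open>x\<close>, \<open>w\<close> is free up to absolute classes; given \<open>w\<close>,
  \<open>x\<close> is free up to classes that die over \<open>{b..}\<close>.\<close>

lemma UU_eq_Rel: "multiplicity_of smul (Lev i) 3 6 = multiplicity_of smul (Ext (i + 1)) 6 7"
proof (rule multiplicity_of_transfer[OF zigzag_space_Lev zigzag_space_Ext, where t = 3 and t' = 7])
  let ?R = "\<lambda>x w. x \<in> h i {b} {} \<and> w \<in> h (i + 1) UNIV {b..} \<and> inc i {b} {} {b..} {} x = bdry i UNIV {b..} w"
  show "linear_relation smul smul ?R" by (rule linear_relationI) auto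
  have dens: "interval_den (Lev i) 3 6 3 = lsub (Lev i) 3 3 \<inter> rsub_pred (Lev i) 6 3"
    "interval_den (Ext (i + 1)) 6 7 7 = lsub_pred (Ext (i + 1)) 6 7 \<inter> rsub (Ext (i + 1)) 7 7"
    by (rule interval_den_zero; simp add: interval_ranges Lev_short_chains Ext_chains)+
  show "relates_quots ?R (interval_num (Lev i) 3 6 3) (interval_den (Lev i) 3 6 3)
      (interval_num (Ext (i + 1)) 6 7 7) (interval_den (Ext (i + 1)) 6 7 7)"
    unfolding relates_quots_def dens interval_unfold
  proof (intro conjI ballI impI, goal_cases)
    case (1 x)
    then obtain u where x: "x \<in> h i {b} {}" "inc i {b} {} {a..b} {} x = 0"
      and u: "u \<in> h i {c..} {}" "inc i {b} {} {b..} {} x = inc i {c..} {} {b..} {} u" by auto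
    have "inc i {a..b} {} {a..} {} (inc i {b} {} {a..b} {} x) = 0" unfolding x(2) by simp
    moreover have "inc i {b..} {} {a..} {} (inc i {b} {} {b..} {} x) = inc i {b..} {} {a..} {} (inc i {c..} {} {b..} {} u)"
      unfolding u(2) ..
    ultimately have ua: "inc i {c..} {} {a..} {} u = 0" using x(1) u(1) by simp
    then have "inc i {a..} {} UNIV {} (inc i {c..} {} {a..} {} u) = 0" by simp
    then have "inc i {c..} {} UNIV {} u = 0" using u(1) by simp
    then obtain s where s: "s \<in> h (i + 1) UNIV {c..}" "u = bdry i UNIV {c..} s"
      using exact_slice_subspace[of "{c..}" UNIV u i] u(1) by auto
    have "bdry i UNIV {a..} (inc (i + 1) UNIV {c..} UNIV {a..} s) = 0"
      using s ua by (simp add: bdry_inc)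
    then obtain v where v: "v \<in> h (i + 1) UNIV {}"
        "inc (i + 1) UNIV {c..} UNIV {a..} s = inc (i + 1) UNIV {} UNIV {a..} v"
      using exact_slice_pair[of "{a..}" UNIV "inc (i + 1) UNIV {c..} UNIV {a..} s" i] s(1) by auto
    \<comment> \<open>Subtracting the absolute class \<open>v\<close> leaves the boundary unchanged
      and makes the class vanish relative to \<open>{a..}\<close>.\<close>
    define s' where "s' = s - inc (i + 1) UNIV {} UNIV {c..} v"
    have s': "s' \<in> h (i + 1) UNIV {c..}" "bdry i UNIV {c..} s' = u"
        "inc (i + 1) UNIV {c..} UNIV {a..} s' = 0"
      unfolding s'_def using s v by (simp_all add: bdry_inc_absolute)
    let ?w = "inc (i + 1) UNIV {c..} UNIV {b..} s'"
    have "bdry i UNIV {b..} ?w = inc i {b} {} {b..} {} x" using s' u(2) by (simp add: bdry_inc)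
    moreover have "inc (i + 1) UNIV {b..} UNIV {a..} ?w = 0" using s' by simp
    ultimately show ?case using s'(1) x(1) by (intro bexI[of _ ?w]) auto
  next
    case (2 w)
    then obtain s where w: "w \<in> h (i + 1) UNIV {b..}" "inc (i + 1) UNIV {b..} UNIV {a..} w = 0"
      and s: "s \<in> h (i + 1) UNIV {c..}" "w = inc (i + 1) UNIV {c..} UNIV {b..} s" by auto
    have bw: "bdry i UNIV {b..} w = inc i {c..} {} {b..} {} (bdry i UNIV {c..} s)"
      unfolding s(2) using s(1) by (intro bdry_inc) auto
    have "inc i {b..} {} {a..} {} (bdry i UNIV {b..} w) = bdry i UNIV {a..} (inc (i + 1) UNIV {b..} UNIV {a..} w)"
      using w(1) by (intro bdry_inc[symmetric]) auto
    then have "inc i {b..} {} {a..} {} (bdry i UNIV {b..} w) = 0" unfolding w(2) by simp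
    \<comment> \<open>Mayer--Vietoris at \<open>b\<close> with zero over \<open>{a..b}\<close>: the
      boundary of \<open>w\<close> dies in \<open>{a..}\<close> because \<open>w\<close> dies
      relative to it.\<close>
    then obtain x where "x \<in> h i {b} {}" "inc i {b} {} {a..b} {} x = 0" "inc i {b} {} {b..} {} x = bdry i UNIV {b..} w"
      using cut_mayer_vietoris[OF cut_intervals(3)[OF ab], of 0 i "bdry i UNIV {b..} w"] w(1) by auto
    then show ?case using bw s(1) w(1) by (intro bexI[of _ x]) auto
  next
    case (3 x w)
    then have x: "x \<in> h i {b} {}" and w: "w \<in> h (i + 1) UNIV {b..}"
      and xw: "inc i {b} {} {b..} {} x = bdry i UNIV {b..} w" by auto
    have "(\<exists>u\<in>h i {d..} {}. inc i {b} {} {b..} {} x = inc i {d..} {} {b..} {} u) \<longleftrightarrow>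
        (\<exists>t\<in>h (i + 1) UNIV {d..}. w = inc (i + 1) UNIV {d..} UNIV {b..} t)"
    proof
      assume "\<exists>u\<in>h i {d..} {}. inc i {b} {} {b..} {} x = inc i {d..} {} {b..} {} u"
      then obtain u where u: "u \<in> h i {d..} {}" "bdry i UNIV {b..} w = inc i {d..} {} {b..} {} u"
        using xw by auto
      have "inc i {b..} {} UNIV {} (bdry i UNIV {b..} w) = 0" using w by (simp add: inc_bdry)
      then have "inc i {d..} {} UNIV {} u = 0" unfolding u(2) using u(1) by simp
      then obtain t where t: "t \<in> h (i + 1) UNIV {d..}" "u = bdry i UNIV {d..} t"
        using exact_slice_subspace[of "{d..}" UNIV u i] u(1) by auto
      let ?t = "inc (i + 1) UNIV {d..} UNIV {b..} t"
      have "bdry i UNIV {b..} (w - ?t) = 0" using w t u(2) by (simp add: bdry_inc)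
      \<comment> \<open>The difference has zero boundary, so it is an absolute class; this also maps
        to the pair with \<open>{d..}\<close> and can be added to \<open>t\<close>.\<close>
      then obtain v where v: "v \<in> h (i + 1) UNIV {}" "w - ?t = inc (i + 1) UNIV {} UNIV {b..} v"
        using exact_slice_pair[of "{b..}" UNIV "w - ?t" i] w t(1) by auto
      have "w = ?t + inc (i + 1) UNIV {} UNIV {b..} v" using v(2) by (simp add: algebra_simps)
      also have "\<dots> = inc (i + 1) UNIV {d..} UNIV {b..} (t + inc (i + 1) UNIV {} UNIV {d..} v)"
        using t(1) v(1) by simp
      finally show "\<exists>t\<in>h (i + 1) UNIV {d..}. w = inc (i + 1) UNIV {d..} UNIV {b..} t"
        using t(1) v(1) by (intro bexI[of _ "t + inc (i + 1) UNIV {} UNIV {d..} v"]) auto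
    next
      assume "\<exists>t\<in>h (i + 1) UNIV {d..}. w = inc (i + 1) UNIV {d..} UNIV {b..} t"
      then obtain t where "t \<in> h (i + 1) UNIV {d..}" "w = inc (i + 1) UNIV {d..} UNIV {b..} t" by blast
      then show "\<exists>u\<in>h i {d..} {}. inc i {b} {} {b..} {} x = inc i {d..} {} {b..} {} u"
        using xw by (intro bexI[of _ "bdry i UNIV {d..} t"]) (auto simp: bdry_inc)
    qed
    then show ?case using 3 by auto
  qed
qed (simp_all add: interval_ranges)

text \<open>The relation is the one used for Ord, but here both chains may have nonzero
  predecessors. The denominators are genuine sums, and a splitting on one side has to be carried to
  the other.\<close>

lemma DU_eq_Ext_plus: "multiplicity_of smul (Lev i) 2 6 = multiplicity_of smul (Ext i) 2 5"
proof (rule multiplicity_of_transfer[OF zigzag_space_Lev zigzag_space_Ext, where t = 5 and t' = 3])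
  let ?R = "\<lambda>x y. x \<in> h i {c} {} \<and> y = inc i {c} {} {..c} {} x"
  show "linear_relation smul smul ?R" by (rule linear_relationI) auto
  have ker_c: "inc i {c} {} UNIV {c..} x = 0" if "x \<in> h i {c} {}" for x
  proof -
    have "inc i {c..} {} UNIV {c..} (inc i {c} {} {c..} {} x) = 0"
      using that by (intro exact_slice_space(2)) auto
    then show ?thesis using that by simp
  qed
  have ker_d: "inc i {d} {} UNIV {d..} x = 0" if "x \<in> h i {d} {}" for x
  proof -
    have "inc i {d..} {} UNIV {d..} (inc i {d} {} {d..} {} x) = 0"
      using that by (intro exact_slice_space(2)) auto
    then show ?thesis using that by simp
  qed
  have lift: "\<exists>x\<in>h i {c} {}. inc i {c} {} {..c} {} x = y"
    if "y \<in> h i {..c} {}" "inc i {..c} {} UNIV {c..} y = 0" for y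
    using cut_restrict[OF cut_intervals(4), of y i c] that by auto
  show "relates_quots ?R (interval_num (Lev i) 2 6 5) (interval_den (Lev i) 2 6 5)
      (interval_num (Ext i) 2 5 3) (interval_den (Ext i) 2 5 3)"
    unfolding relates_quots_def interval_unfold interval_den_def
  proof (intro conjI ballI impI, goal_cases)
    case (1 x)
    then show ?case using ker_c by auto
  next
    case (2 y)
    then show ?case using lift[of y] by auto
  next
    case (3 x y)
    then have x: "x \<in> h i {c} {}" and y: "y = inc i {c} {} {..c} {} x" by auto
    show ?case
    proof
      assume "x \<in> set_sum
        ({x \<in> h i {c} {}. \<exists>u\<in>h i {..a} {}. inc i {c} {} {..c} {} x = inc i {..a} {} {..c} {} u} \<inter> h i {c} {})
        ({x \<in> h i {c} {}. \<exists>u\<in>h i {..b} {}. inc i {c} {} {..c} {} x = inc i {..b} {} {..c} {} u} \<inter>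
         {x \<in> h i {c} {}. \<exists>w\<in>h i {d} {}. inc i {c} {} {c..d} {} x = inc i {d} {} {c..d} {} w})"
      then obtain x1 x2 w where x12: "x = x1 + x2"
        and x1: "x1 \<in> h i {c} {}" "\<exists>u\<in>h i {..a} {}. inc i {c} {} {..c} {} x1 = inc i {..a} {} {..c} {} u"
        and x2: "x2 \<in> h i {c} {}" "\<exists>u\<in>h i {..b} {}. inc i {c} {} {..c} {} x2 = inc i {..b} {} {..c} {} u"
        and w: "w \<in> h i {d} {}" "inc i {c} {} {c..d} {} x2 = inc i {d} {} {c..d} {} w"
        unfolding set_sum_def by blast
      have "inc i {c..d} {} UNIV {d..} (inc i {c} {} {c..d} {} x2) = inc i {c..d} {} UNIV {d..} (inc i {d} {} {c..d} {} w)"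
        unfolding w(2) ..
      then have "inc i {c} {} UNIV {d..} x2 = 0" using w(1) x2(1) ker_d by simp
      moreover have "y = inc i {c} {} {..c} {} x1 + inc i {c} {} {..c} {} x2"
        unfolding y x12 using x1(1) x2(1) by simp
      ultimately show "y \<in> set_sum
        ({y \<in> h i {..c} {}. \<exists>u\<in>h i {..a} {}. y = inc i {..a} {} {..c} {} u} \<inter>
         {y \<in> h i {..c} {}. inc i {..c} {} UNIV {c..} y = 0})
        ({y \<in> h i {..c} {}. \<exists>u\<in>h i {..b} {}. y = inc i {..b} {} {..c} {} u} \<inter>
         {y \<in> h i {..c} {}. inc i {..c} {} UNIV {d..} y = 0})"
        unfolding set_sum_def using x1 x2 ker_c
        by (intro CollectI exI[of _ "inc i {c} {} {..c} {} x1"] exI[of _ "inc i {c} {} {..c} {} x2"]) auto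
    next
      assume "y \<in> set_sum
        ({y \<in> h i {..c} {}. \<exists>u\<in>h i {..a} {}. y = inc i {..a} {} {..c} {} u} \<inter>
         {y \<in> h i {..c} {}. inc i {..c} {} UNIV {c..} y = 0})
        ({y \<in> h i {..c} {}. \<exists>u\<in>h i {..b} {}. y = inc i {..b} {} {..c} {} u} \<inter>
         {y \<in> h i {..c} {}. inc i {..c} {} UNIV {d..} y = 0})"
      then obtain y1 y2 where y12: "y = y1 + y2"
        and y1: "y1 \<in> h i {..c} {}" "\<exists>u\<in>h i {..a} {}. y1 = inc i {..a} {} {..c} {} u"
          "inc i {..c} {} UNIV {c..} y1 = 0"
        and y2: "y2 \<in> h i {..c} {}" "\<exists>u\<in>h i {..b} {}. y2 = inc i {..b} {} {..c} {} u"
          "inc i {..c} {} UNIV {d..} y2 = 0"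
        unfolding set_sum_def by blast
      have "inc i UNIV {d..} UNIV {c..} (inc i {..c} {} UNIV {d..} y2) = 0" unfolding y2(3) by simp
      then obtain x2 where x2: "x2 \<in> h i {c} {}" "inc i {c} {} {..c} {} x2 = y2"
        using lift[of y2] y2(1) by auto
      have "inc i {..d} {} UNIV {d..} (inc i {..c} {} {..d} {} y2) = 0" using y2 by simp
      then obtain w where w: "w \<in> h i {d} {}" "inc i {d} {} {..d} {} w = inc i {..c} {} {..d} {} y2"
        using cut_restrict[OF cut_intervals(4), of "inc i {..c} {} {..d} {} y2" i d] y2(1) by auto
      have "inc i {c..d} {} {..d} {} (inc i {c} {} {c..d} {} x2 - inc i {d} {} {c..d} {} w) = 0"
        using x2(1) w by (simp add: x2(2)[symmetric])
      \<comment> \<open>The lift \<open>x2\<close> of \<open>y2\<close> need not agree with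
        \<open>w\<close> over \<open>{c..d}\<close>, but in \<open>{..d}\<close> both give the image
        of \<open>y2\<close>. Mayer--Vietoris for zero over \<open>{..c}\<close> and the difference
        over \<open>{c..d}\<close> yields the correction \<open>m\<close>, which is invisible in
        \<open>{..c}\<close>.\<close>
      then obtain m where m: "m \<in> h i {c} {}" "inc i {c} {} {..c} {} m = 0"
          "inc i {c} {} {c..d} {} m = inc i {c} {} {c..d} {} x2 - inc i {d} {} {c..d} {} w"
        using cut_mayer_vietoris[OF cut_intervals(2)[OF cd], of 0 i
            "inc i {c} {} {c..d} {} x2 - inc i {d} {} {c..d} {} w"] x2(1) w(1) by auto
      have a: "inc i {c} {} {c..d} {} (x2 - m) = inc i {d} {} {c..d} {} w"
        "inc i {c} {} {..c} {} (x2 - m) = y2" "inc i {c} {} {..c} {} (x - (x2 - m)) = y1"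
        using x x2 m y y12 by (simp_all add: diff_eq_eq)
      show "x \<in> set_sum
        ({x \<in> h i {c} {}. \<exists>u\<in>h i {..a} {}. inc i {c} {} {..c} {} x = inc i {..a} {} {..c} {} u} \<inter> h i {c} {})
        ({x \<in> h i {c} {}. \<exists>u\<in>h i {..b} {}. inc i {c} {} {..c} {} x = inc i {..b} {} {..c} {} u} \<inter>
         {x \<in> h i {c} {}. \<exists>w\<in>h i {d} {}. inc i {c} {} {c..d} {} x = inc i {d} {} {c..d} {} w})"
        unfolding set_sum_def using x x2(1) m(1) w(1) a y1(2) y2(2)
        by (intro CollectI exI[of _ "x - (x2 - m)"] exI[of _ "x2 - m"]) auto
    qed
  qed
qed (simp_all add: interval_ranges)

text \<open>A class of the sublevelset of \<open>d\<close> that vanishes relative to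
  \<open>{a..}\<close> is carried by \<open>{a..d}\<close>, and cutting it at \<open>b\<close>
  lowers the degree by one. The cut class dies in \<open>{b..c}\<close> exactly when the original
  is, in \<open>{..d}\<close>, a sum of a class from \<open>{a..c}\<close> and one from
  \<open>{b..d}\<close>; this matches the denominators.\<close>

lemma UD_eq_Ext_minus: "multiplicity_of smul (Lev i) 3 5 = multiplicity_of smul (Ext (i + 1)) 4 7"
proof (rule multiplicity_of_transfer[OF zigzag_space_Lev zigzag_space_Ext, where t = 3 and t' = 4])
  \<comment> \<open>\<open>x\<close> is the image of \<open>\<eta>\<close> under the Mayer--Vietoris connecting map at the level \<open>b\<close>, with \<open>\<xi>\<close>
    the class that corresponds to \<open>\<eta>\<close> under excision\<close>
  let ?L = "\<lambda>x y \<xi> \<eta>. \<xi> \<in> h (i + 1) {a..b} {b} \<and> \<eta> \<in> h (i + 1) {a..d} {} \<and> x = bdry i {a..b} {b} \<xi> \<and>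
    inc (i + 1) {a..b} {b} {a..d} {b..d} \<xi> = inc (i + 1) {a..d} {} {a..d} {b..d} \<eta> \<and>
    y = inc (i + 1) {a..d} {} {..d} {} \<eta>"
  let ?R = "\<lambda>x y. \<exists>\<xi> \<eta>. ?L x y \<xi> \<eta>"
  have cut_abd: "cut b {a..b} {b..d} {a..d}" and cut_abc: "cut b {a..b} {b..c} {a..c}"
    by (rule cut_intervals(1); simp add: less_trans[OF bc cd])+
  show "linear_relation smul smul ?R"
  proof (rule linear_relationI)
    show "?R 0 0" by (rule exI[of _ 0], rule exI[of _ 0]) simp
    show "?R (x + x') (y + y')" if R: "?R x y" "?R x' y'" for x y x' y'
    proof -
      from R obtain \<xi> \<eta> \<xi>' \<eta>' where "?L x y \<xi> \<eta>" "?L x' y' \<xi>' \<eta>'" by blast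
      then have "?L (x + x') (y + y') (\<xi> + \<xi>') (\<eta> + \<eta>')" by simp
      then show ?thesis by blast
    qed
    show "?R (smul k x) (smul k y)" if R: "?R x y" for k x y
    proof -
      from R obtain \<xi> \<eta> where "?L x y \<xi> \<eta>" by blast
      then have "?L (smul k x) (smul k y) (smul k \<xi>) (smul k \<eta>)" by simp
      then show ?thesis by blast
    qed
  qed
  have den: "interval_den (Lev i) 3 5 3 = lsub (Lev i) 3 3 \<inter> rsub_pred (Lev i) 5 3"
    by (rule interval_den_zero; simp add: interval_ranges Lev_short_chains)
  have ker_a: "inc (i + 1) {a..d} {} UNIV {a..} \<eta> = 0" if "\<eta> \<in> h (i + 1) {a..d} {}" for \<eta>
  proof -
    have "inc (i + 1) {a..} {} UNIV {a..} (inc (i + 1) {a..d} {} {a..} {} \<eta>) = 0"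
      using that by (intro exact_slice_space(2)) auto
    then show ?thesis using that by simp
  qed
  have ker_b: "inc (i + 1) {b..d} {} UNIV {b..} \<kappa> = 0" if "\<kappa> \<in> h (i + 1) {b..d} {}" for \<kappa>
  proof -
    have "inc (i + 1) {b..} {} UNIV {b..} (inc (i + 1) {b..d} {} {b..} {} \<kappa>) = 0"
      using that by (intro exact_slice_space(2)) auto
    then show ?thesis using that by simp
  qed
  show "relates_quots ?R (interval_num (Lev i) 3 5 3) (interval_den (Lev i) 3 5 3)
      (interval_num (Ext (i + 1)) 4 7 4) (interval_den (Ext (i + 1)) 4 7 4)"
    unfolding relates_quots_def den interval_unfold interval_den_def[of "Ext (i + 1)"]
  proof (intro conjI ballI impI, goal_cases)
    case (1 x)
    then obtain z where x: "x \<in> h i {b} {}" "inc i {b} {} {a..b} {} x = 0"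
      and z: "z \<in> h i {c} {}" "inc i {b} {} {b..c} {} x = inc i {c} {} {b..c} {} z" "inc i {c} {} {c..d} {} z = 0"
      by auto
    \<comment> \<open>\<open>x\<close> is moved across \<open>{b..c}\<close> to the level
      \<open>c\<close>, where it continues into \<open>{c..d}\<close> as zero; so it dies in
      \<open>{b..d}\<close>, as a connecting image at \<open>b\<close> must.\<close>
    have "inc i {b..c} {} {b..d} {} (inc i {b} {} {b..c} {} x) = inc i {c} {} {b..d} {} z"
      unfolding z(2) using z(1) by simp
    also have "\<dots> = inc i {c..d} {} {b..d} {} (inc i {c} {} {c..d} {} z)" using z(1) by simp
    also have "\<dots> = 0" unfolding z(3) by simp
    finally have xd: "inc i {b} {} {b..d} {} x = 0" using x(1) by simp
    obtain \<xi> where \<xi>: "\<xi> \<in> h (i + 1) {a..b} {b}" "x = bdry i {a..b} {b} \<xi>"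
      using exact_slice_subspace[of "{b}" "{a..b}" x i] x by auto
    have "bdry i {a..d} {b..d} (inc (i + 1) {a..b} {b} {a..d} {b..d} \<xi>) = 0"
      using \<xi> xd by (simp add: bdry_inc)
    then obtain \<eta> where \<eta>: "\<eta> \<in> h (i + 1) {a..d} {}"
        "inc (i + 1) {a..b} {b} {a..d} {b..d} \<xi> = inc (i + 1) {a..d} {} {a..d} {b..d} \<eta>"
      using exact_slice_pair[of "{b..d}" "{a..d}" "inc (i + 1) {a..b} {b} {a..d} {b..d} \<xi>" i] \<xi>(1) by auto
    show ?case
      using \<xi> \<eta> ker_a by (intro bexI[of _ "inc (i + 1) {a..d} {} {..d} {} \<eta>"] exI[of _ \<xi>] exI[of _ \<eta>]) auto
  next
    case (2 y)
    then have y: "y \<in> h (i + 1) {..d} {}" "inc (i + 1) {..d} {} UNIV {a..} y = 0" by auto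
    \<comment> \<open>Cut the sublevelset of \<open>d\<close> and the whole space at the same level
      \<open>a\<close>.\<close>
    obtain \<eta> where \<eta>: "\<eta> \<in> h (i + 1) {a..d} {}" "y = inc (i + 1) {a..d} {} {..d} {} \<eta>"
      using cut_restrict_upper[OF cut_intervals(2) cut_intervals(4), of a d y "i + 1"] y
        less_trans[OF ab less_trans[OF bc cd]] by auto
    have "inc (i + 1) {a..d} {} {a..d} {b..d} \<eta> \<in> inc (i + 1) {a..b} {b} {a..d} {b..d} ` h (i + 1) {a..b} {b}"
      unfolding bij_betw_imp_surj_on[OF cut_excision[OF cut_abd]] using \<eta>(1) by simp
    then obtain \<xi> where \<xi>: "\<xi> \<in> h (i + 1) {a..b} {b}"
        "inc (i + 1) {a..b} {b} {a..d} {b..d} \<xi> = inc (i + 1) {a..d} {} {a..d} {b..d} \<eta>"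
      by auto
    define x where "x = bdry i {a..b} {b} \<xi>"
    have x: "x \<in> h i {b} {}" "inc i {b} {} {a..b} {} x = 0" unfolding x_def using \<xi>(1) by (simp_all add: inc_bdry)
    have "inc i {b} {} {b..d} {} x = bdry i {a..d} {b..d} (inc (i + 1) {a..b} {b} {a..d} {b..d} \<xi>)"
      unfolding x_def using \<xi>(1) by (simp add: bdry_inc)
    also have "\<dots> = 0" unfolding \<xi>(2) using \<eta>(1) by (simp add: bdry_inc_absolute)
    finally obtain z where "z \<in> h i {c} {}" "inc i {c} {} {b..c} {} z = inc i {b} {} {b..c} {} x"
        "inc i {c} {} {c..d} {} z = 0"
      using cut_mayer_vietoris[OF cut_intervals(1)[OF bc cd], of "inc i {b} {} {b..c} {} x" i 0] x(1) by auto
    then have "\<exists>z\<in>h i {c} {}. inc i {b} {} {b..c} {} x = inc i {c} {} {b..c} {} z \<and> inc i {c} {} {c..d} {} z = 0"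
      by metis
    then have "x \<in> {x \<in> h i {b} {}. inc i {b} {} {a..b} {} x = 0} \<inter> {x \<in> h i {b} {}.
        \<exists>z\<in>h i {c} {}. inc i {b} {} {b..c} {} x = inc i {c} {} {b..c} {} z \<and> inc i {c} {} {c..d} {} z = 0}"
      using x by blast
    moreover have "?L x y \<xi> \<eta>" using \<xi> \<eta> x_def by simp
    ultimately show ?case by blast
  next
    case (3 x y)
    then obtain \<xi> \<eta> where \<xi>: "\<xi> \<in> h (i + 1) {a..b} {b}" "x = bdry i {a..b} {b} \<xi>"
      and \<eta>: "\<eta> \<in> h (i + 1) {a..d} {}" "y = inc (i + 1) {a..d} {} {..d} {} \<eta>"
      and eq: "inc (i + 1) {a..b} {b} {a..d} {b..d} \<xi> = inc (i + 1) {a..d} {} {a..d} {b..d} \<eta>" by blast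
    have x: "x \<in> h i {b} {}" "inc i {b} {} {a..b} {} x = 0" using 3 by auto
    \<comment> \<open>The class of \<open>\<xi>\<close> with upper part shrunk from
      \<open>{b..d}\<close> to \<open>{b..c}\<close>: its boundary is the image of \<open>x\<close>
      in \<open>{b..c}\<close>, whose vanishing is the predecessor condition.\<close>
    define \<zeta> where "\<zeta> = inc (i + 1) {a..b} {b} {a..c} {b..c} \<xi>"
    have \<zeta>: "\<zeta> \<in> h (i + 1) {a..c} {b..c}" "bdry i {a..c} {b..c} \<zeta> = inc i {b} {} {b..c} {} x"
        "inc (i + 1) {a..c} {b..c} {a..d} {b..d} \<zeta> = inc (i + 1) {a..d} {} {a..d} {b..d} \<eta>"
      unfolding \<zeta>_def eq[symmetric] using \<xi> by (simp_all add: bdry_inc)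
    have kap: "inc (i + 1) {b..d} {} {a..d} {b..d} \<kappa> = 0" if "\<kappa> \<in> h (i + 1) {b..d} {}" for \<kappa>
      using that by (intro exact_slice_space(2)) auto
    show ?case
    proof
      assume "x \<in> {x \<in> h i {b} {}. inc i {b} {} {a..b} {} x = 0} \<inter> {x \<in> h i {b} {}. inc i {b} {} {b..c} {} x = 0}"
      then have "bdry i {a..c} {b..c} \<zeta> = 0" using \<zeta>(2) by simp
      then obtain \<theta> where \<theta>: "\<theta> \<in> h (i + 1) {a..c} {}" "\<zeta> = inc (i + 1) {a..c} {} {a..c} {b..c} \<theta>"
        using exact_slice_pair[of "{b..c}" "{a..c}" \<zeta> i] \<zeta>(1) by auto
      have "inc (i + 1) {a..d} {} {a..d} {b..d} (\<eta> - inc (i + 1) {a..c} {} {a..d} {} \<theta>) = 0"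
        using \<zeta>(3) \<theta> \<eta>(1) by simp
      then obtain \<kappa> where \<kappa>: "\<kappa> \<in> h (i + 1) {b..d} {}"
          "\<eta> - inc (i + 1) {a..c} {} {a..d} {} \<theta> = inc (i + 1) {b..d} {} {a..d} {} \<kappa>"
        using exact_slice_space(1)[of "{b..d}" "{a..d}" "\<eta> - inc (i + 1) {a..c} {} {a..d} {} \<theta>" "i + 1"]
          \<theta>(1) \<eta>(1) by auto
      have "\<eta> = inc (i + 1) {a..c} {} {a..d} {} \<theta> + inc (i + 1) {b..d} {} {a..d} {} \<kappa>"
        using \<kappa>(2) by (simp add: algebra_simps)
      then have y: "y = inc (i + 1) {a..c} {} {..d} {} \<theta> + inc (i + 1) {b..d} {} {..d} {} \<kappa>"
        unfolding \<eta>(2) using \<theta>(1) \<kappa>(1) by simp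
      have "inc (i + 1) {a..d} {} UNIV {a..} (inc (i + 1) {a..c} {} {a..d} {} \<theta>) = 0"
        using \<theta>(1) by (intro ker_a) simp
      then have "inc (i + 1) {a..c} {} UNIV {a..} \<theta> = 0" using \<theta>(1) by simp
      moreover have "\<exists>u\<in>h (i + 1) {..c} {}. inc (i + 1) {a..c} {} {..d} {} \<theta> = inc (i + 1) {..c} {} {..d} {} u"
        using \<theta>(1) by (intro bexI[of _ "inc (i + 1) {a..c} {} {..c} {} \<theta>"]) auto
      ultimately show "y \<in> set_sum
         ({y \<in> h (i + 1) {..d} {}. \<exists>u\<in>h (i + 1) {..c} {}. y = inc (i + 1) {..c} {} {..d} {} u} \<inter>
          {y \<in> h (i + 1) {..d} {}. inc (i + 1) {..d} {} UNIV {a..} y = 0})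
         (h (i + 1) {..d} {} \<inter> {y \<in> h (i + 1) {..d} {}. inc (i + 1) {..d} {} UNIV {b..} y = 0})"
        unfolding set_sum_def using y \<theta>(1) \<kappa>(1) ker_b
        by (intro CollectI exI[of _ "inc (i + 1) {a..c} {} {..d} {} \<theta>"]
            exI[of _ "inc (i + 1) {b..d} {} {..d} {} \<kappa>"]) auto
    next
      assume "y \<in> set_sum
         ({y \<in> h (i + 1) {..d} {}. \<exists>u\<in>h (i + 1) {..c} {}. y = inc (i + 1) {..c} {} {..d} {} u} \<inter>
          {y \<in> h (i + 1) {..d} {}. inc (i + 1) {..d} {} UNIV {a..} y = 0})
         (h (i + 1) {..d} {} \<inter> {y \<in> h (i + 1) {..d} {}. inc (i + 1) {..d} {} UNIV {b..} y = 0})"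
      then obtain w v where yw: "y = inc (i + 1) {..c} {} {..d} {} w + v" and w: "w \<in> h (i + 1) {..c} {}"
          "inc (i + 1) {..d} {} UNIV {a..} (inc (i + 1) {..c} {} {..d} {} w) = 0"
        and v: "v \<in> h (i + 1) {..d} {}" "inc (i + 1) {..d} {} UNIV {b..} v = 0"
        unfolding set_sum_def by blast
      obtain \<theta> where \<theta>: "\<theta> \<in> h (i + 1) {a..c} {}" "w = inc (i + 1) {a..c} {} {..c} {} \<theta>"
        using cut_restrict_upper[OF cut_intervals(2) cut_intervals(4), of a c w "i + 1"] w
          less_trans[OF ab bc] by auto
      obtain \<kappa> where \<kappa>: "\<kappa> \<in> h (i + 1) {b..d} {}" "v = inc (i + 1) {b..d} {} {..d} {} \<kappa>"
        using cut_restrict_upper[OF cut_intervals(2) cut_intervals(4), of b d v "i + 1"] v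
          less_trans[OF bc cd] by auto
      define \<delta> where "\<delta> = \<eta> - inc (i + 1) {a..c} {} {a..d} {} \<theta> - inc (i + 1) {b..d} {} {a..d} {} \<kappa>"
      have \<delta>: "\<delta> \<in> h (i + 1) {a..d} {}" unfolding \<delta>_def using \<eta>(1) \<theta>(1) \<kappa>(1) by simp
      have "inc (i + 1) {a..d} {} {..d} {} \<delta> = 0"
        unfolding \<delta>_def using \<eta> \<theta> \<kappa> yw by (simp add: algebra_simps)
      \<comment> \<open>The splitting of \<open>y\<close> holds only in \<open>{..d}\<close>. Over
        \<open>{a..d}\<close> the error \<open>\<delta>\<close> comes from the level
        \<open>a\<close>, by Mayer--Vietoris with zero over \<open>{..a}\<close>, and since that
        level lies in \<open>{a..c}\<close> it can be added to \<open>\<theta>\<close>.\<close>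
      then obtain z where z: "z \<in> h (i + 1) {a} {}" "inc (i + 1) {a} {} {a..d} {} z = \<delta>"
        using cut_mayer_vietoris[OF cut_intervals(2), of a d 0 "i + 1" \<delta>] \<delta>
          less_trans[OF ab less_trans[OF bc cd]] by auto
      define \<theta>' where "\<theta>' = \<theta> + inc (i + 1) {a} {} {a..c} {} z"
      have \<theta>': "\<theta>' \<in> h (i + 1) {a..c} {}" unfolding \<theta>'_def using \<theta>(1) z(1) by simp
      have "\<eta> = inc (i + 1) {a..c} {} {a..d} {} \<theta>' + inc (i + 1) {b..d} {} {a..d} {} \<kappa>"
        unfolding \<theta>'_def using \<theta>(1) z \<delta>_def by (simp add: algebra_simps)
      then have "inc (i + 1) {a..d} {} {a..d} {b..d} \<eta> = inc (i + 1) {a..c} {} {a..d} {b..d} \<theta>'"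
        using \<theta>' \<kappa>(1) kap by simp
      then have "inc (i + 1) {a..c} {b..c} {a..d} {b..d} (\<zeta> - inc (i + 1) {a..c} {} {a..c} {b..c} \<theta>') = 0"
        using \<zeta> \<theta>' by simp
      \<comment> \<open>Both relative groups are excised to the pair over \<open>{a..b}\<close> and
        \<open>{b}\<close>, so passing from \<open>c\<close> to \<open>d\<close> loses
        nothing.\<close>
      then have "\<zeta> - inc (i + 1) {a..c} {} {a..c} {b..c} \<theta>' = 0"
        by (rule cut_excision_inj[OF cut_abc cut_abd, rotated 2]) (use \<zeta>(1) \<theta>' in auto)
      then have "inc i {b} {} {b..c} {} x = 0"
        using \<zeta>(2) \<theta>' by (simp add: bdry_inc_absolute)
      then show "x \<in> {x \<in> h i {b} {}. inc i {b} {} {a..b} {} x = 0} \<inter> {x \<in> h i {b} {}. inc i {b} {} {b..c} {} x = 0}"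
        using x by simp
    qed
  qed
qed (simp_all add: interval_ranges)

end

end

theorem theorem3p18:
  fixes smul :: "'k::field \<Rightarrow> 'v::ab_group_add \<Rightarrow> 'v"
    and H :: "int \<Rightarrow> 'a topology \<Rightarrow> 'a set \<Rightarrow> 'v set"
    and Hmap :: "int \<Rightarrow> 'a topology \<Rightarrow> 'a set \<Rightarrow> 'a topology \<Rightarrow> 'a set \<Rightarrow> ('a \<Rightarrow> 'a) \<Rightarrow> 'v \<Rightarrow> 'v"
    and bd :: "int \<Rightarrow> 'a topology \<Rightarrow> 'a set \<Rightarrow> 'v \<Rightarrow> 'v"
    and X :: "'a topology" and f :: "'a \<Rightarrow> real"
  assumes "homology_theory smul H Hmap bd"
    and "continuous_map X euclideanreal f"
    and "\<And>q. taut_levelset H Hmap X f q"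
  shows "\<forall>i a b c d. a < b \<and> b < c \<and> c < d \<longrightarrow>
     mu_DD smul H Hmap X f i a b c d = mu_Ord smul H Hmap X f i a b c d \<and>
     mu_UU smul H Hmap X f i a b c d = mu_Rel smul H Hmap X f (i + 1) a b c d \<and>
     mu_DU smul H Hmap X f i a b c d = mu_Ext_plus smul H Hmap X f i a b c d \<and>
     mu_UD smul H Hmap X f i a b c d = mu_Ext_minus smul H Hmap X f (i + 1) a b c d"
proof -
  interpret taut_space smul H Hmap bd X f
    using assms by (intro taut_space.intro taut_space_axioms.intro)
  show ?thesis
    unfolding mu_DD_def mu_UU_def mu_DU_def mu_UD_def mu_Ord_def mu_Rel_def mu_Ext_plus_def mu_Ext_minus_def
    by (intro allI impI conjI DD_eq_Ord UU_eq_Rel DU_eq_Ext_plus UD_eq_Ext_minus) auto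
qed

end
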